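(* Let $1\leq p,q\leq\infty$, $0\leq r<\frac1p$, let $b\geq2$ be an integer and $\sigma$ a permutation of $\{0,\dots,b-1\}$. Then there is a constant $C>0$, independent of $n$ and of $\Sigma$, such that for all $n\ge1$ and all $\Sigma\in\{\sigma,\overline\sigma\}^n$, with $\widetilde N=2b^n$, $$\left\|D_{\widetilde N}(\mathcal R_{b,n}^{\Sigma,\mathrm{sym}},\cdot)\mid S_{p,q}^rB([0,1)^2)\right\|\leq C\,\widetilde N^{r-1}(\log\widetilde N)^{\frac1q}.$$
   Context: $\tau(k)=b-1-k$ on $\{0,\dots,b-1\}$, $\overline\sigma=\tau\circ\sigma$. For $\Sigma=(\sigma_1,\dots,\sigma_n)\in\{\sigma,\overline\sigma\}^n$, $\mathcal{R}_{b,n}^{\Sigma}=\left\{\left(\frac{\sigma_n(a_n)}{b}+\dots+\frac{\sigma_1(a_1)}{b^n},\ \frac{a_1}{b}+\dots+\frac{a_n}{b^n}\right): a_i\in\{0,\dots,b-1\}\right\}$. With $\Sigma^*=(\tau\circ\sigma_1,\dots,\tau\circ\sigma_n)$, the symmetrized Hammersley point set is the $2b^n$-point set (multiset union) $\mathcal R_{b,n}^{\Sigma,\mathrm{sym}}=\mathcal R_{b,n}^{\Sigma}\cup\mathcal R_{b,n}^{\Sigma^*}$. For an $N$-point set $\mathcal P=\{\mathbf x_0,\dots,\mathbf x_{N-1}\}\subset[0,1)^s$, $D_N(\mathcal P,\mathbf t)=\frac1N\sum_{n=0}^{N-1}\mathbf 1_{[\mathbf 0,\mathbf t)}(\mathbf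 x_n)-\prod_i t_i$; $\log$ is natural log, $(\log\widetilde N)^{1/q}=1$ for $q=\infty$. Besov space: fix $\phi_0\in\mathcal S(\mathbb R)$ with $\phi_0=1$ on $|t|\le1$, $\phi_0=0$ on $|t|>3/2$; $\phi_d(t)=\phi_0(2^{-d}t)-\phi_0(2^{-d+1}t)$ ($d\in\mathbb N$), $\phi_{\mathbf d}(\mathbf t)=\prod_i\phi_{d_i}(t_i)$. $S^r_{p,q}B(\mathbb R^s)$: tempered distributions with finite $\left(\sum_{\mathbf d\in\mathbb N_0^s}2^{r(d_1+\dots+d_s)q}\|\mathcal F^{-1}(\phi_{\mathbf d}\mathcal Ff)\mid L_p(\mathbb R^s)\|^q\right)^{1/q}$ (sup if $q=\infty$); $\|f\mid S^r_{p,q}B([0,1)^s)\|=\inf\{\|g\mid S^r_{p,q}B(\mathbb R^s)\|: g|_{[0,1)^s}=f\}$. *)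

theory Defs
  imports
    "HOL-Analysis.Analysis"
    "HOL-Probability.Essential_Supremum"
    "HOL-Combinatorics.Permutations"
begin

section \<open>Powers of extended nonnegative reals\<close>

text \<open>Only used with exponents \<open>a > 0\<close>, so that \<open>0\<close> and \<open>\<infinity>\<close> are fixed.\<close>

definition epowr :: "ennreal \<Rightarrow> real \<Rightarrow> ennreal" where
  "epowr x a = (if x = \<infinity> then \<infinity> else ennreal (enn2real x powr a))"


section \<open>Smooth functions, Schwartz functions and tempered distributions\<close>

text \<open>A partial derivative of order \<open>k\<close> is given by a list of \<open>k\<close> coordinate directions.\<close>

primrec iterated_partial :: "'a::euclidean_space list \<Rightarrow> ('a \<Rightarrow> complex) \<Rightarrow> 'a \<Rightarrow> complex" where
  "iterated_partial [] f = f"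
| "iterated_partial (v # vs) f = (\<lambda>x. frechet_derivative (iterated_partial vs f) (at x) v)"

text \<open>
  Differentiability everywhere of all iterated partial derivatives; since differentiable
  functions are continuous, this is \<open>C\<^sup>\<infinity>\<close>.
\<close>

definition smooth :: "('a::euclidean_space \<Rightarrow> complex) \<Rightarrow> bool" where
  "smooth f \<longleftrightarrow>
     (\<forall>vs. set vs \<subseteq> Basis \<longrightarrow> (\<forall>x. iterated_partial vs f differentiable (at x)))"

definition schwartz :: "('a::euclidean_space \<Rightarrow> complex) set" where
  "schwartz = {f. smooth f \<and>
     (\<forall>k vs. set vs \<subseteq> Basis \<longrightarrow>
        bounded (range (\<lambda>x. norm x ^ k * norm (iterated_partial vs f x))))}"

definition schwartz_seminorm ::
    "nat \<Rightarrow> 'a::euclidean_space list \<Rightarrow> ('a \<Rightarrow> complex) \<Rightarrow> real" where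
  "schwartz_seminorm k vs f = (SUP x. norm x ^ k * norm (iterated_partial vs f x))"

text \<open>
  Distributions are functionals on all of \<open>'a \<Rightarrow> complex\<close>, of which only the values on the
  relevant test functions (Schwartz functions, or compactly supported smooth functions) matter.
  Continuity is stated as domination by finitely many of the seminorms that generate the
  topology of the Schwartz space.
\<close>

type_synonym 'a distr = "('a \<Rightarrow> complex) \<Rightarrow> complex"

definition tempered_distribution :: "'a::euclidean_space distr \<Rightarrow> bool" where
  "tempered_distribution T \<longleftrightarrow>
     (\<forall>f\<in>schwartz. \<forall>g\<in>schwartz. T (\<lambda>x. f x + g x) = T f + T g) \<and>
     (\<forall>c. \<forall>f\<in>schwartz. T (\<lambda>x. c * f x) = c * T f) \<and>
     (\<exists>C m. \<forall>f\<in>schwartz.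
        norm (T f) \<le> C * (\<Sum>(k, vs)\<in>{..m} \<times> {vs. set vs \<subseteq> Basis \<and> length vs \<le> m}.
                              schwartz_seminorm k vs f))"

definition test_functions :: "'a::euclidean_space set \<Rightarrow> ('a \<Rightarrow> complex) set" where
  "test_functions U =
     {f. smooth f \<and> compact (closure {x. f x \<noteq> 0}) \<and> closure {x. f x \<noteq> 0} \<subseteq> U}"

definition regular_distr :: "'a::euclidean_space set \<Rightarrow> ('a \<Rightarrow> complex) \<Rightarrow> 'a distr" where
  "regular_distr A h = (\<lambda>\<psi>. LINT x:A|lborel. h x * \<psi> x)"

text \<open>Equality on the domain \<open>A\<close> is tested in the interior of \<open>A\<close>.\<close>

definition restricts_to :: "'a::euclidean_space set \<Rightarrow> 'a distr \<Rightarrow> 'a distr \<Rightarrow> bool" where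
  "restricts_to A g f \<longleftrightarrow> (\<forall>\<psi>\<in>test_functions (interior A). g \<psi> = f \<psi>)"


section \<open>Fourier transform\<close>

text \<open>
  Unitary normalization
  \<open>(\<F> f)(\<xi>) = (2 \<pi>)\<^bsup>-s/2\<^esup> \<integral> e\<^bsup>-i x \<bullet> \<xi>\<^esup> f(x) dx\<close> in dimension \<open>s\<close>, extended to
  distributions by duality.
\<close>

definition fourier :: "('a::euclidean_space \<Rightarrow> complex) \<Rightarrow> 'a \<Rightarrow> complex" where
  "fourier f = (\<lambda>\<xi>. complex_of_real ((2 * pi) powr (- real DIM('a) / 2)) *
     (LINT x|lborel. cis (- (x \<bullet> \<xi>)) * f x))"

definition inverse_fourier :: "('a::euclidean_space \<Rightarrow> complex) \<Rightarrow> 'a \<Rightarrow> complex" where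
  "inverse_fourier f = (\<lambda>x. complex_of_real ((2 * pi) powr (- real DIM('a) / 2)) *
     (LINT \<xi>|lborel. cis (x \<bullet> \<xi>) * f \<xi>))"

definition fourier_distr :: "'a::euclidean_space distr \<Rightarrow> 'a distr" where
  "fourier_distr T = (\<lambda>\<psi>. T (fourier \<psi>))"

definition inverse_fourier_distr :: "'a::euclidean_space distr \<Rightarrow> 'a distr" where
  "inverse_fourier_distr T = (\<lambda>\<psi>. T (inverse_fourier \<psi>))"

definition mult_distr :: "('a \<Rightarrow> complex) \<Rightarrow> 'a distr \<Rightarrow> 'a distr" where
  "mult_distr m T = (\<lambda>\<psi>. T (\<lambda>x. m x * \<psi> x))"


section \<open>Besov spaces of dominating mixed smoothness\<close>

definition Lp_norm :: "ennreal \<Rightarrow> ('a::euclidean_space \<Rightarrow> complex) \<Rightarrow> ennreal" where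
  "Lp_norm p h =
     (if p = \<infinity> then esssup lborel (\<lambda>x. ennreal (norm (h x)))
      else epowr (\<integral>\<^sup>+ x. ennreal (norm (h x) powr enn2real p) \<partial>lborel) (1 / enn2real p))"

definition represents_distr :: "('a::euclidean_space \<Rightarrow> complex) \<Rightarrow> 'a distr \<Rightarrow> bool" where
  "represents_distr h T \<longleftrightarrow>
     h \<in> borel_measurable lborel \<and>
     (\<forall>\<psi>\<in>schwartz. integrable lborel (\<lambda>x. h x * \<psi> x) \<and>
        T \<psi> = (LINT x|lborel. h x * \<psi> x))"

text \<open>
  The \<open>L\<^sub>p\<close> norm of the function representing \<open>T\<close>, which is unique almost everywhere;
  it is \<open>\<infinity>\<close> if \<open>T\<close> is not represented by a function.
\<close>

definition Lp_norm_distr :: "ennreal \<Rightarrow> 'a::euclidean_space distr \<Rightarrow> ennreal" where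
  "Lp_norm_distr p T = (INF h\<in>{h. represents_distr h T}. Lp_norm p h)"

definition dyadic_cutoff :: "(real \<Rightarrow> complex) \<Rightarrow> nat \<Rightarrow> real \<Rightarrow> complex" where
  "dyadic_cutoff \<phi>\<^sub>0 d t =
     (if d = 0 then \<phi>\<^sub>0 t
      else \<phi>\<^sub>0 (2 powr (- real d) * t) - \<phi>\<^sub>0 (2 powr (- real d + 1) * t))"

definition tensor_cutoff ::
    "(real \<Rightarrow> complex) \<Rightarrow> ('s::finite \<Rightarrow> nat) \<Rightarrow> real ^ 's \<Rightarrow> complex" where
  "tensor_cutoff \<phi>\<^sub>0 d t = (\<Prod>i\<in>UNIV. dyadic_cutoff \<phi>\<^sub>0 (d i) (t $ i))"

definition frequency_block ::
    "(real \<Rightarrow> complex) \<Rightarrow> ('s::finite \<Rightarrow> nat) \<Rightarrow> (real ^ 's) distr \<Rightarrow> (real ^ 's) distr" where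
  "frequency_block \<phi>\<^sub>0 d f =
     inverse_fourier_distr (mult_distr (tensor_cutoff \<phi>\<^sub>0 d) (fourier_distr f))"

definition besov_norm ::
    "(real \<Rightarrow> complex) \<Rightarrow> ennreal \<Rightarrow> ennreal \<Rightarrow> real \<Rightarrow> (real ^ 's::finite) distr \<Rightarrow> ennreal" where
  "besov_norm \<phi>\<^sub>0 p q r f =
     (if q = \<infinity>
      then (SUP d. ennreal (2 powr (r * real (\<Sum>i\<in>UNIV. d i))) *
              Lp_norm_distr p (frequency_block \<phi>\<^sub>0 d f))
      else epowr
        (\<Sum>\<^sub>\<infinity>d. ennreal (2 powr (r * real (\<Sum>i\<in>UNIV. d i) * enn2real q)) *
           epowr (Lp_norm_distr p (frequency_block \<phi>\<^sub>0 d f)) (enn2real q))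
        (1 / enn2real q))"

definition besov_space ::
    "(real \<Rightarrow> complex) \<Rightarrow> ennreal \<Rightarrow> ennreal \<Rightarrow> real \<Rightarrow> (real ^ 's::finite) distr set" where
  "besov_space \<phi>\<^sub>0 p q r = {f. tempered_distribution f \<and> besov_norm \<phi>\<^sub>0 p q r f < \<infinity>}"

text \<open>The infimum over the empty set is \<open>\<infinity>\<close>.\<close>

definition besov_norm_on ::
    "(real ^ 's::finite) set \<Rightarrow> (real \<Rightarrow> complex) \<Rightarrow> ennreal \<Rightarrow> ennreal \<Rightarrow> real \<Rightarrow>
     (real ^ 's) distr \<Rightarrow> ennreal" where
  "besov_norm_on A \<phi>\<^sub>0 p q r f =
     (INF g\<in>{g \<in> besov_space \<phi>\<^sub>0 p q r. restricts_to A g f}. besov_norm \<phi>\<^sub>0 p q r g)"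


section \<open>Discrepancy function\<close>

definition unit_cube :: "(real ^ 's) set" where
  "unit_cube = {x. \<forall>i. 0 \<le> x $ i \<and> x $ i < 1}"

definition discrepancy :: "(real ^ 's::finite) multiset \<Rightarrow> real ^ 's \<Rightarrow> real" where
  "discrepancy P t =
     1 / real (size P) * (\<Sum>x\<in>#P. indicator {y. \<forall>i. 0 \<le> y $ i \<and> y $ i < t $ i} x)
     - (\<Prod>i\<in>UNIV. t $ i)"


section \<open>Symmetrized Hammersley point sets\<close>

definition flip :: "nat \<Rightarrow> nat \<Rightarrow> nat" where
  "flip b k = b - 1 - k"

definition hammersley :: "nat \<Rightarrow> nat \<Rightarrow> (nat \<Rightarrow> nat \<Rightarrow> nat) \<Rightarrow> (real ^ 2) set" where
  "hammersley b n \<Sigma> =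
     {vector [\<Sum>i=1..n. real (\<Sigma> i (a i)) / real b ^ (n + 1 - i),
              \<Sum>i=1..n. real (a i) / real b ^ i] | a. a \<in> {1..n} \<rightarrow> {0..b - 1}}"

text \<open>A multiset union: a point belonging to both sets is counted twice.\<close>

definition sym_hammersley :: "nat \<Rightarrow> nat \<Rightarrow> (nat \<Rightarrow> nat \<Rightarrow> nat) \<Rightarrow> (real ^ 2) multiset" where
  "sym_hammersley b n \<Sigma> =
     mset_set (hammersley b n \<Sigma>) + mset_set (hammersley b n (\<lambda>i. flip b \<circ> \<Sigma> i))"

end

theory Submission
  imports Defs "HOL-Probability.Sinc_Integral"
begin

text \<open>
  The extension by zero of the discrepancy function is an admissible competitor in the infimum,
  because \<open>r < 1/p\<close>. Its frequency block of index \<open>(d\<^sub>1, d\<^sub>2)\<close> is a convolution with the kernels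
  \<open>\<kappa>\<^bsub>d\<^esub> = (2\<pi>)\<^sup>-\<^sup>1 \<integral> e\<^bsup>iz\<xi>\<^esup> \<phi>\<^bsub>d\<^esub>(\<xi>) d\<xi>\<close>. With the antiderivatives \<open>H\<close> of the kernels,
  \<open>|H(x - z)| \<le> C (1 + 4\<^sup>d (x - z)\<^sup>2)\<^sup>-\<^sup>1\<close>, integration by parts turns the block
  into the error of the quadrature rule \<open>avg H H - \<integral> H \<integral> H\<close> over the symmetrized point set, up to
  one-dimensional errors multiplied by boundary values of \<open>H\<close>.

  Let \<open>N = b\<^sup>n\<close>. If \<open>2\<^bsup>d\<^sub>1+d\<^sub>2\<^esup> \<le> N\<close>, the error is telescoped over the \<open>b\<close>-adic levels: at level \<open>j\<close> an oscillation
  of the first factor on cells of length \<open>b\<^sup>-\<^sup>j\<close> is paired with an oscillation of the averages of the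
  second factor over the grid of mesh \<open>b\<^sup>-\<^sup>(\<^sup>n\<^sup>-\<^sup>j\<^sup>)\<close>, and these decay geometrically away from the level
  where \<open>b\<^sup>j\<close> is about \<open>2\<^bsup>d\<^sub>1\<^esup>\<close>. The only contribution that does not decay is proportional to the difference
  of the endpoint values of the first factor and would cost a factor \<open>n\<close>;
  symmetrization makes the endpoint values equal. If \<open>2\<^bsup>d\<^sub>1+d\<^sub>2\<^esup> > N\<close>, the average is bounded by the net property,
  and its \<open>L\<^sub>p\<close> norm by interpolation between \<open>L\<^sub>\<infinity>\<close> and \<open>L\<^sub>1\<close>.

  After multiplication by \<open>2\<^bsup>r(d\<^sub>1+d\<^sub>2)\<^esup>\<close> all blocks are \<open>O(N\<^bsup>r-1\<^esup>)\<close>, with geometric decay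
  away from the about \<open>log N\<close> indices with \<open>2\<^bsup>d\<^sub>1+d\<^sub>2\<^esup>\<close> close to \<open>N\<close> or with one of \<open>d\<^sub>1, d\<^sub>2\<close> close to \<open>0\<close>.
\<close>

section \<open>Radical inverse points and Riemann sums\<close>

text \<open>The digit maps enter only as bijections, which is why one constant serves all
  \<open>n\<close> and all \<open>\<Sigma>\<close>. The delicate point is that every level must gain
  a power and not merely stay bounded. At fine levels the gain is cancellation: the oscillations of
  \<open>F\<close> over all coarse cells at a common relative position add up to a Riemann sum of
  \<open>F'\<close>, close to \<open>F 1 - F 0\<close>; splitting the digits where the two resulting
  errors balance gives a square root of the scale ratio. At coarse levels the gain is the small
  \<open>L_1\<close> norm, of order \<open>2^-d\<close>, of the antiderivative of the kernel. The
  averages of the second factor are expanded to first order: the level differences annihilate the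
  constant, the linear term carries the endpoint difference of the second factor, and the remainder
  decays. For \<open>d = 0\<close> the cutoff does not vanish at frequency zero, so no
  antiderivative decays at both ends of the line; it is normalized at \<open>z = 1\<close> and used
  on the unit interval only.\<close>

lemma sum_lessThan_mult:
  fixes f :: "nat \<Rightarrow> 'a::comm_monoid_add"
  shows "(\<Sum>u<M * k. f u) = (\<Sum>p<M. \<Sum>c<k. f (p * k + c))"
proof -
  have "(\<Sum>u<M * k. f u) = (\<Sum>p<M. sum f {p * k..<p * k + k})"
    by (simp add: sum.nat_group)
  also have "\<dots> = (\<Sum>p<M. \<Sum>c<k. f (p * k + c))"
  proof (rule sum.cong[OF refl])
    fix p
    show "sum f {p * k..<p * k + k} = (\<Sum>c<k. f (p * k + c))"
      using sum.shift_bounds_nat_ivl[of f 0 "p * k" k]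
      by (simp add: atLeast0LessThan add.commute)
  qed
  finally show ?thesis .
qed

text \<open>Van der Corput radical inverse with one permutation per digit: the least significant
  digit of \<open>u\<close> leads the expansion. The permutation is indexed by the number of more
  significant digits, so that dropping low digits leaves the permutations of the remaining ones
  unchanged.\<close>

fun radinv :: "nat \<Rightarrow> (nat \<Rightarrow> nat \<Rightarrow> nat) \<Rightarrow> nat \<Rightarrow> nat \<Rightarrow> real" where
  "radinv b \<pi> 0 u = 0"
| "radinv b \<pi> (Suc j) u = (real (\<pi> j (u mod b)) + radinv b \<pi> j (u div b)) / real b"

text \<open>The net property in recursive form: the low \<open>i\<close> digits of \<open>p\<close>
  decide the interval of length \<open>b^-i\<close> that contains the value, the high
  \<open>k\<close> digits only the position inside it. The high digits in turn fix the interval of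
  length \<open>b^-k\<close> that contains \<open>p / b ^ (k + i)\<close>.\<close>

lemma radinv_split:
  assumes "b > 0"
  shows "radinv b \<pi> (k + i) p =
    radinv b (\<lambda>t. \<pi> (k + t)) i (p mod b ^ i) + radinv b \<pi> k (p div b ^ i) / real b ^ i"
proof (induction i arbitrary: p)
  case 0
  show ?case by simp
next
  case (Suc i)
  have 1: "p mod b ^ Suc i mod b = p mod b"
    by (simp add: mod_mod_cancel)
  have "p mod b ^ Suc i = b * (p div b mod b ^ i) + p mod b"
    by (simp add: mod_mult2_eq)
  then have 2: "p mod b ^ Suc i div b = p div b mod b ^ i"
    using assms by simp
  have 3: "p div b div b ^ i = p div b ^ Suc i"
    by (simp add: div_mult2_eq)
  show ?case
    using assms
    by (simp only: add_Suc_right radinv.simps Suc.IH 1 2 3) (simp add: field_simps)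
qed

lemma radinv_bounds:
  assumes "b > 0" and "\<And>j c. c < b \<Longrightarrow> \<pi> j c < b"
  shows "0 \<le> radinv b \<pi> m u \<and> radinv b \<pi> m u < 1"
proof (induction m arbitrary: u)
  case 0
  show ?case by simp
next
  case (Suc m)
  have "\<pi> m (u mod b) < b" using assms by simp
  then have "real (\<pi> m (u mod b)) + 1 \<le> real b" by linarith
  with Suc.IH[of "u div b"] have "real (\<pi> m (u mod b)) + radinv b \<pi> m (u div b) < real b"
    by linarith
  then show ?case using assms(1) Suc.IH[of "u div b"] by (simp add: field_simps)
qed

text \<open>At every level the permutation merely reindexes the leading digit. Sums that see only
  the second coordinate thus become grid sums.\<close>

lemma sum_radinv:
  fixes \<Phi> :: "real \<Rightarrow> 'a::comm_monoid_add"
  assumes "b > 0" and "\<And>j. bij_betw (\<pi> j) {..<b} {..<b}"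
  shows "(\<Sum>u<b ^ m. \<Phi> (radinv b \<pi> m u)) = (\<Sum>v<b ^ m. \<Phi> (real v / real b ^ m))"
proof (induction m arbitrary: \<Phi>)
  case 0
  show ?case by simp
next
  case (Suc m)
  have "(\<Sum>u<b ^ Suc m. \<Phi> (radinv b \<pi> (Suc m) u)) =
      (\<Sum>p<b ^ m. \<Sum>c<b. \<Phi> ((real (\<pi> m c) + radinv b \<pi> m p) / real b))"
    using assms(1) by (simp only: power_Suc2 sum_lessThan_mult) simp
  also have "\<dots> = (\<Sum>c<b. \<Sum>p<b ^ m. \<Phi> ((real (\<pi> m c) + radinv b \<pi> m p) / real b))"
    by (rule sum.swap)
  also have "\<dots> = (\<Sum>c<b. \<Sum>v<b ^ m. \<Phi> ((real (\<pi> m c) + real v / real b ^ m) / real b))"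
    by (intro sum.cong refl Suc.IH)
  also have "\<dots> = (\<Sum>c<b. \<Sum>v<b ^ m. \<Phi> ((real c + real v / real b ^ m) / real b))"
    by (rule sum.reindex_bij_betw[OF assms(2)])
  also have "\<dots> = (\<Sum>c<b. \<Sum>v<b ^ m. \<Phi> (real (c * b ^ m + v) / real b ^ Suc m))"
    using assms(1) by (intro sum.cong refl arg_cong[where f = \<Phi>]) (simp add: field_simps)
  also have "\<dots> = (\<Sum>v<b ^ Suc m. \<Phi> (real v / real b ^ Suc m))"
    by (simp only: power_Suc sum_lessThan_mult)
  finally show ?case .
qed

section \<open>Oscillation and Riemann sums of continuously differentiable functions\<close>

lemma C1_osc_le:
  fixes F :: "real \<Rightarrow> 'a::euclidean_space"
  assumes D: "\<And>t. (F has_vector_derivative F' t) (at t)" and c: "continuous_on UNIV F'"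
    and st: "s \<in> {a..b}" "t \<in> {a..b}"
  shows "norm (F s - F t) \<le> integral {a..b} (\<lambda>x. norm (F' x))"
proof -
  have *: "norm (F v - F u) \<le> integral {a..b} (\<lambda>x. norm (F' x))"
    if "u \<le> v" "a \<le> u" "v \<le> b" for u v
  proof -
    have cn: "continuous_on A (\<lambda>x. norm (F' x))" for A
      using c by (intro continuous_intros) (auto intro: continuous_on_subset)
    have hi: "(F' has_integral (F v - F u)) {u..v}"
      by (rule fundamental_theorem_of_calculus[OF that(1)])
        (rule has_vector_derivative_at_within[OF D])
    then have "norm (F v - F u) = norm (integral {u..v} F')"
      by (simp add: integral_unique)
    also have "\<dots> \<le> integral {u..v} (\<lambda>x. norm (F' x))"
      using hi cn by (intro integral_norm_bound_integral integrable_continuous_real)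
        (auto intro: continuous_on_subset[OF c])
    also have "\<dots> \<le> integral {a..b} (\<lambda>x. norm (F' x))"
      using that cn by (intro integral_subset_le integrable_continuous_real) auto
    finally show ?thesis .
  qed
  show ?thesis
  proof (cases "s \<le> t")
    case True
    then show ?thesis using *[of s t] st by (simp add: norm_minus_commute)
  next
    case False
    then show ?thesis using *[of t s] st by simp
  qed
qed

lemma sum_integral_pieces:
  fixes f :: "real \<Rightarrow> 'a::euclidean_space"
  assumes "M > 0" and c: "continuous_on UNIV f"
  shows "(\<Sum>v<M. integral {real v / real M..(real v + 1) / real M} f) = integral {0..1} f"
proof -
  have "(\<Sum>v<K. integral {real v / real M..(real v + 1) / real M} f)
      = integral {0..real K / real M} f" for K
  proof (induction K)
    case 0
    show ?case by simp
  next
    case (Suc K)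
    have "integral {0..real K / real M} f + integral {real K / real M..(real K + 1) / real M} f
        = integral {0..(real K + 1) / real M} f"
      using assms by (intro Henstock_Kurzweil_Integration.integral_combine integrable_continuous_real)
        (auto simp: divide_right_mono intro: continuous_on_subset)
    with Suc show ?case by (simp add: add.commute)
  qed
  from this[of M] show ?thesis using assms(1) by simp
qed

lemma integral_affine01:
  fixes f :: "real \<Rightarrow> 'a::euclidean_space"
  assumes "M > 0" and c: "continuous_on UNIV f"
  shows "integral {0..1} (\<lambda>t. f ((c + t) / M)) = M *\<^sub>R integral {c / M..(c + 1) / M} f"
proof -
  have "(f has_integral integral {c / M..(c + 1) / M} f) (cbox (c / M) ((c + 1) / M))"
    using c by (auto intro!: integrable_integral integrable_continuous_real continuous_on_subset[OF c])
  from has_integral_affinity[OF this, of "1 / M" "c / M"] assms(1)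
  have "((\<lambda>x. f ((1 / M) *\<^sub>R x + c / M)) has_integral M *\<^sub>R integral {c / M..(c + 1) / M} f)
     ((\<lambda>x. M *\<^sub>R x + - (M *\<^sub>R (c / M))) ` cbox (c / M) ((c + 1) / M))"
    by simp
  moreover have "(\<lambda>x. M *\<^sub>R x + - (M *\<^sub>R (c / M))) ` cbox (c / M) ((c + 1) / M) = {0..1}"
  proof -
    have "(\<lambda>x. M *\<^sub>R x + - (M *\<^sub>R (c / M))) ` cbox (c / M) ((c + 1) / M)
      = (\<lambda>x. M * x + - c) ` {c / M..(c + 1) / M}" using assms(1) by simp
    also have "\<dots> = {0..1}"
      using assms(1) image_affinity_atLeastAtMost[of M "-c" "c / M" "(c + 1) / M"]
      by (auto simp: divide_right_mono)
    finally show ?thesis .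
  qed
  ultimately have "((\<lambda>x. f ((c + x) / M)) has_integral M *\<^sub>R integral {c / M..(c + 1) / M} f) {0..1}"
    by (simp add: add_divide_distrib add.commute)
  then show ?thesis by (rule integral_unique)
qed

lemma riemann_piece:
  fixes f :: "real \<Rightarrow> 'a::euclidean_space"
  assumes D: "\<And>t. (f has_vector_derivative f' t) (at t)" and c: "continuous_on UNIV f'"
    and "l > 0" "s \<in> {a..a + l}"
  shows "norm (l *\<^sub>R f s - integral {a..a + l} f) \<le> l * integral {a..a + l} (\<lambda>x. norm (f' x))"
proof -
  have cf: "continuous_on UNIV f"
    using D by (meson continuous_at_imp_continuous_on has_vector_derivative_continuous)
  have cf': "continuous_on {a..a + l} f" using cf continuous_on_subset by blast
  have "l *\<^sub>R f s - integral {a..a + l} f = integral {a..a + l} (\<lambda>x. f s - f x)"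
    using assms(3) cf' by (subst integral_diff) (auto intro: integrable_continuous_real)
  also have "norm \<dots> \<le> integral {a..a + l} (\<lambda>x. integral {a..a + l} (\<lambda>x. norm (f' x)))"
    using cf' assms by (intro integral_norm_bound_integral integrable_diff)
      (auto intro: integrable_continuous_real intro!: C1_osc_le)
  also have "\<dots> = l * integral {a..a + l} (\<lambda>x. norm (f' x))" using assms(3) by simp
  finally show ?thesis .
qed

lemma C1_continuous:
  assumes "\<And>t. (f has_vector_derivative f' t) (at t)"
  shows "continuous_on A f"
  using assms by (meson continuous_at_imp_continuous_on has_vector_derivative_continuous)

text \<open>On each cell a sample differs from the cell mean by at most the integral of
  \<open>norm f'\<close> there, and the cells tile the interval. The sum is left unnormalized, so
  the error carries no factor \<open>M\<close>; the offset \<open>s\<close> is the common relative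
  position of the samples in their cells.\<close>

lemma riemann_sum:
  fixes f :: "real \<Rightarrow> 'a::euclidean_space"
  assumes D: "\<And>t. (f has_vector_derivative f' t) (at t)" and c: "continuous_on UNIV f'"
    and M: "M > 0" and s: "s \<in> {0..1}"
  shows "norm ((\<Sum>p<M. f ((real p + s) / real M)) - real M *\<^sub>R integral {0..1} f)
      \<le> integral {0..1} (\<lambda>x. norm (f' x))"
    and "(\<Sum>p<M. norm (f ((real p + s) / real M)))
      \<le> real M * integral {0..1} (\<lambda>x. norm (f x)) + integral {0..1} (\<lambda>x. norm (f' x))"
proof -
  have cf: "continuous_on A f" for A using D by (rule C1_continuous)
  have cn': "continuous_on A (\<lambda>x. norm (f' x))" for A
    using c by (intro continuous_intros) (auto intro: continuous_on_subset)
  have cn: "continuous_on A (\<lambda>x. norm (f x))" for A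
    using cf by (intro continuous_intros) (auto intro: continuous_on_subset)
  let ?I = "\<lambda>p. {real p / real M..(real p + 1) / real M}"
  have I: "?I p = {real p / real M..real p / real M + 1 / real M}" for p
    by (simp add: add_divide_distrib)
  have sm: "(real p + s) / real M \<in> {real p / real M..real p / real M + 1 / real M}" for p
    using s M by (auto simp: field_simps)
  have e: "real M * (1 / real M * x) = x" for x using M by simp
  have pc: "norm ((1 / real M) *\<^sub>R f ((real p + s) / real M) - integral (?I p) f)
      \<le> 1 / real M * integral (?I p) (\<lambda>x. norm (f' x))" for p
    unfolding I by (rule riemann_piece[OF D c _ sm]) (use M in auto)
  have *: "(\<Sum>p<M. f ((real p + s) / real M)) - real M *\<^sub>R integral {0..1} f
      = real M *\<^sub>R (\<Sum>p<M. (1 / real M) *\<^sub>R f ((real p + s) / real M) - integral (?I p) f)"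
    using M by (simp add: sum_subtractf scaleR_sum_right[symmetric] sum_integral_pieces[OF M cf]
        scaleR_diff_right)
  have "norm ((\<Sum>p<M. f ((real p + s) / real M)) - real M *\<^sub>R integral {0..1} f)
      \<le> real M * (\<Sum>p<M. 1 / real M * integral (?I p) (\<lambda>x. norm (f' x)))"
  proof -
    have "norm (\<Sum>p<M. (1 / real M) *\<^sub>R f ((real p + s) / real M) - integral (?I p) f)
        \<le> (\<Sum>p<M. 1 / real M * integral (?I p) (\<lambda>x. norm (f' x)))"
      by (rule sum_norm_le) (rule pc)
    from mult_left_mono[OF this, of "real M"] show ?thesis
      by (simp only: * norm_scaleR abs_of_nat of_nat_0_le_iff)
  qed
  also have "\<dots> = (\<Sum>p<M. integral (?I p) (\<lambda>x. norm (f' x)))"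
    by (simp only: sum_distrib_left e)
  also have "\<dots> = integral {0..1} (\<lambda>x. norm (f' x))"
    by (rule sum_integral_pieces[OF M cn'])
  finally show "norm ((\<Sum>p<M. f ((real p + s) / real M)) - real M *\<^sub>R integral {0..1} f)
      \<le> integral {0..1} (\<lambda>x. norm (f' x))" .
  have "norm (f ((real p + s) / real M)) \<le> real M * integral (?I p) (\<lambda>x. norm (f x))
      + integral (?I p) (\<lambda>x. norm (f' x))" for p
  proof -
    have "norm (integral (?I p) f) \<le> integral (?I p) (\<lambda>x. norm (f x))"
      by (intro integral_norm_bound_integral integrable_continuous_real cf cn) auto
    with pc[of p] have "norm ((1 / real M) *\<^sub>R f ((real p + s) / real M)) \<le>
        1 / real M * integral (?I p) (\<lambda>x. norm (f' x)) + integral (?I p) (\<lambda>x. norm (f x))"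
      by (smt (verit) norm_triangle_sub)
    then have "real M * (1 / real M * norm (f ((real p + s) / real M))) \<le>
        real M * (1 / real M * integral (?I p) (\<lambda>x. norm (f' x)) + integral (?I p) (\<lambda>x. norm (f x)))"
      by (intro mult_left_mono) (auto simp: M)
    then show ?thesis by (simp only: e distrib_left add.commute)
  qed
  then have "(\<Sum>p<M. norm (f ((real p + s) / real M))) \<le>
     (\<Sum>p<M. real M * integral (?I p) (\<lambda>x. norm (f x)) + integral (?I p) (\<lambda>x. norm (f' x)))"
    by (intro sum_mono)
  also have "\<dots> = real M * integral {0..1} (\<lambda>x. norm (f x)) + integral {0..1} (\<lambda>x. norm (f' x))"
    by (simp only: sum.distrib sum_distrib_left[symmetric] sum_integral_pieces[OF M cn]
        sum_integral_pieces[OF M cn'])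
  finally show "(\<Sum>p<M. norm (f ((real p + s) / real M)))
      \<le> real M * integral {0..1} (\<lambda>x. norm (f x)) + integral {0..1} (\<lambda>x. norm (f' x))" .
qed

definition C1_fun :: "(real \<Rightarrow> complex) \<Rightarrow> (real \<Rightarrow> complex) \<Rightarrow> bool" where
  "C1_fun F F' \<longleftrightarrow> (\<forall>t. (F has_vector_derivative F' t) (at t)) \<and> continuous_on UNIV F'"

lemma C1_funD:
  assumes "C1_fun F F'"
  shows "(F has_vector_derivative F' t) (at t)" "continuous_on A F" "continuous_on A F'"
    "continuous_on A (\<lambda>x. norm (F' x))" "continuous_on A (\<lambda>x. norm (F x))"
proof -
  show 1: "(F has_vector_derivative F' t) (at t)" for t using assms by (simp add: C1_fun_def)
  show 2: "continuous_on A F" by (rule C1_continuous[OF 1])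
  show 3: "continuous_on A F'" using assms continuous_on_subset by (auto simp: C1_fun_def)
  show "continuous_on A (\<lambda>x. norm (F' x))" "continuous_on A (\<lambda>x. norm (F x))"
    using 2 3 by (auto intro: continuous_intros)
qed

lemma C1_fun_affine:
  assumes "C1_fun F F'"
  shows "C1_fun (\<lambda>t. F ((c + t) / M)) (\<lambda>t. (1 / M) *\<^sub>R F' ((c + t) / M))"
  unfolding C1_fun_def
proof (intro conjI allI)
  fix t
  have "((\<lambda>t. (c + t) / M) has_real_derivative 1 / M) (at t)"
    by (cases "M = 0") (auto intro!: derivative_eq_intros)
  then have "((\<lambda>t. (c + t) / M) has_vector_derivative 1 / M) (at t)"
    by (simp add: has_real_derivative_iff_has_vector_derivative)
  from vector_diff_chain_at[OF this C1_funD(1)[OF assms]]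
  show "((\<lambda>t. F ((c + t) / M)) has_vector_derivative (1 / M) *\<^sub>R F' ((c + t) / M)) (at t)"
    by (simp add: o_def)
next
  have "continuous_on UNIV (\<lambda>t. F' ((c + t) * (1 / M)))"
    by (intro continuous_on_compose2[OF C1_funD(3)[OF assms, of UNIV]] continuous_intros) auto
  then show "continuous_on UNIV (\<lambda>t. (1 / M) *\<^sub>R F' ((c + t) / M))"
    by (intro continuous_intros) simp
qed

lemma C1_fun_sum:
  assumes "\<And>i. i \<in> I \<Longrightarrow> C1_fun (\<phi> i) (\<phi>' i)"
  shows "C1_fun (\<lambda>t. \<Sum>i\<in>I. \<phi> i t) (\<lambda>t. \<Sum>i\<in>I. \<phi>' i t)"
  using assms unfolding C1_fun_def
  by (auto intro!: has_vector_derivative_sum continuous_on_sum)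

lemma C1_fun_cmult:
  assumes "C1_fun \<phi> \<phi>'"
  shows "C1_fun (\<lambda>t. c * \<phi> t) (\<lambda>t. c * \<phi>' t)"
  using assms unfolding C1_fun_def
  by (auto intro!: has_vector_derivative_mult_right continuous_intros)

lemma C1_fun_add:
  assumes "C1_fun \<phi> \<phi>'" "C1_fun \<psi> \<psi>'"
  shows "C1_fun (\<lambda>t. \<phi> t + \<psi> t) (\<lambda>t. \<phi>' t + \<psi>' t)"
  using assms unfolding C1_fun_def
  by (auto intro!: has_vector_derivative_add continuous_intros)

section \<open>Telescoping over the levels\<close>

text \<open>The bound makes the functional vanish on constants, so it measures oscillation. Two
  instances are used: the mean on a child cell minus the mean on the whole cell, and a point value
  minus the mean.\<close>

definition osc_functional :: "((real \<Rightarrow> complex) \<Rightarrow> complex) \<Rightarrow> bool" where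
  "osc_functional \<Lambda> \<longleftrightarrow>
    (\<forall>(M::nat) \<phi>. (\<forall>i. continuous_on UNIV (\<phi> i)) \<longrightarrow> \<Lambda> (\<lambda>t. \<Sum>i<M. \<phi> i t) = (\<Sum>i<M. \<Lambda> (\<phi> i))) \<and>
    (\<forall>\<phi> \<phi>'. C1_fun \<phi> \<phi>' \<longrightarrow> norm (\<Lambda> \<phi>) \<le> integral {0..1} (\<lambda>t. norm (\<phi>' t)))"

lemma integral_le_const01:
  fixes f :: "real \<Rightarrow> real"
  assumes "continuous_on {0..1} f" and "\<And>t. t \<in> {0..1} \<Longrightarrow> f t \<le> K"
  shows "integral {0..1} f \<le> K"
proof -
  have "integral {0..1} f \<le> integral {0..1} (\<lambda>_::real. K)"
    using assms by (intro Henstock_Kurzweil_Integration.integral_le integrable_continuous_real) auto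
  then show ?thesis by simp
qed

text \<open>Write \<open>p = q * b ^ i + w\<close>. For fixed \<open>w\<close> the weight
  \<open>g\<close> is nearly constant in \<open>q\<close>, by the digit splitting, and the
  functionals of the \<open>b ^ k\<close> cells add up to the functional of one function whose
  derivative is a Riemann sum of \<open>F'\<close>, close to \<open>F 1 - F 0\<close>. The first
  summand of the bound comes from freezing \<open>g\<close>, the second from its oscillation, where
  the terms are added in norm.\<close>

lemma weighted_average_bound:
  assumes L: "osc_functional \<Lambda>" and F: "C1_fun F F'" and F': "C1_fun F' F''" and g: "C1_fun g g'"
    and b: "b > 0" and \<pi>: "\<And>j. bij_betw (\<pi> j) {..<b} {..<b}"
    and gB: "\<And>y. y \<in> {0..1} \<Longrightarrow> norm (g y) \<le> B" "integral {0..1} (\<lambda>y. norm (g' y)) \<le> B"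
    and V: "integral {0..1} (\<lambda>y. norm (F' y)) \<le> V"
    and W: "integral {0..1} (\<lambda>y. norm (F'' y)) \<le> W"
  shows "norm (\<Sum>p<b ^ (k + i). \<Lambda> (\<lambda>t. F ((real p + t) / real b ^ (k + i))) * g (radinv b \<pi> (k + i) p))
    \<le> B * (norm (F 1 - F 0) + W / real b ^ k) + B * (V + W / real b ^ k) / real b ^ i"
proof -
  define e where "e = norm (F 1 - F 0)"
  define n where "n = real b ^ (k + i)"
  define bk where "bk = real b ^ k"
  define bi where "bi = real b ^ i"
  have nbk: "n = bk * bi" "bk > 0" "bi > 0" "n > 0"
    using b by (auto simp: n_def bk_def bi_def power_add)
  have B0: "B \<ge> 0" using order_trans[OF norm_ge_zero gB(1)[of 0]] by simp
  have V0: "V \<ge> 0"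
    by (rule order_trans[OF integral_nonneg V])
      (auto intro: integrable_continuous_real C1_funD[OF F])
  have W0: "W \<ge> 0"
    by (rule order_trans[OF integral_nonneg W])
      (auto intro: integrable_continuous_real C1_funD[OF F'])
  have Ladd: "\<Lambda> (\<lambda>t. \<Sum>i<M. \<phi> i t) = (\<Sum>i<M. \<Lambda> (\<phi> i))"
    if "\<And>i. continuous_on UNIV (\<phi> i)" for M :: nat and \<phi>
    using L that unfolding osc_functional_def by blast
  have Lb: "norm (\<Lambda> \<phi>) \<le> integral {0..1} (\<lambda>t. norm (\<phi>' t))" if "C1_fun \<phi> \<phi>'" for \<phi> \<phi>'
    using L that unfolding osc_functional_def by blast
  define A where "A w q = \<Lambda> (\<lambda>t. F ((real (q * b ^ i + w) + t) / n))" for w q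
  define \<rho> where "\<rho> w = radinv b (\<lambda>t. \<pi> (k + t)) i w" for w
  have dF: "C1_fun (\<lambda>t. F ((real (q * b ^ i + w) + t) / n))
      (\<lambda>t. (1 / n) *\<^sub>R F' ((real (q * b ^ i + w) + t) / n))" for q w
    by (rule C1_fun_affine[OF F])
  have arg: "(real (q * b ^ i + w) + t) / n = (real q + (real w + t) / bi) / real (b ^ k)" for q w t
    using nbk by (simp add: bi_def bk_def field_simps)
  have s01: "(real w + t) / bi \<in> {0..1}" if "w < b ^ i" "t \<in> {0..1}" for w t
  proof -
    have "real w + 1 \<le> bi" using that(1) unfolding bi_def
      by (metis Suc_eq_plus1 Suc_leI of_nat_1 of_nat_add of_nat_le_iff of_nat_power)
    then show ?thesis using that(2) nbk by auto
  qed
  have bkn: "b ^ k > 0" using b by simp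
  have intF': "integral {0..1} F' = F 1 - F 0"
    by (rule integral_unique, rule fundamental_theorem_of_calculus)
      (auto intro: has_vector_derivative_at_within C1_funD[OF F])
  \<comment> \<open>The sum over \<open>q\<close> goes inside the functional before norms are taken;
    only so does the cancellation in \<open>F'\<close> survive.\<close>
  have f1: "norm (\<Sum>q<b ^ k. A w q) \<le> (e + W / bk) / bi" if w: "w < b ^ i" for w
  proof -
    let ?d = "\<lambda>t. \<Sum>q<b ^ k. (1 / n) *\<^sub>R F' ((real (q * b ^ i + w) + t) / n)"
    have C: "C1_fun (\<lambda>t. \<Sum>q<b ^ k. F ((real (q * b ^ i + w) + t) / n)) ?d"
      by (rule C1_fun_sum) (rule dF)
    have "(\<Sum>q<b ^ k. A w q) = \<Lambda> (\<lambda>t. \<Sum>q<b ^ k. F ((real (q * b ^ i + w) + t) / n))"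
      unfolding A_def by (rule Ladd[symmetric]) (rule C1_funD[OF dF])
    then have "norm (\<Sum>q<b ^ k. A w q) \<le> integral {0..1} (\<lambda>t. norm (?d t))"
      using Lb[OF C] by simp
    moreover have "integral {0..1} (\<lambda>t. norm (?d t)) \<le> (e + W / bk) / bi"
    proof (rule integral_le_const01)
      show "continuous_on {0..1} (\<lambda>t. norm (?d t))" by (rule C1_funD[OF C])
      fix t :: real assume t: "t \<in> {0..1}"
      let ?S = "\<Sum>q<b ^ k. F' ((real q + (real w + t) / bi) / real (b ^ k))"
      have "norm (?S - real (b ^ k) *\<^sub>R integral {0..1} F') \<le> integral {0..1} (\<lambda>x. norm (F'' x))"
        by (rule riemann_sum(1)[OF C1_funD(1)[OF F'] C1_funD(3)[OF F'] bkn s01[OF w t]])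
      then have "norm (?S - bk *\<^sub>R (F 1 - F 0)) \<le> W"
        using W by (simp add: intF' bk_def)
      moreover have "norm ?S \<le> norm (bk *\<^sub>R (F 1 - F 0)) + norm (?S - bk *\<^sub>R (F 1 - F 0))"
        by (rule norm_triangle_sub)
      ultimately have S: "norm ?S \<le> bk * e + W"
        using nbk by (simp add: e_def)
      have "?d t = (1 / n) *\<^sub>R ?S"
        by (simp only: arg scaleR_sum_right)
      then have "norm (?d t) = norm ?S / n" using nbk by simp
      then have "norm (?d t) \<le> (bk * e + W) / n"
        using S nbk by (simp add: divide_right_mono)
      also have "\<dots> = (e + W / bk) / bi" using nbk by (simp add: field_simps)
      finally show "norm (?d t) \<le> (e + W / bk) / bi" .
    qed
    ultimately show ?thesis by linarith
  qed
  have f2: "(\<Sum>q<b ^ k. norm (A w q)) \<le> (V + W / bk) / bi" if w: "w < b ^ i" for w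
  proof -
    let ?d = "\<lambda>q t. norm ((1 / n) *\<^sub>R F' ((real (q * b ^ i + w) + t) / n))"
    have c: "continuous_on {0..1} (?d q)" for q by (rule C1_funD[OF dF])
    have "(\<Sum>q<b ^ k. norm (A w q)) \<le> (\<Sum>q<b ^ k. integral {0..1} (?d q))"
      unfolding A_def by (rule sum_mono) (rule Lb[OF dF])
    moreover have "(\<Sum>q<b ^ k. integral {0..1} (?d q)) = integral {0..1} (\<lambda>t. \<Sum>q<b ^ k. ?d q t)"
      by (rule integral_sum[symmetric]) (simp, rule integrable_continuous_real, rule c)
    moreover have "integral {0..1} (\<lambda>t. \<Sum>q<b ^ k. ?d q t) \<le> (V + W / bk) / bi"
    proof (rule integral_le_const01)
      show "continuous_on {0..1} (\<lambda>t. \<Sum>q<b ^ k. ?d q t)" by (rule continuous_on_sum) (rule c)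
      fix t :: real assume t: "t \<in> {0..1}"
      let ?S = "\<Sum>q<b ^ k. norm (F' ((real q + (real w + t) / bi) / real (b ^ k)))"
      have S: "?S \<le> bk * V + W"
      proof -
        have "?S \<le> real (b ^ k) * integral {0..1} (\<lambda>x. norm (F' x)) + integral {0..1} (\<lambda>x. norm (F'' x))"
          by (rule riemann_sum(2)[OF C1_funD(1)[OF F'] C1_funD(3)[OF F'] bkn s01[OF w t]])
        moreover have "real (b ^ k) * integral {0..1} (\<lambda>x. norm (F' x)) \<le> real (b ^ k) * V"
          by (rule mult_left_mono[OF V]) simp
        moreover have "real (b ^ k) = bk" by (simp add: bk_def)
        ultimately show ?thesis using W by simp
      qed
      have "(\<Sum>q<b ^ k. ?d q t) = ?S / n"
        unfolding arg using nbk by (simp add: sum_divide_distrib)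
      then have "(\<Sum>q<b ^ k. ?d q t) \<le> (bk * V + W) / n"
        using S nbk by (simp add: divide_right_mono)
      also have "\<dots> = (V + W / bk) / bi" using nbk by (simp add: field_simps)
      finally show "(\<Sum>q<b ^ k. ?d q t) \<le> (V + W / bk) / bi" .
    qed
    ultimately show ?thesis by linarith
  qed
  have \<pi>lt: "\<pi> j c < b" if "c < b" for j c
    using bij_betwE[OF \<pi>[of j]] that by auto
  define osc where "osc v = integral {v..v + 1 / bi} (\<lambda>y. norm (g' y))" for v
  have O0: "osc v \<ge> 0" for v unfolding osc_def
    by (intro integral_nonneg integrable_continuous_real C1_funD[OF g]) auto
  \<comment> \<open>The starting points \<open>\<rho> w\<close> permute the grid of mesh
    \<open>b^-i\<close>, so the intervals tile the unit interval and the oscillations of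
    \<open>g\<close> add up to its total variation.\<close>
  have Osum: "(\<Sum>w<b ^ i. osc (\<rho> w)) \<le> B"
  proof -
    have "(\<Sum>w<b ^ i. osc (\<rho> w)) = (\<Sum>v<b ^ i. osc (real v / real b ^ i))"
      unfolding \<rho>_def by (rule sum_radinv[OF b \<pi>])
    also have "\<dots> = integral {0..1} (\<lambda>y. norm (g' y))"
      unfolding osc_def using sum_integral_pieces[of "b ^ i" "\<lambda>y. norm (g' y)"] b C1_funD(4)[OF g]
      by (simp add: bi_def add_divide_distrib)
    finally show ?thesis using gB(2) by simp
  qed
  let ?G = "\<lambda>w q. g (\<rho> w + radinv b \<pi> k q / bi)"
  have \<rho>01: "\<rho> w \<in> {0..1}" for w
    using radinv_bounds[OF b, of "\<lambda>t. \<pi> (k + t)" i w] \<pi>lt by (auto simp: \<rho>_def)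
  have gdiff: "norm (?G w q - g (\<rho> w)) \<le> osc (\<rho> w)" for w q
    unfolding osc_def
    using radinv_bounds[OF b, of \<pi> k q] \<pi>lt nbk
    by (intro C1_osc_le[OF C1_funD(1)[OF g] C1_funD(3)[OF g]]) (auto simp: divide_right_mono)
  have "(\<Sum>p<b ^ (k + i). \<Lambda> (\<lambda>t. F ((real p + t) / real b ^ (k + i))) * g (radinv b \<pi> (k + i) p))
      = (\<Sum>q<b ^ k. \<Sum>w<b ^ i. A w q * ?G w q)"
    unfolding power_add sum_lessThan_mult using b
    by (intro sum.cong refl)
      (auto simp: A_def n_def power_add \<rho>_def bi_def radinv_split[OF b, unfolded power_add])
  also have "\<dots> = (\<Sum>w<b ^ i. \<Sum>q<b ^ k. A w q * ?G w q)" by (rule sum.swap)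
  also have "\<dots> = (\<Sum>w<b ^ i. g (\<rho> w) * (\<Sum>q<b ^ k. A w q) + (\<Sum>q<b ^ k. A w q * (?G w q - g (\<rho> w))))"
    by (simp add: sum_distrib_left sum_subtractf right_diff_distrib mult.commute)
  finally have *: "(\<Sum>p<b ^ (k + i). \<Lambda> (\<lambda>t. F ((real p + t) / real b ^ (k + i))) * g (radinv b \<pi> (k + i) p))
     = (\<Sum>w<b ^ i. g (\<rho> w) * (\<Sum>q<b ^ k. A w q) + (\<Sum>q<b ^ k. A w q * (?G w q - g (\<rho> w))))" .
  have "norm (\<Sum>w<b ^ i. g (\<rho> w) * (\<Sum>q<b ^ k. A w q) + (\<Sum>q<b ^ k. A w q * (?G w q - g (\<rho> w))))
    \<le> (\<Sum>w<b ^ i. B * ((e + W / bk) / bi) + osc (\<rho> w) * ((V + W / bk) / bi))"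
  proof (rule sum_norm_le)
    fix w assume "w \<in> {..<b ^ i}"
    then have w: "w < b ^ i" by simp
    have 1: "norm (g (\<rho> w) * (\<Sum>q<b ^ k. A w q)) \<le> B * ((e + W / bk) / bi)"
      unfolding norm_mult by (rule mult_mono[OF gB(1)[OF \<rho>01] f1[OF w] B0]) simp
    have "norm (\<Sum>q<b ^ k. A w q * (?G w q - g (\<rho> w))) \<le> (\<Sum>q<b ^ k. norm (A w q) * osc (\<rho> w))"
      by (rule sum_norm_le) (auto simp: norm_mult intro!: mult_left_mono gdiff)
    also have "\<dots> = (\<Sum>q<b ^ k. norm (A w q)) * osc (\<rho> w)"
      by (simp add: sum_distrib_right)
    also have "\<dots> \<le> (V + W / bk) / bi * osc (\<rho> w)"
      by (rule mult_right_mono[OF f2[OF w] O0])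
    finally have 2: "norm (\<Sum>q<b ^ k. A w q * (?G w q - g (\<rho> w))) \<le> osc (\<rho> w) * ((V + W / bk) / bi)"
      by (simp only: mult.commute)
    show "norm (g (\<rho> w) * (\<Sum>q<b ^ k. A w q) + (\<Sum>q<b ^ k. A w q * (?G w q - g (\<rho> w))))
      \<le> B * ((e + W / bk) / bi) + osc (\<rho> w) * ((V + W / bk) / bi)"
      by (rule norm_triangle_le) (use 1 2 in linarith)
  qed
  moreover have "(\<Sum>w<b ^ i. B * ((e + W / bk) / bi) + osc (\<rho> w) * ((V + W / bk) / bi))
     = B * (e + W / bk) + (\<Sum>w<b ^ i. osc (\<rho> w)) * ((V + W / bk) / bi)"
    unfolding sum.distrib sum_distrib_right using nbk by (simp add: bi_def)
  moreover have "(\<Sum>w<b ^ i. osc (\<rho> w)) * ((V + W / bk) / bi) \<le> B * ((V + W / bk) / bi)"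
    using V0 W0 nbk by (intro mult_right_mono Osum) auto
  ultimately show ?thesis unfolding * e_def bk_def bi_def by simp
qed

text \<open>The split \<open>m = k + i\<close> balances \<open>D * X / b ^ k\<close> against
  \<open>X / b ^ i\<close>, which happens for \<open>b ^ i\<close> near
  \<open>sqrt (b ^ m / D)\<close>. Rounding to a power of \<open>b\<close> costs the factor
  \<open>b\<close>; the other two error terms give the \<open>2\<close> in
  \<open>b + 2\<close>.\<close>

lemma weighted_average_bound_sqrt:
  assumes L: "osc_functional \<Lambda>" and F: "C1_fun F F'" and F': "C1_fun F' F''" and g: "C1_fun g g'"
    and b: "b \<ge> 2" and \<pi>: "\<And>j. bij_betw (\<pi> j) {..<b} {..<b}"
    and gB: "\<And>y. y \<in> {0..1} \<Longrightarrow> norm (g y) \<le> B" "integral {0..1} (\<lambda>y. norm (g' y)) \<le> B"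
    and V: "integral {0..1} (\<lambda>y. norm (F' y)) \<le> X"
    and W: "integral {0..1} (\<lambda>y. norm (F'' y)) \<le> D * X"
    and D: "1 \<le> D" "D \<le> real b ^ m" and X: "X \<ge> 0"
  shows "norm (\<Sum>p<b ^ m. \<Lambda> (\<lambda>t. F ((real p + t) / real b ^ m)) * g (radinv b \<pi> m p))
    \<le> B * (norm (F 1 - F 0) + (real b + 2) * X * sqrt (D / real b ^ m))"
proof -
  have B0: "B \<ge> 0" using order_trans[OF norm_ge_zero gB(1)[of 0]] by simp
  define x where "x = sqrt (real b ^ m / D)"
  have bm: "real b ^ m > 0" using b by simp
  have x1: "x \<ge> 1" using D by (simp add: x_def)
  have "nat \<lfloor>x\<rfloor> \<ge> 1" using x1 by linarith
  then obtain i where i: "b ^ i \<le> nat \<lfloor>x\<rfloor>" "nat \<lfloor>x\<rfloor> < b ^ (i + 1)"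
    using ex_power_ivl1[OF b] by blast
  have ix: "real b ^ i \<le> x"
  proof -
    have "real (b ^ i) \<le> real (nat \<lfloor>x\<rfloor>)" using i(1) by linarith
    also have "\<dots> \<le> x" using x1 by linarith
    finally show ?thesis by simp
  qed
  have xi: "x \<le> real b * real b ^ i"
  proof -
    have "real (nat \<lfloor>x\<rfloor>) + 1 \<le> real (b ^ (i + 1))" using i(2) by linarith
    then show ?thesis using x1 by simp linarith
  qed
  have "x\<^sup>2 = real b ^ m / D" using D bm by (simp add: x_def)
  then have x2: "D * (x * x) = real b ^ m" using D by (simp add: power2_eq_square)
  have "x \<le> real b ^ m"
  proof -
    have "x * 1 \<le> x * x" using x1 by (intro mult_left_mono) auto
    also have "\<dots> \<le> D * (x * x)" using D x1 by (simp add: mult_le_cancel_right1)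
    finally show ?thesis using x2 by simp
  qed
  then have "real b ^ i \<le> real b ^ m" using ix by linarith
  then have "i \<le> m" using b by (simp add: power_increasing_iff)
  then obtain k where k: "m = k + i" using le_iff_add[of i m] by (auto simp: add.commute)
  have pos: "real b ^ k > 0" "real b ^ i > 0" using b by auto
  have s: "sqrt (D / real b ^ m) = 1 / x" by (simp add: x_def real_sqrt_divide)
  have "D * X / real b ^ k \<le> X / x"
  proof -
    have "D * (x * x) = real b ^ k * real b ^ i" using x2 k by (simp add: power_add)
    also have "\<dots> \<le> real b ^ k * x" using ix pos by simp
    finally have "D * x \<le> real b ^ k" using x1 by simp
    then have "D * x * X \<le> real b ^ k * X" using X by (rule mult_right_mono)
    then show ?thesis using pos x1 by (simp add: field_simps)
  qed
  moreover have "X / real b ^ i \<le> real b * X / x"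
    using mult_left_mono[OF xi X] pos x1 by (simp add: field_simps)
  moreover have "D * X / real b ^ k / real b ^ i \<le> X / x"
  proof -
    have "D * X / real b ^ k / real b ^ i = X / (x * x)"
      using x2 x1 pos D by (simp add: k power_add field_simps)
    also have "\<dots> \<le> X / x" using x1 X by (intro divide_left_mono) auto
    finally show ?thesis .
  qed
  ultimately have "norm (F 1 - F 0) + D * X / real b ^ k + (X / real b ^ i + D * X / real b ^ k / real b ^ i)
     \<le> norm (F 1 - F 0) + (X / x + (real b * X / x + X / x))"
    by linarith
  also have "\<dots> = norm (F 1 - F 0) + (real b + 2) * X * (1 / x)"
    using x1 by (simp add: field_simps)
  finally have "B * (norm (F 1 - F 0) + D * X / real b ^ k + (X / real b ^ i + D * X / real b ^ k / real b ^ i))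
      \<le> B * (norm (F 1 - F 0) + (real b + 2) * X * (1 / x))"
    by (rule mult_left_mono[OF _ B0])
  moreover have "norm (\<Sum>p<b ^ m. \<Lambda> (\<lambda>t. F ((real p + t) / real b ^ m)) * g (radinv b \<pi> m p))
    \<le> B * (norm (F 1 - F 0) + D * X / real b ^ k) + B * (X + D * X / real b ^ k) / real b ^ i"
    unfolding k using weighted_average_bound[OF L F F' g _ \<pi> gB V W] b by simp
  ultimately show ?thesis unfolding s by (simp add: algebra_simps add_divide_distrib)
qed

section \<open>Means on cells and on translated grids\<close>

definition cell_average :: "nat \<Rightarrow> (real \<Rightarrow> complex) \<Rightarrow> nat \<Rightarrow> nat \<Rightarrow> complex" where
  "cell_average b F m u = integral {0..1} (\<lambda>t. F ((real u + t) / real b ^ m))"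

text \<open>The \<open>k\<close>-th iterate of averaging over the inverse branches of multiplication
  by \<open>b\<close> modulo 1. With \<open>y\<close> the radical inverse of a prefix, it averages
  \<open>G\<close> over all choices of the \<open>k\<close> leading digits of the second
  coordinate.\<close>

definition fold_average :: "nat \<Rightarrow> (real \<Rightarrow> complex) \<Rightarrow> nat \<Rightarrow> real \<Rightarrow> complex" where
  "fold_average b G k y = (\<Sum>v<b ^ k. G ((real v + y) / real b ^ k)) / of_nat b ^ k"

definition child_osc :: "nat \<Rightarrow> nat \<Rightarrow> (real \<Rightarrow> complex) \<Rightarrow> complex" where
  "child_osc b c \<phi> = integral {0..1} (\<lambda>s. \<phi> ((real c + s) / real b)) - integral {0..1} \<phi>"

lemma continuous_on_affine:
  fixes \<phi> :: "real \<Rightarrow> complex"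
  assumes "continuous_on UNIV \<phi>"
  shows "continuous_on A (\<lambda>s. \<phi> ((c + s) / M))"
proof -
  have "continuous_on A (\<lambda>s. \<phi> ((c + s) * (1 / M)))"
    by (intro continuous_on_compose2[OF assms] continuous_intros) auto
  then show ?thesis by simp
qed

lemma norm_minus_average_le:
  fixes \<phi> :: "real \<Rightarrow> complex"
  assumes "continuous_on {0..1} \<phi>" and "\<And>t. t \<in> {0..1} \<Longrightarrow> norm (x - \<phi> t) \<le> K"
  shows "norm (x - integral {0..1} \<phi>) \<le> K"
proof -
  have "x - integral {0..1} \<phi> = integral {0..1} (\<lambda>t. x - \<phi> t)"
    using assms(1) by (subst Henstock_Kurzweil_Integration.integral_diff)
      (auto intro: integrable_continuous_real)
  moreover have "norm (integral {0..1} (\<lambda>t. x - \<phi> t)) \<le> integral {0..1} (\<lambda>t::real. K)"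
    using assms by (intro integral_norm_bound_integral integrable_continuous_real)
      (auto intro!: continuous_intros)
  ultimately show ?thesis by simp
qed

lemma osc_functional_child:
  assumes "c < b"
  shows "osc_functional (child_osc b c)"
  unfolding osc_functional_def
proof (intro conjI allI impI)
  fix M :: nat and \<phi> :: "nat \<Rightarrow> real \<Rightarrow> complex"
  assume c: "\<forall>i. continuous_on UNIV (\<phi> i)"
  have "integral {0..1} (\<lambda>s. \<Sum>i<M. \<phi> i ((real c + s) / real b)) =
      (\<Sum>i<M. integral {0..1} (\<lambda>s. \<phi> i ((real c + s) / real b)))"
    by (rule integral_sum) (auto intro!: integrable_continuous_real continuous_on_affine c[rule_format])
  moreover have "integral {0..1} (\<lambda>s. \<Sum>i<M. \<phi> i s) = (\<Sum>i<M. integral {0..1} (\<phi> i))"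
    using c by (intro integral_sum) (auto intro!: integrable_continuous_real intro: continuous_on_subset)
  ultimately show "child_osc b c (\<lambda>t. \<Sum>i<M. \<phi> i t) = (\<Sum>i<M. child_osc b c (\<phi> i))"
    by (simp add: child_osc_def sum_subtractf)
next
  fix \<phi> \<phi>'
  assume C: "C1_fun \<phi> \<phi>'"
  have b: "real b > 0" "real c + 1 \<le> real b" using assms by auto
  have in01: "(real c + s) / real b \<in> {0..1}" if "s \<in> {0..1}" for s
    using that b by auto
  have "norm (integral {0..1} \<phi> - integral {0..1} (\<lambda>s. \<phi> ((real c + s) / real b)))
     \<le> integral {0..1} (\<lambda>t. norm (\<phi>' t))"
  proof (rule norm_minus_average_le)
    show "continuous_on {0..1} (\<lambda>s. \<phi> ((real c + s) / real b))"
      by (rule continuous_on_affine) (rule C1_funD[OF C])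
    fix s :: real assume s: "s \<in> {0..1}"
    have "norm (\<phi> ((real c + s) / real b) - integral {0..1} \<phi>) \<le> integral {0..1} (\<lambda>t. norm (\<phi>' t))"
      using in01[OF s]
      by (intro norm_minus_average_le C1_osc_le[OF C1_funD(1)[OF C] C1_funD(3)[OF C]] C1_funD(2)[OF C])
    then show "norm (integral {0..1} \<phi> - \<phi> ((real c + s) / real b)) \<le> integral {0..1} (\<lambda>t. norm (\<phi>' t))"
      by (simp add: norm_minus_commute)
  qed
  then show "norm (child_osc b c \<phi>) \<le> integral {0..1} (\<lambda>t. norm (\<phi>' t))"
    by (simp add: child_osc_def norm_minus_commute)
qed

lemma osc_functional_point:
  assumes s: "s \<in> {0..1}"
  shows "osc_functional (\<lambda>\<phi>. \<phi> s - integral {0..1} \<phi>)"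
  unfolding osc_functional_def
proof (intro conjI allI impI)
  fix M :: nat and \<phi> :: "nat \<Rightarrow> real \<Rightarrow> complex"
  assume c: "\<forall>i. continuous_on UNIV (\<phi> i)"
  have "integral {0..1} (\<lambda>s. \<Sum>i<M. \<phi> i s) = (\<Sum>i<M. integral {0..1} (\<phi> i))"
    using c by (intro integral_sum) (auto intro!: integrable_continuous_real intro: continuous_on_subset)
  then show "(\<Sum>i<M. \<phi> i s) - integral {0..1} (\<lambda>t. \<Sum>i<M. \<phi> i t) =
      (\<Sum>i<M. \<phi> i s - integral {0..1} (\<phi> i))"
    by (simp add: sum_subtractf)
next
  fix \<phi> \<phi>'
  assume C: "C1_fun \<phi> \<phi>'"
  show "norm (\<phi> s - integral {0..1} \<phi>) \<le> integral {0..1} (\<lambda>t. norm (\<phi>' t))"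
    using s by (intro norm_minus_average_le C1_osc_le[OF C1_funD(1)[OF C] C1_funD(3)[OF C]] C1_funD(2)[OF C])
qed

lemma sum_child_osc:
  assumes "b > 0" "continuous_on UNIV \<phi>"
  shows "(\<Sum>c<b. child_osc b c \<phi>) = 0"
proof -
  have "(\<Sum>c<b. integral {0..1} (\<lambda>s. \<phi> ((real c + s) / real b))) =
     (\<Sum>c<b. real b *\<^sub>R integral {real c / real b..(real c + 1) / real b} \<phi>)"
    using assms by (intro sum.cong refl integral_affine01) auto
  also have "\<dots> = real b *\<^sub>R integral {0..1} \<phi>"
    by (simp only: scaleR_sum_right[symmetric] sum_integral_pieces[OF assms])
  finally show ?thesis by (simp add: child_osc_def sum_subtractf scaleR_conv_of_real)
qed

lemma child_osc_cell:
  assumes "b > 0"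
  shows "child_osc b c (\<lambda>t. F ((real p + t) / real b ^ j)) =
    cell_average b F (Suc j) (p * b + c) - cell_average b F j p"
proof -
  have "(real p + (real c + s) / real b) / real b ^ j = (real (p * b + c) + s) / real b ^ Suc j" for s
    using assms by (simp add: field_simps)
  then show ?thesis by (simp add: child_osc_def cell_average_def)
qed

lemma fold_average_Suc:
  assumes b: "b > 0" and \<pi>: "bij_betw \<pi> {..<b} {..<b}"
  shows "(\<Sum>c<b. fold_average b G k ((real (\<pi> c) + y) / real b)) = of_nat b * fold_average b G (Suc k) y"
proof -
  have "(\<Sum>c<b. fold_average b G k ((real (\<pi> c) + y) / real b)) =
      (\<Sum>c<b. fold_average b G k ((real c + y) / real b))"
    by (rule sum.reindex_bij_betw[OF \<pi>])
  also have "\<dots> = (\<Sum>c<b. (\<Sum>v<b ^ k. G ((real (v * b + c) + y) / real b ^ Suc k)) / of_nat b ^ k)"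
  proof (rule sum.cong[OF refl])
    fix c
    have "(real v + (real c + y) / real b) / real b ^ k = (real (v * b + c) + y) / real b ^ Suc k" for v
      using b by (simp add: field_simps)
    then show "fold_average b G k ((real c + y) / real b) =
        (\<Sum>v<b ^ k. G ((real (v * b + c) + y) / real b ^ Suc k)) / of_nat b ^ k"
      by (simp add: fold_average_def)
  qed
  also have "\<dots> = (\<Sum>c<b. \<Sum>v<b ^ k. G ((real (v * b + c) + y) / real b ^ Suc k)) / of_nat b ^ k"
    by (rule sum_divide_distrib[symmetric])
  also have "(\<Sum>c<b. \<Sum>v<b ^ k. G ((real (v * b + c) + y) / real b ^ Suc k)) =
      (\<Sum>v<b ^ Suc k. G ((real v + y) / real b ^ Suc k))"
    unfolding power_Suc2 sum_lessThan_mult by (rule sum.swap)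
  finally show ?thesis using b by (simp add: fold_average_def)
qed

text \<open>Passing from level \<open>j\<close> to \<open>Suc j\<close> reveals one more digit
  \<open>c\<close> of the first coordinate. Averaging over that digit turns the
  \<open>k\<close>-fold mean into the \<open>Suc k\<close>-fold one
  (\<open>fold_average_Suc\<close>), so the coarser sum can be written over the finer cells with the
  mean of the parent cell, and only differences of child and parent remain.\<close>

lemma telescope_step:
  assumes b: "b > 0" and \<pi>: "\<And>j. bij_betw (\<pi> j) {..<b} {..<b}"
  shows "(\<Sum>u<b ^ Suc j. cell_average b F (Suc j) u * fold_average b G k (radinv b \<pi> (Suc j) u)) / of_nat b ^ Suc j
     - (\<Sum>u<b ^ j. cell_average b F j u * fold_average b G (Suc k) (radinv b \<pi> j u)) / of_nat b ^ j
     = (\<Sum>c<b. \<Sum>p<b ^ j. child_osc b c (\<lambda>t. F ((real p + t) / real b ^ j)) *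
         fold_average b G k ((real (\<pi> j c) + radinv b \<pi> j p) / real b)) / of_nat b ^ Suc j"
proof -
  have "(\<Sum>c<b. \<Sum>p<b ^ j. child_osc b c (\<lambda>t. F ((real p + t) / real b ^ j)) *
         fold_average b G k ((real (\<pi> j c) + radinv b \<pi> j p) / real b))
    = (\<Sum>p<b ^ j. \<Sum>c<b. (cell_average b F (Suc j) (p * b + c) - cell_average b F j p) *
         fold_average b G k ((real (\<pi> j c) + radinv b \<pi> j p) / real b))"
    unfolding child_osc_cell[OF b] by (rule sum.swap)
  also have "\<dots> = (\<Sum>p<b ^ j. (\<Sum>c<b. cell_average b F (Suc j) (p * b + c) *
         fold_average b G k ((real (\<pi> j c) + radinv b \<pi> j p) / real b))
       - cell_average b F j p * (of_nat b * fold_average b G (Suc k) (radinv b \<pi> j p)))"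
    by (intro sum.cong refl)
      (simp add: left_diff_distrib sum_subtractf sum_distrib_left[symmetric] fold_average_Suc[OF b \<pi>])
  also have "\<dots> = (\<Sum>u<b ^ Suc j. cell_average b F (Suc j) u * fold_average b G k (radinv b \<pi> (Suc j) u))
     - of_nat b * (\<Sum>u<b ^ j. cell_average b F j u * fold_average b G (Suc k) (radinv b \<pi> j u))"
    using b by (simp only: power_Suc2 sum_lessThan_mult) (simp add: sum_subtractf sum_distrib_left mult_ac)
  finally show ?thesis using b by (simp add: field_simps)
qed

text \<open>The terms are largest where \<open>a * q ^ k\<close> is near 1 and decay geometrically
  on both sides, so the bound is uniform in \<open>a\<close> and \<open>K\<close>.\<close>

lemma sum_min_geometric:
  fixes a q :: real
  assumes a: "a > 0" and q: "q > 1"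
  shows "(\<Sum>k<K. min (a * q ^ k) (1 / (a * q ^ k))) \<le> 2 * q / (q - 1)"
proof -
  define S where "S K = (\<Sum>k<K. min (a * q ^ k) (1 / (a * q ^ k)))" for K
  define c where "c = q / (q - 1)"
  have c: "c > 1" using q by (simp add: c_def)
  have cq: "c - 1 = 1 / (q - 1)" "c * (1 / q) = 1 / (q - 1)" using q by (simp_all add: c_def field_simps)
  have pos: "a * q ^ k > 0" for k using a q by simp
  \<comment> \<open>The claim strengthens the bound for the induction: up to the peak it is the
    growing geometric series, beyond it the tail \<open>c / (a * q ^ K)\<close> still to come is
    held in reserve.\<close>
  have "if a * q ^ K \<le> 1 then S K \<le> a * q ^ K / (q - 1) else S K \<le> 2 * c - c / (a * q ^ K)" for K
  proof (induction K)
    case 0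
    have "c / a \<le> 2 * c" if "a > 1" using that c a by (simp add: field_simps)
    then show ?case using a q by (auto simp: S_def)
  next
    case (Suc K)
    let ?t = "a * q ^ K"
    have SS: "S (Suc K) = S K + min ?t (1 / ?t)" by (simp add: S_def)
    have tS: "a * q ^ Suc K = ?t * q" by simp
    consider (1) "?t * q \<le> 1" | (2) "?t \<le> 1" "?t * q > 1" | (3) "?t > 1" by linarith
    then show ?case
    proof cases
      case 1
      have "?t * 1 \<le> ?t * q" using pos[of K] q by (intro mult_left_mono) auto
      then have "?t \<le> 1" using 1 by linarith
      then have "S (Suc K) \<le> ?t / (q - 1) + ?t" using Suc SS by auto
      also have "\<dots> = ?t * q / (q - 1)" using q by (simp add: field_simps)
      finally show ?thesis using 1 by (simp only: tS if_True)
    next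
      case 2
      have "S (Suc K) \<le> ?t / (q - 1) + ?t" using Suc SS 2 by auto
      also have "\<dots> = ?t * c" using q by (simp add: c_def field_simps)
      also have "\<dots> \<le> c" using 2 c by (simp add: mult_le_cancel_right1)
      finally have "S (Suc K) \<le> c" .
      moreover have "c / (?t * q) \<le> c / 1" using 2 c by (intro divide_left_mono) auto
      ultimately have "S (Suc K) \<le> 2 * c - c / (?t * q)" by simp
      then show ?thesis using 2 by (simp only: tS) simp
    next
      case 3
      have "?t * 1 \<le> ?t * q" using pos[of K] q by (intro mult_left_mono) auto
      then have tq: "\<not> ?t * q \<le> 1" using 3 by linarith
      have "S (Suc K) \<le> 2 * c - c / ?t + 1 / ?t" using Suc SS 3 by auto
      also have "\<dots> = 2 * c - (c - 1) / ?t" by (simp add: diff_divide_distrib)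
      also have "(c - 1) / ?t = c / (?t * q)" unfolding cq(1) cq(2)[symmetric] by simp
      finally show ?thesis using tq by (simp only: tS) simp
    qed
  qed
  from this[of K] have "S K \<le> 2 * c"
  proof (cases "a * q ^ K \<le> 1")
    case True
    have "a * q ^ K / (q - 1) \<le> 1 / (q - 1)" using True q by (intro divide_right_mono) auto
    also have "\<dots> \<le> 2 * c" using cq c by linarith
    finally show ?thesis using \<open>if a * q ^ K \<le> 1 then _ else _\<close> True by simp
  next
    case False
    have "c / (a * q ^ K) \<ge> 0" using c pos[of K] by simp
    then show ?thesis using \<open>if a * q ^ K \<le> 1 then _ else _\<close> False by simp
  qed
  then show ?thesis by (simp add: S_def c_def)
qed

lemma integral_fold:
  fixes f :: "real \<Rightarrow> 'a::euclidean_space"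
  assumes "M > 0" and c: "continuous_on UNIV f"
  shows "(\<lambda>y. f ((real v + y) / real M)) integrable_on {0..1}"
    and "(\<Sum>v<M. integral {0..1} (\<lambda>y. f ((real v + y) / real M))) = real M *\<^sub>R integral {0..1} f"
proof -
  have "continuous_on {0..1} (\<lambda>y. f ((real v + y) * (1 / real M)))"
    by (intro continuous_on_compose2[OF c] continuous_intros) auto
  then show "(\<lambda>y. f ((real v + y) / real M)) integrable_on {0..1}"
    by (intro integrable_continuous_real) simp
  have "(\<Sum>v<M. integral {0..1} (\<lambda>y. f ((real v + y) / real M))) =
      (\<Sum>v<M. real M *\<^sub>R integral {real v / real M..(real v + 1) / real M} f)"
    using assms by (intro sum.cong refl integral_affine01) auto
  also have "\<dots> = real M *\<^sub>R integral {0..1} f"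
    by (simp only: scaleR_sum_right[symmetric] sum_integral_pieces[OF assms])
  finally show "(\<Sum>v<M. integral {0..1} (\<lambda>y. f ((real v + y) / real M))) = real M *\<^sub>R integral {0..1} f" .
qed

text \<open>The remainder in the first-order Euler-Maclaurin expansion of \<open>fold_average\<close>.\<close>

definition fold_remainder :: "nat \<Rightarrow> (real \<Rightarrow> complex) \<Rightarrow> nat \<Rightarrow> real \<Rightarrow> complex" where
  "fold_remainder b G k y = fold_average b G k y - integral {0..1} G -
     of_real (1 / real b ^ k) * (of_real (y - 1 / 2) * (G 1 - G 0))"

text \<open>The remainder has mean zero, so its supremum is bounded by the integral of the norm of
  its derivative. That derivative is \<open>b^-k\<close> times the error of a Riemann mean of
  \<open>G'\<close>, which is at most \<open>D * Y / b ^ k\<close> pointwise by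
  \<open>riemann_sum\<close> and at most \<open>2 * Y\<close> in the integral by the triangle
  inequality; the minimum records both.\<close>

lemma fold_remainder_bounds:
  fixes k :: nat
  assumes b: "b > 0" and G: "C1_fun G G'" and G': "C1_fun G' G''"
    and V: "integral {0..1} (\<lambda>y. norm (G' y)) \<le> Y"
    and W: "integral {0..1} (\<lambda>y. norm (G'' y)) \<le> D * Y"
  defines "R' \<equiv> \<lambda>y. of_real (1 / real b ^ k) * (fold_average b G' k y - (G 1 - G 0))"
  shows "C1_fun (fold_remainder b G k) R'"
    and "integral {0..1} (\<lambda>y. norm (R' y)) \<le> 2 * Y / real b ^ k * min 1 (D / real b ^ k)"
    and "y \<in> {0..1} \<Longrightarrow> norm (fold_remainder b G k y) \<le> 2 * Y / real b ^ k * min 1 (D / real b ^ k)"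
proof -
  let ?M = "real b ^ k"
  have M: "?M > 0" using b by simp
  have bk: "b ^ k > 0" using b by simp
  have C1: "C1_fun (\<lambda>y. fold_average b G k y) (\<lambda>y. of_real (1 / ?M) * fold_average b G' k y)"
  proof -
    have "C1_fun (\<lambda>y. \<Sum>v<b ^ k. G ((real v + y) / ?M)) (\<lambda>y. \<Sum>v<b ^ k. (1 / ?M) *\<^sub>R G' ((real v + y) / ?M))"
      by (rule C1_fun_sum) (rule C1_fun_affine[OF G])
    from C1_fun_cmult[OF this, of "of_real (1 / ?M)"] show ?thesis
      by (simp add: fold_average_def[abs_def] sum_distrib_left scaleR_conv_of_real divide_inverse mult_ac)
  qed
  show CR: "C1_fun (fold_remainder b G k) R'"
    using C1 unfolding C1_fun_def fold_remainder_def R'_def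
    by (auto intro!: derivative_eq_intros continuous_intros simp: algebra_simps)
  have intG': "integral {0..1} G' = G 1 - G 0"
    by (rule integral_unique, rule fundamental_theorem_of_calculus)
      (auto intro: has_vector_derivative_at_within C1_funD[OF G])
  have W0: "D * Y \<ge> 0"
    by (rule order_trans[OF integral_nonneg W]) (auto intro: integrable_continuous_real C1_funD[OF G'])
  have e: "norm (G 1 - G 0) \<le> Y"
    using C1_osc_le[OF C1_funD(1)[OF G] C1_funD(3)[OF G], of 1 0 1 0] V by simp
  have I1: "integral {0..1} (\<lambda>y. norm (R' y)) \<le> D * Y / (?M * ?M)"
  proof (rule integral_le_const01)
    show "continuous_on {0..1} (\<lambda>y. norm (R' y))" by (rule C1_funD[OF CR])
    fix y :: real assume y: "y \<in> {0..1}"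
    have "norm ((\<Sum>p<b ^ k. G' ((real p + y) / real (b ^ k))) - real (b ^ k) *\<^sub>R integral {0..1} G') \<le> D * Y"
      using riemann_sum(1)[OF C1_funD(1)[OF G'] C1_funD(3)[OF G'] bk y] W by linarith
    moreover have "R' y = of_real (1 / (?M * ?M)) * ((\<Sum>p<b ^ k. G' ((real p + y) / real (b ^ k))) - real (b ^ k) *\<^sub>R integral {0..1} G')"
      using M by (simp add: R'_def fold_average_def intG' scaleR_conv_of_real field_simps)
    ultimately show "norm (R' y) \<le> D * Y / (?M * ?M)"
      using M by (simp only: norm_mult norm_of_real) (simp add: divide_right_mono)
  qed
  have I2: "integral {0..1} (\<lambda>y. norm (R' y)) \<le> 2 * Y / ?M"
  proof -
    have int: "(\<lambda>y. norm (G' ((real v + y) / real (b ^ k)))) integrable_on {0..1}" for v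
      by (rule integral_fold(1)[OF bk C1_funD(4)[OF G]])
    have "integral {0..1} (\<lambda>y. norm (R' y)) \<le> integral {0..1} (\<lambda>y. 1 / ?M * (1 / ?M *
        (\<Sum>v<b ^ k. norm (G' ((real v + y) / real (b ^ k)))) + Y))"
    proof (rule Henstock_Kurzweil_Integration.integral_le)
      show "(\<lambda>y. norm (R' y)) integrable_on {0..1}"
        by (intro integrable_continuous_real C1_funD[OF CR])
      show "(\<lambda>y. 1 / ?M * (1 / ?M * (\<Sum>v<b ^ k. norm (G' ((real v + y) / real (b ^ k)))) + Y)) integrable_on {0..1}"
        by (intro integrable_on_mult_right integrable_add integrable_sum int) auto
      fix y :: real
      have "norm (fold_average b G' k y - (G 1 - G 0)) \<le> norm (fold_average b G' k y) + norm (G 1 - G 0)"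
        by (rule norm_triangle_ineq4)
      moreover have "norm (fold_average b G' k y) \<le> 1 / ?M * (\<Sum>v<b ^ k. norm (G' ((real v + y) / real (b ^ k))))"
        using M by (simp add: fold_average_def norm_divide norm_power divide_right_mono sum_norm_le)
      ultimately have "norm (fold_average b G' k y - (G 1 - G 0)) \<le>
         1 / ?M * (\<Sum>v<b ^ k. norm (G' ((real v + y) / real (b ^ k)))) + Y" using e by linarith
      from mult_left_mono[OF this, of "1 / ?M"] M
      show "norm (R' y) \<le> 1 / ?M * (1 / ?M * (\<Sum>v<b ^ k. norm (G' ((real v + y) / real (b ^ k)))) + Y)"
        by (simp only: R'_def norm_mult norm_of_real) simp
    qed
    also have "\<dots> = 1 / ?M * (1 / ?M * (\<Sum>v<b ^ k. integral {0..1} (\<lambda>y. norm (G' ((real v + y) / real (b ^ k))))) + Y)"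
    proof -
      have "integral {0..1} (\<lambda>y. \<Sum>v<b ^ k. norm (G' ((real v + y) / real (b ^ k)))) =
          (\<Sum>v<b ^ k. integral {0..1} (\<lambda>y. norm (G' ((real v + y) / real (b ^ k)))))"
        by (intro integral_sum int finite_lessThan)
      moreover have "integral {0..1} (\<lambda>y. 1 / ?M * (\<Sum>v<b ^ k. norm (G' ((real v + y) / real (b ^ k)))) + Y)
         = integral {0..1} (\<lambda>y. 1 / ?M * (\<Sum>v<b ^ k. norm (G' ((real v + y) / real (b ^ k)))))
          + integral {0..1} (\<lambda>y::real. Y)"
        by (intro Henstock_Kurzweil_Integration.integral_add integrable_on_mult_right integrable_sum int) auto
      ultimately show ?thesis by (simp only: integral_mult_right) simp
    qed
    also have "\<dots> = 1 / ?M * (integral {0..1} (\<lambda>y. norm (G' y)) + Y)"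
      unfolding integral_fold(2)[OF bk C1_funD(4)[OF G]] using M by simp
    also have "\<dots> \<le> 1 / ?M * (2 * Y)"
      using V M by (intro mult_left_mono) auto
    finally show ?thesis by simp
  qed
  show I: "integral {0..1} (\<lambda>y. norm (R' y)) \<le> 2 * Y / ?M * min 1 (D / ?M)"
  proof (cases "D / ?M \<le> 1")
    case True
    have "2 * Y / ?M * (D / ?M) \<ge> D * Y / (?M * ?M)" using W0 M by (simp add: field_simps)
    then show ?thesis using I1 True by (simp add: min_absorb2)
  next
    case False
    then show ?thesis using I2 by (simp add: min_absorb1)
  qed
  assume y: "y \<in> {0..1}"
  \<comment> \<open>Folding preserves the mean, and \<open>y - 1 / 2\<close> has mean zero.\<close>
  have "integral {0..1} (fold_remainder b G k) = 0"
  proof -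
    have int: "(\<lambda>y. G ((real v + y) / real (b ^ k))) integrable_on {0..1}" for v
      by (rule integral_fold(1)[OF bk C1_funD(2)[OF G]])
    have "integral {0..1} (\<lambda>y. \<Sum>v<b ^ k. G ((real v + y) / real (b ^ k))) = of_real ?M * integral {0..1} G"
    proof -
      have "integral {0..1} (\<lambda>y. \<Sum>v<b ^ k. G ((real v + y) / real (b ^ k))) =
          (\<Sum>v<b ^ k. integral {0..1} (\<lambda>y. G ((real v + y) / real (b ^ k))))"
        by (intro integral_sum int finite_lessThan)
      then show ?thesis
        unfolding integral_fold(2)[OF bk C1_funD(2)[OF G]] by (simp add: scaleR_conv_of_real)
    qed
    moreover have "(\<lambda>y. \<Sum>v<b ^ k. G ((real v + y) / real (b ^ k))) integrable_on {0..1}"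
      by (intro integrable_sum int finite_lessThan)
    ultimately have "((\<lambda>y. \<Sum>v<b ^ k. G ((real v + y) / real (b ^ k))) has_integral of_real ?M * integral {0..1} G) {0..1}"
      by (simp only: has_integral_iff)
    from has_integral_divide[OF this, of "of_nat b ^ k"] b
    have fa: "(fold_average b G k has_integral integral {0..1} G) {0..1}"
      by (simp add: fold_average_def[abs_def])
    have "((\<lambda>y. y - 1 / 2) has_integral (1\<^sup>2 / 2 - 1 / 2 * 1) - (0\<^sup>2 / 2 - 1 / 2 * 0)) {0..1::real}"
      by (rule fundamental_theorem_of_calculus)
        (auto intro!: derivative_eq_intros simp flip: has_real_derivative_iff_has_vector_derivative)
    then have "((\<lambda>y. y - 1 / 2) has_integral 0) {0..1::real}" by simp
    then have "((\<lambda>y. complex_of_real (y - 1 / 2)) has_integral of_real 0) {0..1}"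
      by (rule has_integral_of_real)
    from has_integral_mult_right[OF has_integral_mult_left[OF this, of "G 1 - G 0"], of "of_real (1 / ?M)"]
    have lin: "((\<lambda>y. of_real (1 / ?M) * (of_real (y - 1 / 2) * (G 1 - G 0))) has_integral 0) {0..1}"
      by (simp only: of_real_0 mult_zero_left mult_zero_right)
    have "((\<lambda>y::real. integral {0..1} G) has_integral integral {0..1} G) {0..1}"
      using has_integral_const_real[of "integral {0..1} G" 0 1] by simp
    from has_integral_diff[OF has_integral_diff[OF fa this] lin]
    show ?thesis by (simp add: fold_remainder_def[abs_def] integral_unique)
  qed
  then have "norm (fold_remainder b G k y) = norm (fold_remainder b G k y - integral {0..1} (fold_remainder b G k))"
    by simp
  also have "\<dots> \<le> integral {0..1} (\<lambda>y. norm (R' y))"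
    using y by (intro norm_minus_average_le C1_osc_le[OF C1_funD(1)[OF CR] C1_funD(3)[OF CR]] C1_funD(2)[OF CR])
  finally show "norm (fold_remainder b G k y) \<le> 2 * Y / ?M * min 1 (D / ?M)" using I by linarith
qed

definition child_sum ::
  "nat \<Rightarrow> (nat \<Rightarrow> nat \<Rightarrow> nat) \<Rightarrow> (real \<Rightarrow> complex) \<Rightarrow> nat \<Rightarrow> nat \<Rightarrow> (real \<Rightarrow> complex) \<Rightarrow> complex" where
  "child_sum b \<pi> F j c g =
     (\<Sum>p<b ^ j. child_osc b c (\<lambda>t. F ((real p + t) / real b ^ j)) * g (radinv b \<pi> j p))"

text \<open>The first bound is the square-root gain on levels finer than \<open>D\<close>, with the
  endpoint term removed by \<open>F 1 = F 0\<close>, and the total variation bound otherwise. The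
  second serves the coarse levels: there the cell means are bounded through the \<open>L_1\<close>
  norm \<open>X / D\<close> of \<open>F\<close> itself.\<close>

lemma child_sum_le:
  assumes F: "C1_fun F F'" and F': "C1_fun F' F''" and g: "C1_fun g g'"
    and b: "b \<ge> 2" and \<pi>: "\<And>j. bij_betw (\<pi> j) {..<b} {..<b}" and cb: "c < b"
    and gB: "\<And>y. y \<in> {0..1} \<Longrightarrow> norm (g y) \<le> B" "integral {0..1} (\<lambda>y. norm (g' y)) \<le> B"
    and I: "integral {0..1} (\<lambda>y. norm (F y)) \<le> X / D"
    and V: "integral {0..1} (\<lambda>y. norm (F' y)) \<le> X"
    and W: "integral {0..1} (\<lambda>y. norm (F'' y)) \<le> D * X"
    and D: "1 \<le> D" and e: "F 1 = F 0"
  shows "norm (child_sum b \<pi> F j c g) \<le> B * ((real b + 2) * X) * min 1 (sqrt (D / real b ^ j))"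
    and "norm (child_sum b \<pi> F j c g) \<le> B * (2 * real b * X) * (real b ^ j / D)"
proof -
  have b0: "b > 0" using b by simp
  have B0: "B \<ge> 0" using order_trans[OF norm_ge_zero gB(1)[of 0]] by simp
  have X0: "X \<ge> 0"
    by (rule order_trans[OF integral_nonneg V]) (auto intro: integrable_continuous_real C1_funD[OF F])
  have bj: "b ^ j > 0" using b by simp
  have r01: "radinv b \<pi> j p \<in> {0..1}" for p
    using radinv_bounds[OF b0, of \<pi> j p] bij_betwE[OF \<pi>] by auto
  let ?\<Lambda> = "\<lambda>p. child_osc b c (\<lambda>t. F ((real p + t) / real b ^ j))"
  have triv: "norm (child_sum b \<pi> F j c g) \<le> (\<Sum>p<b ^ j. norm (?\<Lambda> p)) * B"
    unfolding child_sum_def sum_distrib_right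
    by (rule sum_norm_le) (auto simp: norm_mult intro!: mult_left_mono gB(1) r01)
  have cell: "(\<Sum>u<b ^ m. norm (cell_average b F m u)) \<le> real b ^ m * (X / D)" for m
  proof -
    have bm: "b ^ m > 0" using b by simp
    have "(\<Sum>u<b ^ m. norm (cell_average b F m u)) \<le>
        (\<Sum>u<b ^ m. integral {0..1} (\<lambda>t. norm (F ((real u + t) / real (b ^ m)))))"
      unfolding cell_average_def of_nat_power[symmetric]
      by (intro sum_mono integral_norm_bound_integral integral_fold(1)[OF bm] C1_funD[OF F]) auto
    also have "\<dots> = real b ^ m * integral {0..1} (\<lambda>y. norm (F y))"
      by (subst integral_fold(2)[OF bm C1_funD(5)[OF F]]) simp
    also have "\<dots> \<le> real b ^ m * (X / D)"
      by (rule mult_left_mono[OF I]) simp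
    finally show ?thesis .
  qed
  have t1: "(\<Sum>p<b ^ j. norm (?\<Lambda> p)) \<le> X"
  proof -
    have "(\<Sum>p<b ^ j. norm (?\<Lambda> p)) \<le>
        (\<Sum>p<b ^ j. integral {0..1} (\<lambda>t. norm ((1 / real b ^ j) *\<^sub>R F' ((real p + t) / real b ^ j))))"
      using osc_functional_child[OF cb] C1_fun_affine[OF F] unfolding osc_functional_def
      by (intro sum_mono) blast
    also have "\<dots> = 1 / real b ^ j * (\<Sum>p<b ^ j. integral {0..1} (\<lambda>t. norm (F' ((real p + t) / real (b ^ j)))))"
      by (simp add: sum_distrib_left)
    also have "\<dots> = integral {0..1} (\<lambda>y. norm (F' y))"
      by (subst integral_fold(2)[OF bj C1_funD(4)[OF F]]) (use b in simp)
    finally show ?thesis using V by linarith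
  qed
  have t2: "(\<Sum>p<b ^ j. norm (?\<Lambda> p)) \<le> 2 * real b * X * (real b ^ j / D)"
  proof -
    have "(\<Sum>p<b ^ j. norm (?\<Lambda> p)) \<le>
       (\<Sum>p<b ^ j. norm (cell_average b F (Suc j) (p * b + c)) + norm (cell_average b F j p))"
      unfolding child_osc_cell[OF b0] by (intro sum_mono norm_triangle_ineq4)
    also have "\<dots> = (\<Sum>p<b ^ j. norm (cell_average b F (Suc j) (p * b + c))) + (\<Sum>p<b ^ j. norm (cell_average b F j p))"
      by (rule sum.distrib)
    also have "(\<Sum>p<b ^ j. norm (cell_average b F (Suc j) (p * b + c)))
       \<le> (\<Sum>p<b ^ j. \<Sum>c<b. norm (cell_average b F (Suc j) (p * b + c)))"
      using cb by (intro sum_mono member_le_sum) auto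
    also have "\<dots> = (\<Sum>u<b ^ Suc j. norm (cell_average b F (Suc j) u))"
      by (simp only: power_Suc2 sum_lessThan_mult)
    also have "\<dots> \<le> real b ^ Suc j * (X / D)" by (rule cell)
    finally have "(\<Sum>p<b ^ j. norm (?\<Lambda> p)) \<le> real b ^ Suc j * (X / D) + real b ^ j * (X / D)"
      using cell[of j] by linarith
    also have "\<dots> \<le> real b ^ Suc j * (X / D) + real b ^ Suc j * (X / D)"
      using b X0 D by (intro add_left_mono mult_right_mono) (auto simp: mult_le_cancel_right2)
    finally show ?thesis by (simp add: mult_ac)
  qed
  show "norm (child_sum b \<pi> F j c g) \<le> B * (2 * real b * X) * (real b ^ j / D)"
    using mult_right_mono[OF t2 B0] triv by (simp add: mult_ac)
  show "norm (child_sum b \<pi> F j c g) \<le> B * ((real b + 2) * X) * min 1 (sqrt (D / real b ^ j))"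
  proof (cases "D \<le> real b ^ j")
    case True
    then have m: "min 1 (sqrt (D / real b ^ j)) = sqrt (D / real b ^ j)"
      using bj by (simp add: min_absorb2 divide_le_eq)
    show ?thesis
      using weighted_average_bound_sqrt[OF osc_functional_child[OF cb] F F' g b \<pi> gB V W D True X0] e
      by (simp add: child_sum_def m mult_ac)
  next
    case False
    then have m: "min 1 (sqrt (D / real b ^ j)) = 1"
      using bj by (simp add: min_absorb1 le_divide_eq)
    have "X * B \<le> (real b + 2) * X * B"
      using mult_right_mono[of 1 "real b + 2" X] X0 B0 by (intro mult_right_mono) auto
    moreover have "(\<Sum>p<b ^ j. norm (?\<Lambda> p)) * B \<le> X * B" by (rule mult_right_mono[OF t1 B0])
    ultimately show ?thesis using triv unfolding m by (simp add: mult_ac)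
  qed
qed

text \<open>Both bounds in one symmetric form; the linear gain on the coarse side is weakened to a
  square root so that \<open>sum_min_geometric\<close> covers both sides at once.\<close>

lemma child_sum_mu:
  assumes F: "C1_fun F F'" and F': "C1_fun F' F''" and g: "C1_fun g g'"
    and b: "b \<ge> 2" and \<pi>: "\<And>j. bij_betw (\<pi> j) {..<b} {..<b}" and cb: "c < b"
    and gB: "\<And>y. y \<in> {0..1} \<Longrightarrow> norm (g y) \<le> B" "integral {0..1} (\<lambda>y. norm (g' y)) \<le> B"
    and I: "integral {0..1} (\<lambda>y. norm (F y)) \<le> X / D"
    and V: "integral {0..1} (\<lambda>y. norm (F' y)) \<le> X"
    and W: "integral {0..1} (\<lambda>y. norm (F'' y)) \<le> D * X"
    and D: "1 \<le> D" and e: "F 1 = F 0"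
  shows "norm (child_sum b \<pi> F j c g) \<le> B * (2 * (real b + 2) * X) *
     min (sqrt (real b ^ j / D)) (1 / sqrt (real b ^ j / D))"
proof -
  have B0: "B \<ge> 0" using order_trans[OF norm_ge_zero gB(1)[of 0]] by simp
  have X0: "X \<ge> 0"
    by (rule order_trans[OF integral_nonneg V]) (auto intro: integrable_continuous_real C1_funD[OF F])
  have c1: "norm (child_sum b \<pi> F j c g) \<le> B * ((real b + 2) * X) * min 1 (sqrt (D / real b ^ j))"
    by (rule child_sum_le(1)[OF F F' g b \<pi> cb gB I V W D e])
  have c2: "norm (child_sum b \<pi> F j c g) \<le> B * (2 * real b * X) * (real b ^ j / D)"
    by (rule child_sum_le(2)[OF F F' g b \<pi> cb gB I V W D e])
  define t where "t = real b ^ j / D"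
  have t: "t > 0" using b D by (simp add: t_def)
  have s: "sqrt (D / real b ^ j) = 1 / sqrt t" by (simp add: t_def real_sqrt_divide)
  show ?thesis
  proof (cases "t \<le> 1")
    case True
    then have st: "sqrt t \<le> 1" using t by simp
    have "sqrt t * sqrt t = t" using t by simp
    then have ts: "t \<le> sqrt t" using st t mult_left_mono[OF st, of "sqrt t"] by simp
    have m: "min (sqrt t) (1 / sqrt t) = sqrt t" using st t by (simp add: min_absorb1 le_divide_eq)
    have "B * (2 * real b * X) * t \<le> B * (2 * (real b + 2) * X) * sqrt t"
      using B0 X0 ts t by (intro mult_mono) auto
    then show ?thesis using c2 unfolding t_def[symmetric] m by linarith
  next
    case False
    then have st: "sqrt t \<ge> 1" by simp
    have "1 / sqrt t \<le> sqrt t"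
      using False by (simp add: divide_le_eq)
    then have m: "min (sqrt t) (1 / sqrt t) = 1 / sqrt t" by simp
    have "B * ((real b + 2) * X) * min 1 (1 / sqrt t) \<le> B * (2 * (real b + 2) * X) * (1 / sqrt t)"
      using B0 X0 t by (intro mult_mono) auto
    then show ?thesis using c1 unfolding t_def[symmetric] m s by linarith
  qed
qed

text \<open>The folded mean of \<open>G\<close> is a constant plus a linear term plus
  \<open>fold_remainder\<close>. The constant meets functionals that sum to zero over the children.
  The linear term has slope \<open>(G 1 - G 0) / b ^ k\<close> and inherits the decay of
  \<open>child_sum_mu\<close> around \<open>b ^ j = D1\<close>; the remainder decays around
  \<open>b ^ k = D2\<close> and yields the second term.\<close>

lemma telescope_term_bound:
  fixes j k :: nat
  assumes F: "C1_fun F F'" and F': "C1_fun F' F''" and G: "C1_fun G G'" and G': "C1_fun G' G''"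
    and b: "b \<ge> 2" and \<pi>: "\<And>j. bij_betw (\<pi> j) {..<b} {..<b}"
    and FI: "integral {0..1} (\<lambda>y. norm (F y)) \<le> X / D1"
    and FV: "integral {0..1} (\<lambda>y. norm (F' y)) \<le> X"
    and FW: "integral {0..1} (\<lambda>y. norm (F'' y)) \<le> D1 * X"
    and GV: "integral {0..1} (\<lambda>y. norm (G' y)) \<le> Y"
    and GW: "integral {0..1} (\<lambda>y. norm (G'' y)) \<le> D2 * Y"
    and D: "1 \<le> D1" "1 \<le> D2" and e: "F 1 = F 0"
  defines "\<mu> \<equiv> \<lambda>t::real. min (sqrt t) (1 / sqrt t)" and "n \<equiv> Suc (j + k)"
  shows "norm ((\<Sum>c<b. \<Sum>p<b ^ j. child_osc b c (\<lambda>t. F ((real p + t) / real b ^ j)) *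
         fold_average b G k ((real (\<pi> j c) + radinv b \<pi> j p) / real b)) / of_nat b ^ Suc j)
     \<le> 2 * real b * (real b + 2) / real b ^ n * (norm (G 1 - G 0) * X * \<mu> (real b ^ j / D1) +
        X * Y * sqrt (real b * (D1 * D2 / real b ^ n)) * \<mu> (real b ^ k / D2))"
proof -
  have b0: "b > 0" using b by simp
  have \<pi>lt: "\<pi> j c < b" if "c < b" for c using bij_betwE[OF \<pi>[of j]] that by auto
  have X0: "X \<ge> 0"
    by (rule order_trans[OF integral_nonneg FV]) (auto intro: integrable_continuous_real C1_funD[OF F])
  have Y0: "Y \<ge> 0"
    by (rule order_trans[OF integral_nonneg GV]) (auto intro: integrable_continuous_real C1_funD[OF G])
  define R where "R = fold_remainder b G k"
  define R' where "R' = (\<lambda>y. of_real (1 / real b ^ k) * (fold_average b G' k y - (G 1 - G 0)))"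
  define Bk where "Bk = 2 * Y / real b ^ k * min 1 (D2 / real b ^ k)"
  note FR = fold_remainder_bounds[OF b0 G G' GV GW, where k = k, folded R_def R'_def Bk_def]
  have FR2: "integral {0..1} (\<lambda>y. norm (R' y)) \<le> Bk" using FR(2) by (simp only: R'_def)
  define \<Gamma> where "\<Gamma> = of_real (1 / real b ^ k) * (G 1 - G 0)"
  let ?\<Lambda> = "\<lambda>c p. child_osc b c (\<lambda>t. F ((real p + t) / real b ^ j))"
  let ?y = "\<lambda>c y. (real (\<pi> j c) + y) / real b"
  have dec: "fold_average b G k y = (integral {0..1} G - \<Gamma> / 2) + \<Gamma> * of_real y + R y" for y
    by (simp add: R_def fold_remainder_def \<Gamma>_def algebra_simps diff_divide_distrib)
  have cont: "continuous_on UNIV (\<lambda>t. F ((real p + t) / real b ^ j))" for p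
    by (rule continuous_on_affine) (rule C1_funD[OF F])
  have "(\<Sum>c<b. \<Sum>p<b ^ j. ?\<Lambda> c p * fold_average b G k (?y c (radinv b \<pi> j p)))
     = (integral {0..1} G - \<Gamma> / 2) * (\<Sum>c<b. \<Sum>p<b ^ j. ?\<Lambda> c p)
      + \<Gamma> * (\<Sum>c<b. child_sum b \<pi> F j c (\<lambda>y. of_real (?y c y))) + (\<Sum>c<b. child_sum b \<pi> F j c (\<lambda>y. R (?y c y)))"
  proof -
    have "l * (K + \<Gamma> * a + r) = K * l + \<Gamma> * (l * a) + l * r" for l K a r :: complex
      by (simp add: algebra_simps)
    then show ?thesis
      unfolding dec child_sum_def by (simp only: sum.distrib sum_distrib_left)
  qed
  moreover have "(\<Sum>c<b. \<Sum>p<b ^ j. ?\<Lambda> c p) = 0"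
    by (subst sum.swap) (simp add: sum_child_osc[OF b0 cont])
  ultimately have eq: "(\<Sum>c<b. \<Sum>p<b ^ j. ?\<Lambda> c p * fold_average b G k (?y c (radinv b \<pi> j p)))
     = \<Gamma> * (\<Sum>c<b. child_sum b \<pi> F j c (\<lambda>y. of_real (?y c y))) + (\<Sum>c<b. child_sum b \<pi> F j c (\<lambda>y. R (?y c y)))"
    by simp
  have y01: "?y c y \<in> {0..1}" if "c < b" "y \<in> {0..1}" for c y
  proof -
    have "real (\<pi> j c) + 1 \<le> real b" using \<pi>lt[OF that(1)] by linarith
    then show ?thesis using that(2) b0 by auto
  qed
  have lin: "norm (child_sum b \<pi> F j c (\<lambda>y. of_real (?y c y))) \<le> 2 * (real b + 2) * X * \<mu> (real b ^ j / D1)"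
    if c: "c < b" for c
  proof -
    have id: "C1_fun of_real (\<lambda>_. 1)"
      unfolding C1_fun_def
      using has_vector_derivative_of_real[OF DERIV_ident] by (auto simp: has_vector_derivative_def)
    have "norm (child_sum b \<pi> F j c (\<lambda>y. of_real (?y c y))) \<le> 1 * (2 * (real b + 2) * X) *
        min (sqrt (real b ^ j / D1)) (1 / sqrt (real b ^ j / D1))"
    proof (rule child_sum_mu[OF F F' C1_fun_affine[OF id] b \<pi> c _ _ FI FV FW D(1) e])
      show "norm (complex_of_real (?y c y)) \<le> 1" if "y \<in> {0..1}" for y
        using y01[OF c that] unfolding norm_of_real by (simp only: atLeastAtMost_iff abs_of_nonneg)
      show "integral {0..1} (\<lambda>y::real. norm ((1 / real b) *\<^sub>R (1::complex))) \<le> 1"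
        using b by simp
    qed
    then show ?thesis by (simp add: \<mu>_def)
  qed
  have rem: "norm (child_sum b \<pi> F j c (\<lambda>y. R (?y c y))) \<le> Bk * ((real b + 2) * X) * min 1 (sqrt (D1 / real b ^ j))"
    if c: "c < b" for c
  proof (rule child_sum_le(1)[OF F F' C1_fun_affine[OF FR(1)] b \<pi> c _ _ FI FV FW D(1) e])
    show "norm (R (?y c y)) \<le> Bk" if "y \<in> {0..1}" for y
      by (rule FR(3)) (rule y01[OF c that])
    have "integral {0..1} (\<lambda>y. norm ((1 / real b) *\<^sub>R R' ((real (\<pi> j c) + y) / real b)))
       = 1 / real b * integral {0..1} (\<lambda>y. norm (R' ((real (\<pi> j c) + y) / real b)))"
      by simp
    also have "\<dots> = integral {real (\<pi> j c) / real b..(real (\<pi> j c) + 1) / real b} (\<lambda>y. norm (R' y))"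
      using b0 by (subst integral_affine01[OF _ C1_funD(4)[OF FR(1)]]) auto
    also have "\<dots> \<le> integral {0..1} (\<lambda>y. norm (R' y))"
      using y01[OF c, of 0] y01[OF c, of 1]
      by (intro integral_subset_le integrable_continuous_real C1_funD(4)[OF FR(1)]) auto
    finally show "integral {0..1} (\<lambda>y. norm ((1 / real b) *\<^sub>R R' ((real (\<pi> j c) + y) / real b))) \<le> Bk"
      using FR2 by linarith
  qed
  define t t' where "t = real b ^ j / D1" and "t' = real b ^ k / D2"
  \<comment> \<open>Since \<open>j + k + 1 = n\<close>, the two ratios are tied by
    \<open>1 / t = \<theta> * t'\<close>; the one missing level is the factor \<open>b\<close> in
    \<open>\<theta>\<close>.\<close>
  define \<theta> where "\<theta> = real b * (D1 * D2 / real b ^ n)"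
  have pos: "t > 0" "t' > 0" "\<theta> > 0" using b D by (auto simp: t_def t'_def \<theta>_def)
  have tt: "1 / t = \<theta> * t'"
    using b D by (simp add: t_def t'_def \<theta>_def n_def power_add field_simps)
  \<comment> \<open>The gain of \<open>F\<close> at level \<open>j\<close> reads
    \<open>sqrt (\<theta> * t')\<close>; together with the gain \<open>1 / t'\<close> of the
    remainder it decays on both sides of \<open>t' = 1\<close>.\<close>
  have mins: "min 1 (sqrt (D1 / real b ^ j)) * min 1 (D2 / real b ^ k) \<le> sqrt \<theta> * \<mu> t'"
  proof -
    have a: "min 1 (sqrt (D1 / real b ^ j)) \<le> sqrt \<theta> * sqrt t'"
    proof -
      have "D1 / real b ^ j = \<theta> * t'" using tt by (simp add: t_def)
      then show ?thesis by (simp add: real_sqrt_mult)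
    qed
    have c: "D2 / real b ^ k = 1 / t'" by (simp add: t'_def)
    have d: "min 1 (1 / t') \<ge> 0" using pos by simp
    have "min 1 (sqrt (D1 / real b ^ j)) * min 1 (1 / t') \<le> sqrt \<theta> * sqrt t' * min 1 (1 / t')"
      by (rule mult_right_mono[OF a d])
    moreover have "sqrt t' * min 1 (1 / t') \<le> \<mu> t'"
    proof -
      have "sqrt t' * (1 / t') = 1 / sqrt t'"
        using pos by (simp add: field_simps)
      then have "sqrt t' * min 1 (1 / t') \<le> 1 / sqrt t'"
        using mult_left_mono[of "min 1 (1 / t')" "1 / t'" "sqrt t'"] pos by simp
      moreover have "sqrt t' * min 1 (1 / t') \<le> sqrt t'"
        using mult_left_mono[of "min 1 (1 / t')" 1 "sqrt t'"] pos by simp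
      ultimately show ?thesis by (simp add: \<mu>_def)
    qed
    then have "sqrt \<theta> * (sqrt t' * min 1 (1 / t')) \<le> sqrt \<theta> * \<mu> t'"
      using pos by (intro mult_left_mono) auto
    ultimately show ?thesis unfolding c by (simp add: mult.assoc)
  qed
  have rem': "norm (child_sum b \<pi> F j c (\<lambda>y. R (?y c y))) \<le> 2 * (real b + 2) / real b ^ k * (X * Y * sqrt \<theta> * \<mu> t')"
    if c: "c < b" for c
  proof -
    have "norm (child_sum b \<pi> F j c (\<lambda>y. R (?y c y))) \<le> 2 * (real b + 2) * X * Y / real b ^ k *
        (min 1 (sqrt (D1 / real b ^ j)) * min 1 (D2 / real b ^ k))"
    proof -
      have *: "2 * Y / K * m2 * (B2 * X) * m1 = 2 * B2 * X * Y / K * (m1 * m2)" for K m1 m2 B2 :: real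
        by simp
      show ?thesis using rem[OF c] unfolding Bk_def by (simp only: *)
    qed
    also have "\<dots> \<le> 2 * (real b + 2) * X * Y / real b ^ k * (sqrt \<theta> * \<mu> t')"
      using X0 Y0 by (intro mult_left_mono[OF mins]) auto
    finally show ?thesis by (simp add: mult_ac)
  qed
  have n\<Gamma>: "norm \<Gamma> = norm (G 1 - G 0) / real b ^ k" by (simp add: \<Gamma>_def norm_divide norm_power)
  have "norm (\<Gamma> * (\<Sum>c<b. child_sum b \<pi> F j c (\<lambda>y. of_real (?y c y)))) \<le>
      norm \<Gamma> * (\<Sum>c<b. 2 * (real b + 2) * X * \<mu> t)"
    unfolding norm_mult using lin by (intro mult_left_mono sum_norm_le) (auto simp: t_def)
  moreover have "norm (\<Sum>c<b. child_sum b \<pi> F j c (\<lambda>y. R (?y c y))) \<le>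
     (\<Sum>c<b. 2 * (real b + 2) / real b ^ k * (X * Y * sqrt \<theta> * \<mu> t'))"
    using rem' by (intro sum_norm_le) auto
  ultimately have "norm (\<Sum>c<b. \<Sum>p<b ^ j. ?\<Lambda> c p * fold_average b G k (?y c (radinv b \<pi> j p))) \<le>
     norm \<Gamma> * (\<Sum>c<b. 2 * (real b + 2) * X * \<mu> t) + (\<Sum>c<b. 2 * (real b + 2) / real b ^ k * (X * Y * sqrt \<theta> * \<mu> t'))"
    unfolding eq by (rule norm_triangle_mono)
  also have "\<dots> = 2 * real b * (real b + 2) / real b ^ k * (norm (G 1 - G 0) * X * \<mu> t + X * Y * sqrt \<theta> * \<mu> t')"
    unfolding n\<Gamma> by (simp add: algebra_simps add_divide_distrib)
  finally have "norm (\<Sum>c<b. \<Sum>p<b ^ j. ?\<Lambda> c p * fold_average b G k (?y c (radinv b \<pi> j p))) / real b ^ Suc j \<le>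
     2 * real b * (real b + 2) / real b ^ k * (norm (G 1 - G 0) * X * \<mu> t + X * Y * sqrt \<theta> * \<mu> t') / real b ^ Suc j"
    by (rule divide_right_mono) simp
  also have "\<dots> = 2 * real b * (real b + 2) / real b ^ n * (norm (G 1 - G 0) * X * \<mu> t + X * Y * sqrt \<theta> * \<mu> t')"
    by (simp add: n_def power_add mult_ac)
  finally show ?thesis
    by (simp add: norm_divide norm_power norm_mult t_def t'_def \<theta>_def)
qed

section \<open>Quadrature over the symmetrized points\<close>

lemma integral_reflect01:
  fixes f :: "real \<Rightarrow> 'a::euclidean_space"
  assumes "continuous_on UNIV f"
  shows "integral {0..1} (\<lambda>y. f (1 - y)) = integral {0..1} f"
proof -
  have "(f has_integral integral {0..1} f) (cbox 0 1)"
    using assms by (auto intro!: integrable_integral integrable_continuous_real intro: continuous_on_subset)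
  from has_integral_affinity[OF this, of "-1" 1]
  have "((\<lambda>x. f (1 - x)) has_integral integral {0..1} f) ((\<lambda>x. 1 - x) ` cbox 0 1)"
    by simp
  moreover have "(\<lambda>x. 1 - x) ` cbox 0 1 = {0..1::real}"
    using image_affinity_atLeastAtMost[of "-1" "1::real" 0 1] by (simp add: algebra_simps)
  ultimately show ?thesis by (simp add: integral_unique)
qed

lemma C1_fun_reflect:
  assumes "C1_fun F F'"
  shows "C1_fun (\<lambda>t. F (1 - t)) (\<lambda>t. - F' (1 - t))"
  using C1_fun_affine[OF assms, of "-1" "-1"] by simp

lemma fold_average_0 [simp]: "fold_average b G 0 y = G y"
  by (simp add: fold_average_def)

text \<open>The first summand multiplies the factor of \<open>telescope_term_bound\<close>, the
  geometric sum with ratio \<open>sqrt b\<close> and the \<open>sqrt b\<close> contained in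
  \<open>sqrt (b * \<theta>)\<close>; \<open>b + 5\<close> absorbs the passage from cell means to
  point values and the one-dimensional error of \<open>G\<close>.\<close>

definition quadrature_const :: "nat \<Rightarrow> real" where
  "quadrature_const b = 2 * real b * (real b + 2) * (2 * sqrt (real b) / (sqrt (real b) - 1)) * sqrt (real b) + real b + 5"

lemma quadrature_const_pos:
  assumes "b \<ge> 2" shows "quadrature_const b > 0"
proof -
  have "sqrt (real b) > 1" using assms by simp
  then have "2 * real b * (real b + 2) * (2 * sqrt (real b) / (sqrt (real b) - 1)) * sqrt (real b) \<ge> 0"
    by (intro mult_nonneg_nonneg divide_nonneg_nonneg) auto
  then show ?thesis unfolding quadrature_const_def by linarith
qed

text \<open>Averaging over the reflected points replaces \<open>F\<close> by \<open>F x + F (1 - x)\<close>, which takes equal values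
  at \<open>0\<close> and \<open>1\<close>, so that \<open>telescope_term_bound\<close> applies.\<close>

lemma quadrature_bound:
  fixes X Y D1 D2 :: real
  assumes b: "b \<ge> 2" and \<pi>: "\<And>j. bij_betw (\<pi> j) {..<b} {..<b}"
    and F: "C1_fun F F'" and F': "C1_fun F' F''" and G: "C1_fun G G'" and G': "C1_fun G' G''"
    and FI: "integral {0..1} (\<lambda>y. norm (F y)) \<le> X / D1"
    and FV: "integral {0..1} (\<lambda>y. norm (F' y)) \<le> X"
    and FW: "integral {0..1} (\<lambda>y. norm (F'' y)) \<le> D1 * X"
    and GV: "integral {0..1} (\<lambda>y. norm (G' y)) \<le> Y"
    and GW: "integral {0..1} (\<lambda>y. norm (G'' y)) \<le> D2 * Y"
    and GS: "\<And>y. y \<in> {0..1} \<Longrightarrow> norm (G y) \<le> Y"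
    and D: "1 \<le> D1" "1 \<le> D2" "D1 * D2 \<le> real b ^ n"
  shows "norm (((\<Sum>u<b ^ n. F (real u / real b ^ n) * G (radinv b \<pi> n u)) +
             (\<Sum>u<b ^ n. F (1 - (real u + 1) / real b ^ n) * G (radinv b \<pi> n u))) / of_real (2 * real b ^ n)
            - integral {0..1} F * integral {0..1} G)
      \<le> quadrature_const b / real b ^ n * (X * Y * sqrt (D1 * D2 / real b ^ n) + X * norm (G 1 - G 0) + norm (F 1 - F 0) * Y)"
proof -
  define K0 where "K0 = 2 * sqrt (real b) / (sqrt (real b) - 1)"
  define K where "K = 2 * real b * (real b + 2) * K0"
  have qc: "quadrature_const b = K * sqrt (real b) + real b + 5"
    by (simp add: quadrature_const_def K_def K0_def)
  have sb: "sqrt (real b) > 1" using b by simp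
  have K0: "K0 > 0" using sb by (simp add: K0_def)
  have K: "K > 0" using K0 b by (simp add: K_def)
  have mu_sum: "(\<Sum>j<n. min (sqrt (real b ^ j / D)) (1 / sqrt (real b ^ j / D))) \<le> K0" if "D > 0" for n D
  proof -
    have "sqrt (real b ^ j / D) = (1 / sqrt D) * sqrt (real b) ^ j" for j
      by (simp add: real_sqrt_divide real_sqrt_power)
    then show ?thesis
      using sum_min_geometric[of "1 / sqrt D" "sqrt (real b)" n] that sb by (simp add: K0_def)
  qed
  have b0: "b > 0" using b by simp
  let ?N = "real b ^ n"
  have N: "?N > 0" using b by simp
  have X0: "X \<ge> 0"
    by (rule order_trans[OF integral_nonneg FV]) (auto intro: integrable_continuous_real C1_funD[OF F])
  have Y0: "Y \<ge> 0" using order_trans[OF norm_ge_zero GS[of 0]] by simp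
  define eF eG where "eF = norm (F 1 - F 0)" and "eG = norm (G 1 - G 0)"
  define \<theta> where "\<theta> = D1 * D2 / ?N"
  have \<theta>: "\<theta> > 0" "\<theta> \<le> 1" "D1 / ?N \<le> \<theta>" "D2 / ?N \<le> \<theta>"
    using D N by (auto simp: \<theta>_def divide_right_mono mult_le_cancel_left1 mult_le_cancel_right1)
  have \<theta>s: "\<theta> \<le> sqrt \<theta>"
    using \<theta> mult_left_mono[of "sqrt \<theta>" 1 "sqrt \<theta>"] by simp
  define Fr where "Fr = (\<lambda>t. F (1 - t))"
  define Fs where "Fs = (\<lambda>t. F t + Fr t)"
  note refl = C1_fun_reflect[OF F] C1_fun_cmult[OF C1_fun_reflect[OF F'], of "-1", simplified]
  have Fs: "C1_fun Fs (\<lambda>t. F' t + - F' (1 - t))" "C1_fun (\<lambda>t. F' t + - F' (1 - t)) (\<lambda>t. F'' t + F'' (1 - t))"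
    unfolding Fs_def Fr_def using C1_fun_add[OF F refl(1)] C1_fun_add[OF F' refl(2)] by simp_all
  have refl_int: "integral {0..1} (\<lambda>y. norm (f (1 - y))) = integral {0..1} (\<lambda>y. norm (f y))"
    "integral {0..1} (\<lambda>y. norm (- f (1 - y))) = integral {0..1} (\<lambda>y. norm (f y))"
    if "continuous_on UNIV f" for f :: "real \<Rightarrow> complex"
    using that by (auto intro!: integral_reflect01[of "\<lambda>y. norm (f y)"] continuous_intros)
  have dbl: "integral {0..1} (\<lambda>y. norm (f y + g y)) \<le> I + J"
    if "continuous_on UNIV f" "continuous_on UNIV g" "integral {0..1} (\<lambda>y. norm (f y)) \<le> I"
      "integral {0..1} (\<lambda>y. norm (g y)) \<le> J" for f g :: "real \<Rightarrow> complex" and I J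
  proof -
    have i: "(\<lambda>y. norm (f y)) integrable_on {0..1}" "(\<lambda>y. norm (g y)) integrable_on {0..1}"
      "(\<lambda>y. norm (f y + g y)) integrable_on {0..1}"
      using that by (auto intro!: integrable_continuous_real continuous_intros intro: continuous_on_subset)
    have "integral {0..1} (\<lambda>y. norm (f y + g y)) \<le> integral {0..1} (\<lambda>y. norm (f y) + norm (g y))"
      by (intro Henstock_Kurzweil_Integration.integral_le i integrable_add norm_triangle_ineq)
    also have "\<dots> = integral {0..1} (\<lambda>y. norm (f y)) + integral {0..1} (\<lambda>y. norm (g y))"
      by (intro Henstock_Kurzweil_Integration.integral_add i)
    finally show ?thesis using that by linarith
  qed
  note cF = C1_funD(2,3)[OF F] C1_funD(3)[OF F']
  have cr: "continuous_on UNIV (\<lambda>t. F (1 - t))" "continuous_on UNIV (\<lambda>t. - F' (1 - t))"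
    "continuous_on UNIV (\<lambda>t. F'' (1 - t))"
    using C1_funD[OF refl(1)] C1_funD[OF refl(2)] by auto
  have FsI: "integral {0..1} (\<lambda>y. norm (Fs y)) \<le> (2 * X) / D1"
    unfolding Fs_def Fr_def using dbl[OF cF(1) cr(1) FI, of "X / D1"] FI refl_int[OF cF(1)] by simp
  have FsV: "integral {0..1} (\<lambda>y. norm (F' y + - F' (1 - y))) \<le> 2 * X"
    using dbl[OF cF(2) cr(2) FV, of X] FV refl_int[OF cF(2)] by simp
  have FsW: "integral {0..1} (\<lambda>y. norm (F'' y + F'' (1 - y))) \<le> D1 * (2 * X)"
    using dbl[OF cF(3) cr(3) FW, of "D1 * X"] FW refl_int[OF cF(3)] by simp
  have Fse: "Fs 1 = Fs 0" by (simp add: Fs_def Fr_def)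
  \<comment> \<open>\<open>S 0\<close> is the integral of \<open>Fs\<close> times a grid mean of
    \<open>G\<close>; \<open>S n\<close> pairs the cell means of \<open>Fs\<close> with the values
    of \<open>G\<close> at the points.\<close>
  define S where "S j = (\<Sum>u<b ^ j. cell_average b Fs j u * fold_average b G (n - j) (radinv b \<pi> j u)) / of_nat b ^ j" for j
  define \<mu> where "\<mu> = (\<lambda>t::real. min (sqrt t) (1 / sqrt t))"
  define L where "L = 2 * real b * (real b + 2) / ?N"
  have step: "norm (S (Suc j) - S j) \<le> L * (eG * (2 * X) * \<mu> (real b ^ j / D1) +
      2 * X * Y * sqrt (real b * \<theta>) * \<mu> (real b ^ (n - Suc j) / D2))" if j: "j < n" for j
  proof -
    obtain k where k: "n = Suc (j + k)" using less_imp_Suc_add[OF j] by blast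
    have nk: "n - j = Suc k" "n - Suc j = k" using k by auto
    have "S (Suc j) - S j = (\<Sum>c<b. \<Sum>p<b ^ j. child_osc b c (\<lambda>t. Fs ((real p + t) / real b ^ j)) *
       fold_average b G k ((real (\<pi> j c) + radinv b \<pi> j p) / real b)) / of_nat b ^ Suc j"
      unfolding S_def nk by (rule telescope_step[OF b0 \<pi>])
    then show ?thesis
      using telescope_term_bound[OF Fs G G' b \<pi> FsI FsV FsW GV GW D(1,2) Fse, of j k]
      by (simp only: k[symmetric] nk L_def \<mu>_def \<theta>_def eG_def)
  qed
  have "norm (S n - S 0) \<le> (\<Sum>j<n. norm (S (Suc j) - S j))"
    unfolding sum_lessThan_telescope[symmetric] by (rule norm_sum)
  also have "\<dots> \<le> (\<Sum>j<n. L * (eG * (2 * X) * \<mu> (real b ^ j / D1) +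
      2 * X * Y * sqrt (real b * \<theta>) * \<mu> (real b ^ (n - Suc j) / D2)))"
    by (rule sum_mono) (use step in auto)
  also have "\<dots> = L * (eG * (2 * X) * (\<Sum>j<n. \<mu> (real b ^ j / D1)) +
      2 * X * Y * sqrt (real b * \<theta>) * (\<Sum>j<n. \<mu> (real b ^ (n - Suc j) / D2)))"
    by (simp only: sum_distrib_left[symmetric] sum.distrib)
  also have "(\<Sum>j<n. \<mu> (real b ^ (n - Suc j) / D2)) = (\<Sum>j<n. \<mu> (real b ^ j / D2))"
    by (rule sum.nat_diff_reindex)
  also have "L * (eG * (2 * X) * (\<Sum>j<n. \<mu> (real b ^ j / D1)) +
      2 * X * Y * sqrt (real b * \<theta>) * (\<Sum>j<n. \<mu> (real b ^ j / D2))) \<le>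
     L * (eG * (2 * X) * K0 + 2 * X * Y * sqrt (real b * \<theta>) * K0)"
    unfolding \<mu>_def using X0 Y0 D N \<theta> b
    by (intro mult_left_mono add_mono mu_sum) (auto simp: L_def eG_def)
  also have "\<dots> = 2 * (K / ?N * (X * eG + X * Y * sqrt \<theta> * sqrt (real b)))"
    by (simp add: L_def K_def real_sqrt_mult algebra_simps add_divide_distrib)
  finally have "norm (S n - S 0) \<le> 2 * (K / ?N * (X * eG + X * Y * sqrt \<theta> * sqrt (real b)))" .
  then have SS': "norm (S n - S 0) / 2 \<le> K / ?N * (X * eG + X * Y * sqrt \<theta> * sqrt (real b))"
    by linarith
  have intFs: "integral {0..1} Fs = 2 * integral {0..1} F"
  proof -
    have "integral {0..1} Fs = integral {0..1} F + integral {0..1} Fr"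
      unfolding Fs_def Fr_def
      by (intro Henstock_Kurzweil_Integration.integral_add integrable_continuous_real
          continuous_on_subset[OF cF(1)] continuous_on_subset[OF cr(1)]) auto
    then show ?thesis unfolding Fr_def integral_reflect01[OF cF(1)] by simp
  qed
  have S0: "S 0 = 2 * integral {0..1} F * fold_average b G n 0"
    by (simp add: S_def cell_average_def intFs)
  have cell_add: "cell_average b Fs n u = cell_average b F n u + cell_average b Fr n u" for u
    unfolding cell_average_def Fs_def Fr_def
    by (intro Henstock_Kurzweil_Integration.integral_add integrable_continuous_real
        continuous_on_affine[OF cF(1)] continuous_on_affine[OF cr(1)])
  define E0 where "E0 = (\<Sum>u<b ^ n. (F ((real u + 0) / ?N) - integral {0..1} (\<lambda>t. F ((real u + t) / ?N))) * G (radinv b \<pi> n u))"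
  \<comment> \<open>The reflected node \<open>1 - (u + 1) / b ^ n\<close> corresponds to
    \<open>Fr\<close> at the right end of cell \<open>u\<close>, hence the offset \<open>1\<close>
    here against \<open>0\<close> in \<open>E0\<close>.\<close>
  define E1 where "E1 = (\<Sum>u<b ^ n. (Fr ((real u + 1) / ?N) - integral {0..1} (\<lambda>t. Fr ((real u + t) / ?N))) * G (radinv b \<pi> n u))"
  have DN: "D1 \<le> ?N"
  proof -
    have "D1 * 1 \<le> D1 * D2" using D by (intro mult_left_mono) auto
    then show ?thesis using D by linarith
  qed
  have D1s: "sqrt (D1 / ?N) \<le> sqrt \<theta>" using \<theta> by simp
  have mono: "Y * (eF + (real b + 2) * X * sqrt (D1 / ?N)) \<le> Y * (eF + (real b + 2) * X * sqrt \<theta>)"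
    using X0 Y0 by (intro mult_left_mono add_left_mono D1s) auto
  \<comment> \<open>Here \<open>F\<close> itself is sampled, with possibly unequal endpoint values;
    the difference is paid once and not at every level.\<close>
  have "norm E0 \<le> Y * (norm (F 1 - F 0) + (real b + 2) * X * sqrt (D1 / ?N))"
    unfolding E0_def
    by (rule weighted_average_bound_sqrt[OF osc_functional_point F F' G b \<pi> GS GV FV FW D(1) DN X0]) auto
  then have E0: "norm E0 \<le> Y * (eF + (real b + 2) * X * sqrt \<theta>)" using mono by (simp add: eF_def)
  have FrV: "integral {0..1} (\<lambda>y. norm (- F' (1 - y))) \<le> X"
    and FrW: "integral {0..1} (\<lambda>y. norm (F'' (1 - y))) \<le> D1 * X"
    using FV FW refl_int[OF cF(2)] refl_int[OF cF(3)] by simp_all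
  have "norm E1 \<le> Y * (norm (Fr 1 - Fr 0) + (real b + 2) * X * sqrt (D1 / ?N))"
    unfolding E1_def Fr_def
    by (rule weighted_average_bound_sqrt[OF osc_functional_point refl G b \<pi> GS GV FrV FrW D(1) DN X0]) auto
  then have E1: "norm E1 \<le> Y * (eF + (real b + 2) * X * sqrt \<theta>)"
    using mono by (simp add: eF_def Fr_def norm_minus_commute)
  let ?A = "(\<Sum>u<b ^ n. F (real u / ?N) * G (radinv b \<pi> n u)) +
           (\<Sum>u<b ^ n. F (1 - (real u + 1) / ?N) * G (radinv b \<pi> n u))"
  have Sn: "of_nat b ^ n * S n = (\<Sum>u<b ^ n. cell_average b Fs n u * G (radinv b \<pi> n u))"
    using b0 by (simp add: S_def)
  have A: "?A = of_nat b ^ n * S n + E0 + E1"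
    unfolding Sn E0_def E1_def cell_add unfolding Fr_def cell_average_def
    by (simp add: sum.distrib[symmetric] algebra_simps)
  \<comment> \<open>The grid starts at \<open>y = 0\<close>, where the linear term of the expansion
    is minus half the jump of \<open>G\<close> divided by \<open>b ^ n\<close>.\<close>
  define \<delta> where "\<delta> = fold_average b G n 0 - integral {0..1} G"
  have \<delta>: "norm \<delta> \<le> 2 * Y * \<theta> / ?N + eG / (2 * ?N)"
  proof -
    have "\<delta> = fold_remainder b G n 0 - of_real (1 / (2 * ?N)) * (G 1 - G 0)"
      by (simp add: \<delta>_def fold_remainder_def)
    then have "norm \<delta> \<le> norm (fold_remainder b G n 0) + norm (of_real (1 / (2 * ?N)) * (G 1 - G 0))"
      by (simp only: norm_triangle_ineq4)
    moreover have "norm (of_real (1 / (2 * ?N)) * (G 1 - G 0)) = eG / (2 * ?N)"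
      by (simp only: norm_mult norm_of_real) (simp add: eG_def)
    moreover have "norm (fold_remainder b G n 0) \<le> 2 * Y / ?N * min 1 (D2 / ?N)"
      by (rule fold_remainder_bounds(3)[OF b0 G G' GV GW]) simp
    moreover have "2 * Y / ?N * min 1 (D2 / ?N) \<le> 2 * Y / ?N * \<theta>"
      using Y0 N \<theta> by (intro mult_left_mono) auto
    ultimately show ?thesis by simp
  qed
  have IF: "norm (integral {0..1} F) \<le> X"
  proof -
    have "norm (integral {0..1} F) \<le> integral {0..1} (\<lambda>y. norm (F y))"
      by (intro integral_norm_bound_integral integrable_continuous_real C1_funD[OF F]) auto
    also have "\<dots> \<le> X / D1" by (rule FI)
    also have "\<dots> \<le> X" using D X0 by (simp add: divide_le_eq mult_le_cancel_left1)
    finally show ?thesis .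
  qed
  have "?A / of_real (2 * ?N) - integral {0..1} F * integral {0..1} G =
     (S n - S 0) / 2 + integral {0..1} F * \<delta> + (E0 + E1) / of_real (2 * ?N)"
    unfolding A S0 \<delta>_def using N b0 by (simp add: field_simps)
  also have "norm \<dots> \<le> norm (S n - S 0) / 2 + norm (integral {0..1} F) * norm \<delta> + (norm E0 + norm E1) / (2 * ?N)"
  proof (intro norm_triangle_mono)
    have "norm ((E0 + E1) / of_real (2 * ?N)) = norm (E0 + E1) / (2 * ?N)"
      by (simp only: norm_divide norm_of_real) simp
    also have "\<dots> \<le> (norm E0 + norm E1) / (2 * ?N)"
      using N by (intro divide_right_mono norm_triangle_ineq) auto
    finally show "norm ((E0 + E1) / of_real (2 * ?N)) \<le> (norm E0 + norm E1) / (2 * ?N)" .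
  qed (simp_all add: norm_mult norm_divide)
  also have "\<dots> \<le> K / ?N * (X * eG + X * Y * sqrt \<theta> * sqrt (real b)) + X * (2 * Y * \<theta> / ?N + eG / (2 * ?N))
     + (Y * (eF + (real b + 2) * X * sqrt \<theta>) + Y * (eF + (real b + 2) * X * sqrt \<theta>)) / (2 * ?N)"
    using SS' E0 E1 N X0 by (intro add_mono mult_mono[OF IF \<delta>] divide_right_mono) auto
  also have "\<dots> = (K * (X * eG) + K * sqrt (real b) * (X * Y * sqrt \<theta>) + 2 * (X * Y * \<theta>) + X * eG / 2
      + Y * eF + (real b + 2) * (X * Y * sqrt \<theta>)) / ?N"
    using N by (simp add: field_simps)
  also have "\<dots> \<le> (K * sqrt (real b) + real b + 5) * (X * Y * sqrt \<theta> + X * eG + eF * Y) / ?N"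
  proof (rule divide_right_mono)
    have p: "X * eG \<ge> 0" "X * Y * sqrt \<theta> \<ge> 0" "Y * eF \<ge> 0" "X * Y * \<theta> \<le> X * Y * sqrt \<theta>"
      using X0 Y0 \<theta> \<theta>s by (auto simp: eG_def eF_def intro!: mult_left_mono)
    have kb: "K * 1 \<le> K * sqrt (real b)" using K sb by (intro mult_left_mono) auto
    have "K * (X * eG) \<le> K * sqrt (real b) * (X * eG)" using p kb by (intro mult_right_mono) auto
    moreover have "0 \<le> K * sqrt (real b) * (Y * eF)" "0 \<le> real b * (Y * eF)" "0 \<le> real b * (X * eG)"
      using K p by auto
    ultimately show "K * (X * eG) + K * sqrt (real b) * (X * Y * sqrt \<theta>) + 2 * (X * Y * \<theta>) + X * eG / 2
      + Y * eF + (real b + 2) * (X * Y * sqrt \<theta>) \<le> (K * sqrt (real b) + real b + 5) * (X * Y * sqrt \<theta> + X * eG + eF * Y)"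
      using p by (simp add: algebra_simps)
  qed (use N in simp)
  finally show ?thesis by (simp add: qc \<theta>_def eF_def eG_def)
qed

section \<open>The dyadic kernels\<close>

text \<open>Common majorant of the kernels and their antiderivatives: integrable, with the
  elementary primitive \<open>arctan\<close>, and stable up to constants under bounded
  shifts.\<close>

definition peak :: "real \<Rightarrow> real" where
  "peak t = 1 / (1 + t\<^sup>2)"

lemma peak_bounds: "0 < peak t" "peak t \<le> 1"
proof -
  have "1 + t\<^sup>2 > 0" using zero_le_power2[of t] by linarith
  then show "0 < peak t" "peak t \<le> 1" by (simp_all add: peak_def)
qed

text \<open>\<open>[-2, 2]\<close> contains the support of the profiles in its interior, so boundary
  terms vanish, and differentiation under the integral takes place over a compact interval.\<close>

definition trunc_fourier :: "(real \<Rightarrow> complex) \<Rightarrow> real \<Rightarrow> complex" where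
  "trunc_fourier m z = integral {-2..2} (\<lambda>\<xi>. cis (z * \<xi>) * m \<xi>)"

lemma cis_vector_derivative:
  "((\<lambda>z. cis (z * \<xi>)) has_vector_derivative (\<i> * of_real \<xi> * cis (z * \<xi>))) (at z within A)"
proof -
  have "((\<lambda>z. cis (z * \<xi>)) has_derivative (\<lambda>h. of_real (h * \<xi>) * (\<i> * cis (z * \<xi>)))) (at z within A)"
    by (auto intro!: derivative_eq_intros simp: scaleR_conv_of_real)
  then show ?thesis
    by (simp add: has_vector_derivative_def scaleR_conv_of_real mult_ac)
qed

lemma continuous_on_cis_mult: "continuous_on A (\<lambda>\<xi>. cis (z * \<xi>))"
  by (intro continuous_intros)

lemma trunc_fourier_C1:
  assumes m: "continuous_on UNIV m"
  shows "C1_fun (trunc_fourier m) (trunc_fourier (\<lambda>\<xi>. \<i> * of_real \<xi> * m \<xi>))"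
proof -
  have D: "(trunc_fourier m has_vector_derivative trunc_fourier (\<lambda>\<xi>. \<i> * of_real \<xi> * m \<xi>) z) (at z)"
    if mc: "continuous_on UNIV m" for m z
  proof -
    have "((\<lambda>z. integral (cbox (-2) 2) (\<lambda>\<xi>. cis (z * \<xi>) * m \<xi>)) has_vector_derivative
        integral (cbox (-2) 2) (\<lambda>\<xi>. \<i> * of_real \<xi> * cis (z * \<xi>) * m \<xi>)) (at z within UNIV)"
    proof (rule leibniz_rule_vector_derivative)
      show "((\<lambda>x. cis (x * t) * m t) has_vector_derivative \<i> * of_real t * cis (x * t) * m t) (at x within UNIV)" for x t
        by (intro has_vector_derivative_mult_left cis_vector_derivative)
      show "(\<lambda>\<xi>. cis (x * \<xi>) * m \<xi>) integrable_on cbox (-2) 2" for x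
        by (intro integrable_continuous continuous_on_mult continuous_on_cis_mult
            continuous_on_subset[OF mc subset_UNIV])
      show "continuous_on (UNIV \<times> cbox (-2) 2) (\<lambda>(x, t). \<i> * of_real t * cis (x * t) * m t)"
        unfolding case_prod_beta
        by (intro continuous_intros continuous_on_compose2[OF mc continuous_on_snd[OF continuous_on_id]]) simp
    qed auto
    then show ?thesis by (simp add: trunc_fourier_def[abs_def] mult_ac)
  qed
  have "continuous_on UNIV (\<lambda>\<xi>. \<i> * of_real \<xi> * m \<xi>)" by (intro continuous_intros m)
  then have "continuous_on UNIV (trunc_fourier (\<lambda>\<xi>. \<i> * of_real \<xi> * m \<xi>))"
    by (intro C1_continuous[OF D])
  then show ?thesis using D[OF m] by (auto simp: C1_fun_def)
qed

lemma C1_fun_zero_on_open: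
  assumes F: "C1_fun F F'" and S: "open S" "\<And>t. t \<in> S \<Longrightarrow> F t = 0" and t: "t \<in> S"
  shows "F' t = 0"
proof -
  have "((\<lambda>_. 0) has_vector_derivative F' t) (at t)"
    using has_vector_derivative_transform_within_open[OF C1_funD(1)[OF F] S(1) t, of "\<lambda>_. 0"] S(2) by auto
  then show ?thesis
    using vector_derivative_unique_at[of "\<lambda>_. 0" "F' t" t 0] by auto
qed

lemma trunc_fourier_decay:
  assumes m: "C1_fun m m'" "C1_fun m' m''" and supp: "\<And>t. \<bar>t\<bar> > 3 / 2 \<Longrightarrow> m t = 0"
  shows "norm (trunc_fourier m z) \<le>
    (integral {-2..2} (\<lambda>x. norm (m x)) + integral {-2..2} (\<lambda>x. norm (m'' x))) * peak z"
proof -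
  have 0: "m t = 0" "m' t = 0" if "\<bar>t\<bar> > 3 / 2" for t
  proof -
    show "m t = 0" by (rule supp[OF that])
    have "open {t::real. \<bar>t\<bar> > 3 / 2}" by (intro open_Collect_less continuous_intros)
    then show "m' t = 0" by (rule C1_fun_zero_on_open[OF m(1)]) (use supp that in auto)
  qed
  \<comment> \<open>Two integrations by parts at once:
    \<open>cis (z * \<xi>) * (m' \<xi> - \<i> * z * m \<xi>)\<close> is a primitive of the integrand
    and vanishes at both ends by the support condition.\<close>
  have "((\<lambda>\<xi>. cis (z * \<xi>) * (m'' \<xi> + of_real (z\<^sup>2) * m \<xi>)) has_integral
     cis (z * 2) * (m' 2 - \<i> * of_real z * m 2) - cis (z * (-2)) * (m' (-2) - \<i> * of_real z * m (-2))) {-2..2}"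
  proof (rule fundamental_theorem_of_calculus)
    fix x :: real
    have c: "((\<lambda>\<xi>. cis (z * \<xi>)) has_vector_derivative (\<i> * of_real z * cis (z * x))) (at x within {-2..2})"
      using cis_vector_derivative[of z x "{-2..2}"] by (simp add: mult.commute)
    have "((\<lambda>\<xi>. m' \<xi> - \<i> * of_real z * m \<xi>) has_vector_derivative (m'' x - \<i> * of_real z * m' x)) (at x within {-2..2})"
      by (intro has_vector_derivative_diff has_vector_derivative_mult_right
          has_vector_derivative_at_within[OF C1_funD(1)[OF m(1)]] has_vector_derivative_at_within[OF C1_funD(1)[OF m(2)]])
    from has_vector_derivative_mult[OF c this]
    show "((\<lambda>\<xi>. cis (z * \<xi>) * (m' \<xi> - \<i> * of_real z * m \<xi>)) has_vector_derivative
        cis (z * x) * (m'' x + of_real (z\<^sup>2) * m x)) (at x within {-2..2})"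
      by (simp add: algebra_simps power2_eq_square)
  qed simp
  then have hi0: "((\<lambda>\<xi>. cis (z * \<xi>) * (m'' \<xi> + of_real (z\<^sup>2) * m \<xi>)) has_integral 0) {-2..2}"
    using 0[of 2] 0[of "-2"] by simp
  have int: "(\<lambda>\<xi>. cis (z * \<xi>) * f \<xi>) integrable_on {-2..2}" "(\<lambda>\<xi>. norm (f \<xi>)) integrable_on {-2..2}"
    if "continuous_on UNIV f" for f :: "real \<Rightarrow> complex"
    using that by (auto intro!: integrable_continuous_real continuous_intros intro: continuous_on_subset)
  have nb: "norm (integral {-2..2} (\<lambda>\<xi>. cis (z * \<xi>) * f \<xi>)) \<le> integral {-2..2} (\<lambda>x. norm (f x))"
    if "continuous_on UNIV f" for f :: "real \<Rightarrow> complex"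
    by (intro integral_norm_bound_integral int that) (simp add: norm_mult)
  have i1: "((\<lambda>\<xi>. cis (z * \<xi>) * m'' \<xi>) has_integral integral {-2..2} (\<lambda>\<xi>. cis (z * \<xi>) * m'' \<xi>)) {-2..2}"
    by (intro integrable_integral int C1_funD[OF m(2)])
  have "((\<lambda>\<xi>. cis (z * \<xi>) * m \<xi>) has_integral trunc_fourier m z) {-2..2}"
    unfolding trunc_fourier_def by (intro integrable_integral int C1_funD[OF m(1)])
  from has_integral_add[OF i1 has_integral_mult_right[OF this, of "of_real (z\<^sup>2)"]]
  have "((\<lambda>\<xi>. cis (z * \<xi>) * (m'' \<xi> + of_real (z\<^sup>2) * m \<xi>)) has_integral
      integral {-2..2} (\<lambda>\<xi>. cis (z * \<xi>) * m'' \<xi>) + of_real (z\<^sup>2) * trunc_fourier m z) {-2..2}"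
    by (simp only: distrib_left mult.left_commute)
  from has_integral_unique[OF this hi0]
  have "integral {-2..2} (\<lambda>\<xi>. cis (z * \<xi>) * m'' \<xi>) + of_real (z\<^sup>2) * trunc_fourier m z = 0" .
  then have "of_real (z\<^sup>2) * trunc_fourier m z = - integral {-2..2} (\<lambda>\<xi>. cis (z * \<xi>) * m'' \<xi>)"
    by (simp only: add_eq_0_iff)
  then have "norm (of_real (z\<^sup>2) * trunc_fourier m z) = norm (integral {-2..2} (\<lambda>\<xi>. cis (z * \<xi>) * m'' \<xi>))"
    by simp
  then have "z\<^sup>2 * norm (trunc_fourier m z) \<le> integral {-2..2} (\<lambda>x. norm (m'' x))"
    using nb[OF C1_funD(3)[OF m(2)]] by (simp add: norm_mult norm_power)
  moreover have "norm (trunc_fourier m z) \<le> integral {-2..2} (\<lambda>x. norm (m x))"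
    unfolding trunc_fourier_def by (rule nb) (rule C1_funD[OF m(1)])
  ultimately have "(1 + z\<^sup>2) * norm (trunc_fourier m z) \<le>
      integral {-2..2} (\<lambda>x. norm (m x)) + integral {-2..2} (\<lambda>x. norm (m'' x))"
    by (simp add: distrib_right)
  moreover have "1 + z\<^sup>2 > 0" using zero_le_power2[of z] by linarith
  ultimately show ?thesis by (simp add: peak_def field_simps)
qed

section \<open>Smoothness of multipliers and of their quotients by the frequency\<close>

lemma C1_fun_mult:
  assumes "C1_fun F F'" "C1_fun G G'"
  shows "C1_fun (\<lambda>t. F t * G t) (\<lambda>t. F t * G' t + F' t * G t)"
  unfolding C1_fun_def
  by (auto intro!: has_vector_derivative_mult C1_funD[OF assms(1)] C1_funD[OF assms(2)] continuous_intros)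

lemma C1_fun_i_id: "C1_fun (\<lambda>t. \<i> * of_real t) (\<lambda>_. \<i>)"
proof -
  have "(of_real has_vector_derivative (1::complex)) (at t)" for t :: real
    using has_vector_derivative_of_real[OF DERIV_ident[of "at t"]] by simp
  from has_vector_derivative_mult_right[OF this, of \<i>] show ?thesis
    by (simp add: C1_fun_def)
qed

lemma C1_fun_const: "C1_fun (\<lambda>_. c) (\<lambda>_. 0)"
  by (simp add: C1_fun_def)

definition C2_fun :: "(real \<Rightarrow> complex) \<Rightarrow> bool" where
  "C2_fun m \<longleftrightarrow> (\<exists>m' m''. C1_fun m m' \<and> C1_fun m' m'')"

lemma C2_fun_i_id_mult:
  assumes "C2_fun m"
  shows "C2_fun (\<lambda>t. \<i> * of_real t * m t)"
proof -
  from assms obtain m' m'' where m: "C1_fun m m'" "C1_fun m' m''" by (auto simp: C2_fun_def)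
  show ?thesis
    unfolding C2_fun_def
    using C1_fun_mult[OF C1_fun_i_id m(1)]
      C1_fun_add[OF C1_fun_mult[OF C1_fun_i_id m(2)] C1_fun_mult[OF C1_fun_const m(1), of \<i>]]
    by blast
qed

text \<open>Near zero the quotient vanishes identically, also at \<open>t = 0\<close>, where
  division by zero returns \<open>0\<close>; away from zero this is the quotient rule.\<close>

lemma C1_fun_divide_id:
  assumes f: "C1_fun f f'" and z: "\<And>t. \<bar>t\<bar> < \<delta> \<Longrightarrow> f t = 0" and \<delta>: "\<delta> > 0"
  shows "C1_fun (\<lambda>t. f t / of_real t) (\<lambda>t. f' t / of_real t - f t / of_real t / of_real t)"
proof -
  let ?S = "{t. \<bar>t\<bar> < \<delta>}"
  have S: "open ?S" by (intro open_Collect_less continuous_intros)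
  have z': "f' t = 0" if "\<bar>t\<bar> < \<delta>" for t
    by (rule C1_fun_zero_on_open[OF f S]) (use z that in auto)
  let ?d = "\<lambda>t. f' t / of_real t - f t / of_real t / of_real t"
  have "((\<lambda>t. f t / of_real t) has_vector_derivative ?d t) (at t) \<and> isCont ?d t" for t
  proof (cases "\<bar>t\<bar> < \<delta>")
    case True
    have "((\<lambda>_. 0) has_vector_derivative ?d t) (at t)" using z z' True by simp
    then have 1: "((\<lambda>t. f t / of_real t) has_vector_derivative ?d t) (at t)"
      by (rule has_vector_derivative_transform_within_open[OF _ S]) (use z True in auto)
    have "continuous_on ?S (\<lambda>_. 0::complex)" by simp
    then have "continuous_on ?S ?d" by (rule continuous_on_eq) (use z z' in auto)
    then have "isCont ?d t" using continuous_on_eq_continuous_at[OF S] True by blast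
    with 1 show ?thesis by blast
  next
    case False
    then have t: "t \<noteq> 0" using \<delta> by auto
    have inv: "((\<lambda>t. inverse (of_real t)) has_vector_derivative (- (inverse (of_real t) * inverse (of_real t)) :: complex)) (at t)"
    proof -
      have "((\<lambda>t::real. inverse t) has_real_derivative - (inverse t * inverse t)) (at t)"
        using t by (auto intro!: derivative_eq_intros simp: power2_eq_square)
      then have "((\<lambda>t. complex_of_real (inverse t)) has_vector_derivative complex_of_real (- (inverse t * inverse t))) (at t)"
        by (rule has_vector_derivative_of_real)
      then show ?thesis by simp
    qed
    have 1: "((\<lambda>t. f t / of_real t) has_vector_derivative ?d t) (at t)"
      using has_vector_derivative_mult[OF C1_funD(1)[OF f] inv] by (simp add: field_simps)
    have "isCont f t" "isCont f' t"
      using C1_funD(2,3)[OF f, of UNIV] by (simp_all add: continuous_on_eq_continuous_at)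
    then have "isCont ?d t" using t by (intro continuous_intros) auto
    with 1 show ?thesis by blast
  qed
  then show ?thesis by (auto simp: C1_fun_def continuous_on_eq_continuous_at)
qed

text \<open>Division by \<open>\<i> * t\<close> on the frequency side is antidifferentiation of the
  kernel; two derivatives of the quotient are what \<open>trunc_fourier_decay\<close> asks
  for.\<close>

lemma C2_fun_divide_id:
  assumes "C2_fun m" and z: "\<And>t. \<bar>t\<bar> < \<delta> \<Longrightarrow> m t = 0" and \<delta>: "\<delta> > 0"
  shows "C2_fun (\<lambda>t. m t / (\<i> * of_real t))"
proof -
  from assms obtain m' m'' where m: "C1_fun m m'" "C1_fun m' m''" by (auto simp: C2_fun_def)
  have S: "open {t::real. \<bar>t\<bar> < \<delta>}" by (intro open_Collect_less continuous_intros)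
  have z': "m' t = 0" if "\<bar>t\<bar> < \<delta>" for t
    by (rule C1_fun_zero_on_open[OF m(1) S]) (use z that in auto)
  note 1 = C1_fun_divide_id[OF m(1) z \<delta>] and 2 = C1_fun_divide_id[OF m(2) z' \<delta>]
  have 3: "C1_fun (\<lambda>t. m t / of_real t / of_real t) (\<lambda>t. (m' t / of_real t - m t / of_real t / of_real t) / of_real t - m t / of_real t / of_real t / of_real t)"
    by (rule C1_fun_divide_id[OF 1 _ \<delta>]) (use z in auto)
  have "C1_fun (\<lambda>t. (1 / \<i>) * (m t / of_real t)) (\<lambda>t. (1 / \<i>) * (m' t / of_real t + (-1) * (m t / of_real t / of_real t)))"
    using C1_fun_cmult[OF 1, of "1 / \<i>"] by simp
  moreover note C1_fun_cmult[OF C1_fun_add[OF 2 C1_fun_cmult[OF 3, of "-1"]], of "1 / \<i>"]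
  ultimately have "C2_fun (\<lambda>t. (1 / \<i>) * (m t / of_real t))" unfolding C2_fun_def by blast
  moreover have "(1 / \<i>) * (m t / of_real t) = m t / (\<i> * of_real t)" for t
    by (simp only: times_divide_times_eq mult_1)
  ultimately show ?thesis by simp
qed

lemma schwartz_C2_fun:
  fixes f :: "real \<Rightarrow> complex"
  assumes "f \<in> schwartz"
  shows "C2_fun f"
proof -
  have d: "iterated_partial vs f differentiable (at x)" if "set vs \<subseteq> Basis" for vs x
    using assms that by (auto simp: schwartz_def smooth_def)
  have D: "(iterated_partial vs f has_vector_derivative iterated_partial (1 # vs) f x) (at x)"
    if "set vs \<subseteq> Basis" for vs x
  proof -
    have hd: "(iterated_partial vs f has_derivative frechet_derivative (iterated_partial vs f) (at x)) (at x)"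
      using d[OF that] frechet_derivative_works by blast
    have eq: "(\<lambda>h::real. h *\<^sub>R frechet_derivative (iterated_partial vs f) (at x) 1) =
        frechet_derivative (iterated_partial vs f) (at x)"
    proof
      fix h :: real
      show "h *\<^sub>R frechet_derivative (iterated_partial vs f) (at x) 1 = frechet_derivative (iterated_partial vs f) (at x) h"
        using linear_scale[OF has_derivative_linear[OF hd], of h 1] by simp
    qed
    show ?thesis unfolding has_vector_derivative_def iterated_partial.simps eq by (rule hd)
  qed
  have C: "C1_fun (iterated_partial vs f) (iterated_partial (1 # vs) f)" if "set vs \<subseteq> Basis" for vs
    unfolding C1_fun_def using D[OF that] C1_continuous[OF D[of "1 # vs"]] that by auto
  show ?thesis unfolding C2_fun_def using C[of "[]"] C[of "[1]"] by auto
qed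

lemma C2_fun_trunc_fourier_decay:
  assumes "C2_fun m" and "\<And>t. \<bar>t\<bar> > 3 / 2 \<Longrightarrow> m t = 0"
  obtains C where "C > 0" "\<And>z. norm (trunc_fourier m z) \<le> C * peak z"
proof -
  from assms obtain m' m'' where m: "C1_fun m m'" "C1_fun m' m''" by (auto simp: C2_fun_def)
  define C where "C = integral {-2..2} (\<lambda>x. norm (m x)) + integral {-2..2} (\<lambda>x. norm (m'' x))"
  have *: "norm (trunc_fourier m z) \<le> C * peak z" for z
    unfolding C_def by (rule trunc_fourier_decay[OF m assms(2)])
  have "C * peak z \<le> (\<bar>C\<bar> + 1) * peak z" for z
    by (rule mult_right_mono) (use peak_bounds(1)[of z] in linarith)+
  then have **: "norm (trunc_fourier m z) \<le> (\<bar>C\<bar> + 1) * peak z" for z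
    using order_trans[OF *] by blast
  have "\<bar>C\<bar> + 1 > 0" by linarith
  from that[OF this **] show thesis .
qed

text \<open>The factor is the product of the one-dimensional unitary constants of
  \<open>fourier\<close> and \<open>inverse_fourier\<close>, so that multiplication by the cutoff is
  convolution with exactly this function.\<close>

definition kernel :: "(real \<Rightarrow> complex) \<Rightarrow> nat \<Rightarrow> real \<Rightarrow> complex" where
  "kernel \<phi>\<^sub>0 d z = of_real (1 / (2 * pi)) * (LINT \<xi>|lborel. cis (z * \<xi>) * dyadic_cutoff \<phi>\<^sub>0 d \<xi>)"

lemma lborel_integral_trunc_fourier:
  assumes m: "continuous_on UNIV m" and supp: "\<And>t. \<bar>t\<bar> > 3 / 2 \<Longrightarrow> m t = 0"
  shows "(LINT \<xi>|lborel. cis (z * \<xi>) * m \<xi>) = trunc_fourier m z"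
    and "integrable lborel (\<lambda>\<xi>. cis (z * \<xi>) * m \<xi>)"
proof -
  let ?f = "\<lambda>\<xi>. cis (z * \<xi>) * m \<xi>"
  have si: "set_integrable lborel {-2..2} ?f"
    by (intro borel_integrable_atLeastAtMost' continuous_on_mult continuous_on_cis_mult
        continuous_on_subset[OF m subset_UNIV])
  have eq: "?f \<xi> = indicator {-2..2} \<xi> *\<^sub>R ?f \<xi>" for \<xi>
    using supp[of \<xi>] by (auto simp: indicator_def)
  show "integrable lborel ?f"
    using si unfolding set_integrable_def by (subst eq)
  have "(LINT \<xi>|lborel. ?f \<xi>) = (LINT \<xi>:{-2..2}|lborel. ?f \<xi>)"
    unfolding set_lebesgue_integral_def by (subst eq) (rule refl)
  also have "\<dots> = trunc_fourier m z"
    unfolding trunc_fourier_def by (rule set_borel_integral_eq_integral(2)[OF si])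
  finally show "(LINT \<xi>|lborel. ?f \<xi>) = trunc_fourier m z" .
qed

lemma C2_funD: "C2_fun m \<Longrightarrow> continuous_on A m"
  by (auto simp: C2_fun_def dest: C1_funD)

lemma C2_fun_diff_scaled:
  assumes "C2_fun m"
  shows "C2_fun (\<lambda>t. m t - m (2 * t))"
proof -
  from assms obtain m' m'' where m: "C1_fun m m'" "C1_fun m' m''" by (auto simp: C2_fun_def)
  have 1: "C1_fun (\<lambda>t. m (2 * t)) (\<lambda>t. 2 * m' (2 * t))"
    using C1_fun_affine[OF m(1), of 0 "1/2"] by (simp add: scaleR_conv_of_real mult.commute)
  have 2: "C1_fun (\<lambda>t. m' (2 * t)) (\<lambda>t. 2 * m'' (2 * t))"
    using C1_fun_affine[OF m(2), of 0 "1/2"] by (simp add: scaleR_conv_of_real mult.commute)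
  show ?thesis
    unfolding C2_fun_def
    using C1_fun_add[OF m(1) C1_fun_cmult[OF 1, of "-1"]]
      C1_fun_add[OF m(2) C1_fun_cmult[OF C1_fun_cmult[OF 2, of 2], of "-1"]]
    by (auto simp: algebra_simps)
qed

lemma peak_shift:
  assumes "\<bar>s - t\<bar> \<le> 1"
  shows "peak s \<le> 3 * peak t"
proof -
  have "(t - s)\<^sup>2 \<le> 1" using assms by (simp add: abs_square_le_1 abs_minus_commute)
  moreover have "0 \<le> (2 * s - t)\<^sup>2" by simp
  moreover have "t\<^sup>2 + (2 * s - t)\<^sup>2 = 2 * s\<^sup>2 + 2 * (t - s)\<^sup>2" by (simp add: power2_eq_square algebra_simps)
  ultimately have "t\<^sup>2 \<le> 2 * s\<^sup>2 + 2" by linarith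
  then have "1 + t\<^sup>2 \<le> 3 * (1 + s\<^sup>2)"
    using zero_le_power2[of s] unfolding distrib_left by linarith
  moreover have "1 + t\<^sup>2 > 0" "1 + s\<^sup>2 > 0" using zero_le_power2[of t] zero_le_power2[of s] by linarith+
  ultimately show ?thesis by (simp add: peak_def field_simps)
qed

text \<open>For \<open>d > 0\<close> all three families are dilations of fixed Fourier integrals
  with profiles \<open>\<Phi> t / (\<i> * t)\<close>, \<open>\<Phi> t\<close> and
  \<open>\<i> * t * \<Phi> t\<close>, and each derivative costs \<open>2 ^ d\<close>. For
  \<open>d = 0\<close> the quotient would be singular; there \<open>H\<close> is an ordinary
  primitive vanishing at \<open>z = 1\<close>, which explains why its bound is restricted to the
  unit interval.\<close>

lemma kernel_family:
  assumes sch: "\<phi>\<^sub>0 \<in> schwartz"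
    and one: "\<And>t. \<bar>t\<bar> \<le> 1 \<Longrightarrow> \<phi>\<^sub>0 t = 1"
    and supp: "\<And>t. \<bar>t\<bar> > 3 / 2 \<Longrightarrow> \<phi>\<^sub>0 t = 0"
  obtains C H \<kappa>' where "C > 0"
    and "\<And>d x. C1_fun (H d x) (\<lambda>z. - kernel \<phi>\<^sub>0 d (x - z))"
    and "\<And>d x. C1_fun (\<lambda>z. - kernel \<phi>\<^sub>0 d (x - z)) (\<lambda>z. \<kappa>' d (x - z))"
    and "\<And>d x z. z \<in> {0..1} \<Longrightarrow> norm (H d x z) \<le> C * peak (2 ^ d * (x - z))"
    and "\<And>d w. norm (kernel \<phi>\<^sub>0 d w) \<le> C * 2 ^ d * peak (2 ^ d * w)"
    and "\<And>d w. norm (\<kappa>' d w) \<le> C * 4 ^ d * peak (2 ^ d * w)"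
proof -
  define \<Phi> where "\<Phi> = (\<lambda>t. \<phi>\<^sub>0 t - \<phi>\<^sub>0 (2 * t))"
  have C\<phi>: "C2_fun \<phi>\<^sub>0" by (rule schwartz_C2_fun[OF sch])
  have C\<Phi>: "C2_fun \<Phi>" unfolding \<Phi>_def by (rule C2_fun_diff_scaled[OF C\<phi>])
  have \<Phi>supp: "\<Phi> t = 0" if "\<bar>t\<bar> > 3 / 2" for t using that supp by (simp add: \<Phi>_def)
  have \<Phi>zero: "\<Phi> t = 0" if "\<bar>t\<bar> < 1 / 2" for t using that one by (simp add: \<Phi>_def)
  define m1 where "m1 = (\<lambda>t. \<Phi> t / (\<i> * of_real t))"
  have Cm1: "C2_fun m1" unfolding m1_def by (rule C2_fun_divide_id[OF C\<Phi>, where \<delta> = "1 / 2"]) (use \<Phi>zero in auto)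
  have im1: "\<i> * of_real t * m1 t = \<Phi> t" for t
    using \<Phi>zero[of t] by (cases "t = 0") (auto simp: m1_def)
  obtain C1 where C1: "C1 > 0" "\<And>z. norm (trunc_fourier m1 z) \<le> C1 * peak z"
    by (rule C2_fun_trunc_fourier_decay[OF Cm1]) (use \<Phi>supp in \<open>auto simp: m1_def\<close>)
  obtain C2 where C2: "C2 > 0" "\<And>z. norm (trunc_fourier \<Phi> z) \<le> C2 * peak z"
    by (rule C2_fun_trunc_fourier_decay[OF C\<Phi> \<Phi>supp]) auto
  obtain C3 where C3: "C3 > 0" "\<And>z. norm (trunc_fourier (\<lambda>t. \<i> * of_real t * \<Phi> t) z) \<le> C3 * peak z"
    by (rule C2_fun_trunc_fourier_decay[OF C2_fun_i_id_mult[OF C\<Phi>]]) (use \<Phi>supp in auto)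
  obtain C4 where C4: "C4 > 0" "\<And>z. norm (trunc_fourier \<phi>\<^sub>0 z) \<le> C4 * peak z"
    by (rule C2_fun_trunc_fourier_decay[OF C\<phi> supp]) auto
  obtain C5 where C5: "C5 > 0" "\<And>z. norm (trunc_fourier (\<lambda>t. \<i> * of_real t * \<phi>\<^sub>0 t) z) \<le> C5 * peak z"
    by (rule C2_fun_trunc_fourier_decay[OF C2_fun_i_id_mult[OF C\<phi>]]) (use supp in auto)
  have k0: "kernel \<phi>\<^sub>0 0 w = of_real (1 / (2 * pi)) * trunc_fourier \<phi>\<^sub>0 w" for w
    unfolding kernel_def dyadic_cutoff_def if_P[OF refl]
    by (subst lborel_integral_trunc_fourier(1)[OF C2_funD[OF C\<phi>] supp]) auto
  have kS: "kernel \<phi>\<^sub>0 d w = of_real (2 ^ d / (2 * pi)) * trunc_fourier \<Phi> (2 ^ d * w)" if d: "d \<noteq> 0" for d w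
  proof -
    have dc: "dyadic_cutoff \<phi>\<^sub>0 d (0 + 2 ^ d * \<xi>) = \<Phi> \<xi>" for \<xi>
    proof -
      have a: "2 powr (- real d) * (2 ^ d * \<xi>) = \<xi>"
        by (simp add: powr_minus powr_realpow)
      have b: "2 powr (- real d + 1) * (2 ^ d * \<xi>) = 2 * \<xi>"
        by (simp add: powr_add powr_diff powr_minus powr_realpow)
      show ?thesis using d by (simp only: dyadic_cutoff_def if_False add_0_left a b \<Phi>_def)
    qed
    have "(LINT \<xi>|lborel. cis (w * \<xi>) * dyadic_cutoff \<phi>\<^sub>0 d \<xi>) =
       \<bar>2 ^ d\<bar> *\<^sub>R (LINT \<xi>|lborel. cis (w * (0 + 2 ^ d * \<xi>)) * dyadic_cutoff \<phi>\<^sub>0 d (0 + 2 ^ d * \<xi>))"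
      by (rule lborel_integral_real_affine) simp
    also have "\<dots> = 2 ^ d *\<^sub>R (LINT \<xi>|lborel. cis (2 ^ d * w * \<xi>) * \<Phi> \<xi>)"
      unfolding dc by (simp add: mult_ac)
    also have "\<dots> = 2 ^ d *\<^sub>R trunc_fourier \<Phi> (2 ^ d * w)"
      by (subst lborel_integral_trunc_fourier(1)[OF C2_funD[OF C\<Phi>] \<Phi>supp]) auto
    finally show ?thesis by (simp add: kernel_def scaleR_conv_of_real)
  qed
  \<comment> \<open>The factor \<open>3\<close> is for \<open>H\<close> at \<open>d = 0\<close>,
    where \<open>peak_shift\<close> compares the majorant at \<open>x - t\<close> with that at
    \<open>x - z\<close>.\<close>
  define C where "C = 3 * (C1 + C2 + C3 + C4 + C5)"
  have Cb: "C1 \<le> C" "C2 \<le> C" "C3 \<le> C" "C4 \<le> C" "C5 \<le> C" "3 * C4 \<le> C" "C > 0"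
    using C1(1) C2(1) C3(1) C4(1) C5(1) by (auto simp: C_def)
  have pi1: "1 / (2 * pi) \<le> 1" "1 / (2 * pi) > 0" using pi_gt3 by (auto simp: divide_le_eq)
  have bnd: "norm (of_real (1 / (2 * pi)) * z) \<le> norm z" for z :: complex
    using mult_right_mono[OF pi1(1), of "norm z"] pi1 by (simp only: norm_mult norm_of_real) simp
  have p0: "peak t \<ge> 0" for t using peak_bounds[of t] by simp
  have aff: "C1_fun (\<lambda>z. F (2 ^ d * (x - z))) (\<lambda>z. - (2 ^ d * F' (2 ^ d * (x - z))))"
    if "C1_fun F F'" for F F' and x :: real and d :: nat
  proof -
    have "(- x + z) / (- (1 / 2 ^ d)) = 2 ^ d * (x - z)" for z :: real by (simp add: field_simps)
    then show ?thesis using C1_fun_affine[OF that, of "- x" "- (1 / 2 ^ d)"]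
      by (simp add: scaleR_conv_of_real)
  qed
  define \<kappa>' where "\<kappa>' d w = (if d = 0 then of_real (1 / (2 * pi)) * trunc_fourier (\<lambda>t. \<i> * of_real t * \<phi>\<^sub>0 t) w
    else of_real (4 ^ d / (2 * pi)) * trunc_fourier (\<lambda>t. \<i> * of_real t * \<Phi> t) (2 ^ d * w))" for d w
  have C\<kappa>: "C1_fun (\<lambda>z. - kernel \<phi>\<^sub>0 d (x - z)) (\<lambda>z. \<kappa>' d (x - z))" for d x
  proof (cases "d = 0")
    case True
    show ?thesis
      using C1_fun_cmult[OF aff[OF trunc_fourier_C1[OF C2_funD[OF C\<phi>]], of 0 x], of "- of_real (1 / (2 * pi))"]
      unfolding True k0 \<kappa>'_def by simp
  next
    case False
    have "(4::complex) ^ d = 2 ^ d * 2 ^ d" by (simp flip: power_mult_distrib)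
    then show ?thesis
      using C1_fun_cmult[OF aff[OF trunc_fourier_C1[OF C2_funD[OF C\<Phi>]], of d x], of "- of_real (2 ^ d / (2 * pi))"] False
      unfolding kS[OF False] \<kappa>'_def by (simp add: mult_ac)
  qed
  have "\<exists>K. \<forall>x. -\<infinity> < ereal x \<longrightarrow> ereal x < \<infinity> \<longrightarrow> (K has_vector_derivative kernel \<phi>\<^sub>0 0 x) (at x)"
  proof (rule einterval_antiderivative)
    have "continuous_on UNIV (trunc_fourier \<phi>\<^sub>0)"
      by (rule C1_funD[OF trunc_fourier_C1[OF C2_funD[OF C\<phi>]]])
    then show "isCont (kernel \<phi>\<^sub>0 0) x" for x
      unfolding k0[abs_def] by (intro continuous_intros) (auto simp: continuous_on_eq_continuous_at)
  qed simp
  then obtain K where K: "\<And>x. (K has_vector_derivative kernel \<phi>\<^sub>0 0 x) (at x)" by auto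
  have ck0: "continuous_on UNIV (kernel \<phi>\<^sub>0 0)"
    unfolding k0[abs_def] by (intro continuous_intros C1_funD[OF trunc_fourier_C1[OF C2_funD[OF C\<phi>]]])
  define H where "H d x z = (if d = 0 then K (x - z) - K (x - 1) else
     of_real (1 / (2 * pi)) * trunc_fourier m1 (2 ^ d * (x - z)))" for d x z
  have CH: "C1_fun (H d x) (\<lambda>z. - kernel \<phi>\<^sub>0 d (x - z))" for d x
  proof (cases "d = 0")
    case True
    have "C1_fun K (kernel \<phi>\<^sub>0 0)" using K ck0 by (simp add: C1_fun_def)
    from C1_fun_add[OF aff[OF this, of 0 x] C1_fun_const[of "- K (x - 1)"]]
    show ?thesis unfolding True H_def[abs_def] by simp
  next
    case False
    have "C1_fun (trunc_fourier m1) (trunc_fourier \<Phi>)"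
      using trunc_fourier_C1[OF C2_funD[OF Cm1]] by (simp add: im1)
    from C1_fun_cmult[OF aff[OF this, of d x], of "of_real (1 / (2 * pi))"]
    show ?thesis unfolding H_def[abs_def] kS[OF False] using False by simp
  qed
  have k_le: "norm (kernel \<phi>\<^sub>0 d w) \<le> C * 2 ^ d * peak (2 ^ d * w)" for d w
  proof (cases "d = 0")
    case True
    have "norm (kernel \<phi>\<^sub>0 d w) \<le> C4 * peak w" unfolding True k0 using bnd C4(2)[of w] order_trans by blast
    also have "\<dots> \<le> C * peak w" by (intro mult_right_mono Cb p0)
    finally show ?thesis by (simp add: True)
  next
    case False
    have "norm (kernel \<phi>\<^sub>0 d w) = norm (of_real (1 / (2 * pi)) * (2 ^ d * trunc_fourier \<Phi> (2 ^ d * w)))"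
      unfolding kS[OF False] by simp
    also have "\<dots> \<le> norm (2 ^ d * trunc_fourier \<Phi> (2 ^ d * w))" by (rule bnd)
    also have "\<dots> = 2 ^ d * norm (trunc_fourier \<Phi> (2 ^ d * w))" by (simp add: norm_mult norm_power)
    also have "\<dots> \<le> 2 ^ d * (C * peak (2 ^ d * w))"
      by (intro mult_left_mono order_trans[OF C2(2)] mult_right_mono Cb p0) simp
    finally show ?thesis by (simp add: mult_ac)
  qed
  have k'_le: "norm (\<kappa>' d w) \<le> C * 4 ^ d * peak (2 ^ d * w)" for d w
  proof (cases "d = 0")
    case True
    have "norm (\<kappa>' d w) \<le> C5 * peak w" unfolding True \<kappa>'_def if_P[OF refl] using bnd C5(2)[of w] order_trans by blast
    also have "\<dots> \<le> C * peak w" by (intro mult_right_mono Cb p0)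
    finally show ?thesis by (simp add: True)
  next
    case False
    let ?f = "trunc_fourier (\<lambda>t. \<i> * of_real t * \<Phi> t)"
    have "norm (\<kappa>' d w) = norm (of_real (1 / (2 * pi)) * (4 ^ d * ?f (2 ^ d * w)))"
      unfolding \<kappa>'_def using False by simp
    also have "\<dots> \<le> norm (4 ^ d * ?f (2 ^ d * w))" by (rule bnd)
    also have "\<dots> = 4 ^ d * norm (?f (2 ^ d * w))" by (simp add: norm_mult norm_power)
    also have "\<dots> \<le> 4 ^ d * (C * peak (2 ^ d * w))"
      by (intro mult_left_mono order_trans[OF C3(2)] mult_right_mono Cb p0) simp
    finally show ?thesis by (simp add: mult_ac)
  qed
  have H_le: "norm (H d x z) \<le> C * peak (2 ^ d * (x - z))" if z: "z \<in> {0..1}" for d x z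
  proof (cases "d = 0")
    case True
    \<comment> \<open>\<open>H 0 x 1 = 0\<close>, so the difference is the value itself; on an
      interval of length at most 1 the majorant changes by a factor of at most
      \<open>3\<close>.\<close>
    have "norm (H 0 x z - H 0 x 1) \<le> integral {z..1} (\<lambda>t. norm (- kernel \<phi>\<^sub>0 0 (x - t)))"
      using z by (intro C1_osc_le C1_funD[OF CH]) auto
    also have "\<dots> \<le> integral {z..1} (\<lambda>t. 3 * C4 * peak (x - z))"
    proof (rule Henstock_Kurzweil_Integration.integral_le)
      show "(\<lambda>t. norm (- kernel \<phi>\<^sub>0 0 (x - t))) integrable_on {z..1}"
        by (intro integrable_continuous_real C1_funD[OF CH])
      fix t assume "t \<in> {z..1}"
      then have "peak (x - t) \<le> 3 * peak (x - z)" using z by (intro peak_shift) auto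
      then have "C4 * peak (x - t) \<le> C4 * (3 * peak (x - z))" using C4(1) by (intro mult_left_mono) auto
      moreover have "norm (kernel \<phi>\<^sub>0 0 (x - t)) \<le> C4 * peak (x - t)"
        unfolding k0 using bnd C4(2)[of "x - t"] order_trans by blast
      ultimately show "norm (- kernel \<phi>\<^sub>0 0 (x - t)) \<le> 3 * C4 * peak (x - z)" by simp
    qed auto
    also have "\<dots> = (1 - z) * (3 * C4 * peak (x - z))" using z by simp
    also have "\<dots> \<le> 1 * (C * peak (x - z))"
      using z C4(1) Cb p0 by (intro mult_mono mult_right_mono) auto
    finally show ?thesis by (simp add: True H_def)
  next
    case False
    have "norm (H d x z) \<le> norm (trunc_fourier m1 (2 ^ d * (x - z)))"
      unfolding H_def using False bnd by simp
    also have "\<dots> \<le> C * peak (2 ^ d * (x - z))"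
      by (intro order_trans[OF C1(2)] mult_right_mono Cb p0)
    finally show ?thesis .
  qed
  show thesis by (rule that[OF Cb(7) CH C\<kappa> H_le k_le k'_le])
qed

section \<open>Frequency blocks as convolutions\<close>

text \<open>Carries the product measure on pairs to the measure on \<open>real ^ 2\<close>, so that
  Fubini can be applied coordinate by coordinate.\<close>

definition vec2 :: "real \<times> real \<Rightarrow> real ^ 2" where
  "vec2 z = fst z *\<^sub>R axis 1 1 + snd z *\<^sub>R axis 2 1"

lemma vec2_nth [simp]: "vec2 z $ 1 = fst z" "vec2 z $ 2 = snd z"
  by (simp_all add: vec2_def axis_def)

lemma measurable_vec2 [measurable]: "vec2 \<in> borel_measurable borel"
  unfolding vec2_def[abs_def] by (intro borel_measurable_continuous_onI continuous_intros)

lemma measurable_vec2_pair [measurable]: "vec2 \<in> lborel \<Otimes>\<^sub>M lborel \<rightarrow>\<^sub>M borel"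
  unfolding lborel_prod using measurable_vec2 by simp

lemma lborel_vec2: "(lborel :: (real ^ 2) measure) = distr (lborel \<Otimes>\<^sub>M lborel) borel vec2"
proof (rule lborel_eqI)
  fix l u :: "real ^ 2"
  assume le: "\<And>b. b \<in> Basis \<Longrightarrow> l \<bullet> b \<le> u \<bullet> b"
  have le': "l $ i \<le> u $ i" for i
    using le[of "axis i 1"] by (simp add: inner_axis axis_in_Basis_iff)
  have pre: "vec2 -` box l u = box (l $ 1, l $ 2) (u $ 1, u $ 2)"
    by (auto simp: mem_box_cart box_prod mem_box forall_2)
  have "emeasure (distr (lborel \<Otimes>\<^sub>M lborel) borel vec2) (box l u) =
      emeasure (lborel :: (real \<times> real) measure) (box (l $ 1, l $ 2) (u $ 1, u $ 2))"
    by (subst emeasure_distr) (auto simp: lborel_prod pre)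
  also have "\<dots> = ennreal (\<Prod>b\<in>Basis. ((u $ 1, u $ 2) - (l $ 1, l $ 2)) \<bullet> b)"
    using le' by (intro emeasure_lborel_box) (auto simp: Basis_prod_def)
  also have "(\<Prod>b\<in>Basis. ((u $ 1, u $ 2) - (l $ 1, l $ 2)) \<bullet> b) = (u $ 1 - l $ 1) * (u $ 2 - l $ 2)"
    by (simp add: Basis_prod_def prod.union_disjoint)
  also have "\<dots> = (\<Prod>b\<in>Basis. (u - l) \<bullet> b)"
  proof -
    have B: "(Basis :: (real ^ 2) set) = {axis 1 1, axis 2 1}"
      by (auto simp: Basis_vec_def UNIV_2)
    have "axis 1 1 \<noteq> (axis 2 1 :: real ^ 2)" by (simp add: axis_eq_axis)
    then show ?thesis unfolding B by (simp add: inner_axis)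
  qed
  finally show "emeasure (distr (lborel \<Otimes>\<^sub>M lborel) borel vec2) (box l u) = ennreal (\<Prod>b\<in>Basis. (u - l) \<bullet> b)" .
qed simp

lemma nn_integral_vec2:
  fixes f g :: "real \<Rightarrow> ennreal"
  assumes [measurable]: "f \<in> borel_measurable borel" "g \<in> borel_measurable borel"
  shows "(\<integral>\<^sup>+x. f (x $ 1) * g (x $ 2) \<partial>(lborel :: (real ^ 2) measure)) =
    (\<integral>\<^sup>+x. f x \<partial>lborel) * (\<integral>\<^sup>+x. g x \<partial>lborel)"
proof -
  have "(\<integral>\<^sup>+x. f (x $ 1) * g (x $ 2) \<partial>(lborel :: (real ^ 2) measure)) =
      (\<integral>\<^sup>+z. f (fst z) * g (snd z) \<partial>(lborel \<Otimes>\<^sub>M lborel))"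
    by (subst lborel_vec2, subst nn_integral_distr) simp_all
  also have "\<dots> = (\<integral>\<^sup>+x. \<integral>\<^sup>+y. f x * g y \<partial>lborel \<partial>lborel)"
    by (subst lborel.nn_integral_fst[symmetric]) simp_all
  also have "\<dots> = (\<integral>\<^sup>+x. f x \<partial>lborel) * (\<integral>\<^sup>+x. g x \<partial>lborel)"
    by (simp add: nn_integral_cmult nn_integral_multc)
  finally show ?thesis .
qed

lemma integrable_pair_mult:
  fixes f :: "'a::euclidean_space \<Rightarrow> complex" and g :: "'b::euclidean_space \<Rightarrow> complex"
  assumes f: "integrable lborel f" and g: "integrable lborel g"
  shows "integrable (lborel \<Otimes>\<^sub>M lborel) (\<lambda>z. f (fst z) * g (snd z))"
proof (rule lborel_pair.Fubini_integrable)
  have [measurable]: "f \<in> borel_measurable borel" "g \<in> borel_measurable borel"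
    using borel_measurable_integrable[OF f] borel_measurable_integrable[OF g] by simp_all
  show "(\<lambda>z. f (fst z) * g (snd z)) \<in> borel_measurable (lborel \<Otimes>\<^sub>M lborel)" by simp
  show "integrable lborel (\<lambda>x. LINT y|lborel. norm (f (fst (x, y)) * g (snd (x, y))))"
    using f by (simp add: norm_mult)
  show "AE x in lborel. integrable lborel (\<lambda>y. f (fst (x, y)) * g (snd (x, y)))"
    using g by simp
qed

lemma integrable_pair_mult_bounded:
  fixes f :: "'a::euclidean_space \<Rightarrow> complex" and g :: "'b::euclidean_space \<Rightarrow> complex"
  assumes f: "integrable lborel f" and g: "integrable lborel g"
    and m[measurable]: "m \<in> borel_measurable (borel \<Otimes>\<^sub>M borel)" and B: "\<And>z. norm (m z) \<le> B"
  shows "integrable (lborel \<Otimes>\<^sub>M lborel) (\<lambda>z. f (fst z) * g (snd z) * m z)"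
proof (rule Bochner_Integration.integrable_bound)
  have [measurable]: "f \<in> borel_measurable borel" "g \<in> borel_measurable borel"
    using borel_measurable_integrable[OF f] borel_measurable_integrable[OF g] by simp_all
  show "integrable (lborel \<Otimes>\<^sub>M lborel) (\<lambda>z. of_real B * (f (fst z) * g (snd z)))"
    by (intro integrable_mult_right integrable_pair_mult f g)
  show "(\<lambda>z. f (fst z) * g (snd z) * m z) \<in> borel_measurable (lborel \<Otimes>\<^sub>M lborel)" by simp
  have "0 \<le> B" using order_trans[OF norm_ge_zero B] .
  then show "AE z in lborel \<Otimes>\<^sub>M lborel. norm (f (fst z) * g (snd z) * m z) \<le> norm (of_real B * (f (fst z) * g (snd z)))"
    using B by (auto simp: norm_mult mult.commute[of B] intro!: AE_I2 mult_left_mono)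
qed

lemma integral_vec2:
  fixes f g :: "real \<Rightarrow> complex"
  assumes f: "integrable lborel f" and g: "integrable lborel g"
  shows "integrable (lborel :: (real ^ 2) measure) (\<lambda>x. f (x $ 1) * g (x $ 2))"
    and "(LINT x|(lborel :: (real ^ 2) measure). f (x $ 1) * g (x $ 2)) = (LINT x|lborel. f x) * (LINT x|lborel. g x)"
proof -
  have [measurable]: "f \<in> borel_measurable borel" "g \<in> borel_measurable borel"
    using borel_measurable_integrable[OF f] borel_measurable_integrable[OF g] by simp_all
  have i: "integrable (lborel \<Otimes>\<^sub>M lborel) (\<lambda>z. f (fst z) * g (snd z))"
    by (rule integrable_pair_mult[OF f g])
  show "integrable (lborel :: (real ^ 2) measure) (\<lambda>x. f (x $ 1) * g (x $ 2))"
    by (subst lborel_vec2, subst integrable_distr_eq) (use i in simp_all)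
  have "(LINT x|(lborel :: (real ^ 2) measure). f (x $ 1) * g (x $ 2)) =
      (LINT z|(lborel \<Otimes>\<^sub>M lborel). f (fst z) * g (snd z))"
    by (subst lborel_vec2, subst integral_distr) simp_all
  also have "\<dots> = (LINT x|lborel. LINT y|lborel. f x * g y)"
    using lborel_pair.integral_fst'[OF i] by simp
  also have "\<dots> = (LINT x|lborel. f x) * (LINT x|lborel. g x)" by simp
  finally show "(LINT x|(lborel :: (real ^ 2) measure). f (x $ 1) * g (x $ 2)) =
      (LINT x|lborel. f x) * (LINT x|lborel. g x)" .
qed

lemma integrable_peak: "integrable lborel peak"
proof -
  have "peak = (\<lambda>x. inverse (1 + x\<^sup>2))" by (simp add: peak_def fun_eq_iff divide_inverse)
  then show ?thesis
    using integrable_inverse_1_plus_square by (simp add: set_integrable_def einterval_def)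
qed

lemma continuous_on_peak: "continuous_on A peak"
proof -
  have "1 + x\<^sup>2 \<noteq> 0" for x :: real using zero_le_power2[of x] by linarith
  then show ?thesis unfolding peak_def[abs_def] by (intro continuous_intros) auto
qed

lemma measurable_peak [measurable]: "peak \<in> borel_measurable borel"
  by (intro borel_measurable_continuous_onI continuous_on_peak)

lemma schwartz_continuous:
  assumes "f \<in> schwartz" shows "continuous_on A f"
proof -
  have "f differentiable (at x)" for x
    using assms unfolding schwartz_def smooth_def by (auto dest!: spec[of _ "[]"])
  then show ?thesis by (meson continuous_at_imp_continuous_on differentiable_imp_continuous_within)
qed

text \<open>The seminorms with weights \<open>norm x ^ 0\<close> and \<open>norm x ^ 4\<close> bound
  the function by a multiple of a product of two peaks, because
  \<open>(1 + s) * (1 + t) \<le> 2 + 2 * (s + t)^2\<close> for the squares \<open>s\<close>,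
  \<open>t\<close> of the coordinates.\<close>

lemma schwartz_integrable:
  fixes \<psi> :: "real ^ 2 \<Rightarrow> complex"
  assumes \<psi>: "\<psi> \<in> schwartz"
  shows "integrable lborel \<psi>"
proof -
  have bd: "\<exists>B. \<forall>x. norm x ^ k * norm (\<psi> x) \<le> B" for k
  proof -
    have "bounded (range (\<lambda>x. norm x ^ k * norm (iterated_partial [] \<psi> x)))"
      using \<psi> unfolding schwartz_def by (auto dest!: spec[of _ k] spec[of _ "[]"])
    then obtain B where B: "\<And>x. norm (norm x ^ k * norm (\<psi> x)) \<le> B"
      unfolding bounded_iff by auto
    have "norm x ^ k * norm (\<psi> x) \<le> B" for x using B[of x] by simp
    then show ?thesis by blast
  qed
  obtain B0 where B0: "\<And>x. norm (\<psi> x) \<le> B0" using bd[of 0] by auto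
  obtain B4 where B4: "\<And>x. norm x ^ 4 * norm (\<psi> x) \<le> B4" using bd[of 4] by auto
  let ?p = "\<lambda>x::real ^ 2. complex_of_real (peak (x $ 1)) * complex_of_real (peak (x $ 2))"
  show ?thesis
  proof (rule Bochner_Integration.integrable_bound)
    have "integrable lborel (\<lambda>x. complex_of_real (peak x))"
      using integrable_peak by simp
    then show "integrable lborel (\<lambda>x. of_real (2 * B0 + 2 * B4) * ?p x)"
      by (intro integrable_mult_right integral_vec2)
    show "\<psi> \<in> borel_measurable lborel"
      using borel_measurable_continuous_onI[OF schwartz_continuous[OF \<psi>]] by simp
    have "norm (\<psi> x) \<le> norm (of_real (2 * B0 + 2 * B4) * ?p x)" for x
    proof -
      have n: "norm x ^ 2 = (x $ 1)\<^sup>2 + (x $ 2)\<^sup>2"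
        unfolding power2_norm_eq_inner by (simp add: inner_vec_def sum_2 power2_eq_square)
      define s t where "s = (x $ 1)\<^sup>2" and "t = (x $ 2)\<^sup>2"
      have st: "s \<ge> 0" "t \<ge> 0" by (auto simp: s_def t_def)
      have "norm x ^ 4 = (s + t)\<^sup>2" using n by (simp add: s_def t_def power2_eq_square power4_eq_xxxx mult.assoc)
      moreover have "(1 + s) * (1 + t) \<le> 2 + 2 * (s + t)\<^sup>2"
      proof -
        have "2 + 2 * (s + t)\<^sup>2 - (1 + s) * (1 + t) = (1 - (s + t) / 2)\<^sup>2 + (3 / 4) * (s + t)\<^sup>2 + (s * s + s * t + t * t)"
          by (simp add: power2_eq_square field_simps)
        moreover have "\<dots> \<ge> 0" using st by (intro add_nonneg_nonneg) auto
        ultimately show ?thesis by linarith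
      qed
      ultimately have "(1 + s) * (1 + t) * norm (\<psi> x) \<le> (2 + 2 * norm x ^ 4) * norm (\<psi> x)"
        by (intro mult_right_mono) auto
      also have "\<dots> \<le> 2 * B0 + 2 * B4" using B0[of x] B4[of x] by (simp add: distrib_right)
      finally have *: "(1 + s) * (1 + t) * norm (\<psi> x) \<le> 2 * B0 + 2 * B4" .
      have pos: "(1 + s) * (1 + t) > 0" using st by (intro mult_pos_pos) auto
      have "0 \<le> (1 + s) * (1 + t) * norm (\<psi> x)" using pos by simp
      then have BB: "2 * B0 + 2 * B4 \<ge> 0" using * by linarith
      have "norm (\<psi> x) \<le> (2 * B0 + 2 * B4) / ((1 + s) * (1 + t))"
        using * pos by (simp add: le_divide_eq mult.commute)
      also have "\<dots> = (2 * B0 + 2 * B4) * (peak (x $ 1) * peak (x $ 2))"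
        by (simp add: peak_def s_def t_def)
      also have "\<dots> = norm (of_real ((2 * B0 + 2 * B4) * (peak (x $ 1) * peak (x $ 2))) :: complex)"
        using BB peak_bounds[of "x $ 1"] peak_bounds[of "x $ 2"] unfolding norm_of_real by simp
      finally show ?thesis by simp
    qed
    then show "AE x in lborel. norm (\<psi> x) \<le> norm (of_real (2 * B0 + 2 * B4) * ?p x)" by simp
  qed
qed

lemma indicator_unit_cube:
  "indicator unit_cube x = (indicator {0..<1} (x $ 1) * indicator {0..<1} (x $ 2) :: 'a::{comm_semiring_1})"
  for x :: "real ^ 2"
  by (auto simp: unit_cube_def indicator_def forall_2)

lemma sets_unit_cube [measurable]: "(unit_cube :: (real ^ 2) set) \<in> sets borel"
  unfolding unit_cube_def forall_2 by simp

lemma integrable_unit_cube: "integrable lborel (\<lambda>x::real ^ 2. indicator unit_cube x :: complex)"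
proof -
  have "integrable lborel (\<lambda>x::real. indicator {0..<1} x :: complex)"
    by (subst of_real_indicator[symmetric]) (intro integrable_of_real integrable_real_indicator; simp)
  from integral_vec2(1)[OF this this] show ?thesis by (simp only: indicator_unit_cube)
qed

lemma integrable_unit_cube_mult:
  fixes h :: "real ^ 2 \<Rightarrow> complex"
  assumes [measurable]: "h \<in> borel_measurable borel" and B: "\<And>x. x \<in> unit_cube \<Longrightarrow> norm (h x) \<le> B"
  shows "integrable lborel (\<lambda>x. indicator unit_cube x * h x)"
proof (rule Bochner_Integration.integrable_bound)
  show "integrable lborel (\<lambda>x::real ^ 2. of_real B * indicator unit_cube x :: complex)"
    by (rule integrable_mult_right) (rule integrable_unit_cube)
  have B0: "0 \<le> B"
    by (rule order_trans[OF norm_ge_zero B[of 0]]) (simp add: unit_cube_def)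
  show "AE x in lborel. norm (indicator unit_cube x * h x) \<le> norm (of_real B * indicator unit_cube x :: complex)"
    using B B0 by (auto simp: indicator_def intro!: AE_I2)
qed simp

section \<open>Tensor kernels and duality\<close>

lemma tensor_cutoff_2: "tensor_cutoff \<phi>\<^sub>0 d x = dyadic_cutoff \<phi>\<^sub>0 (d 1) (x $ 1) * dyadic_cutoff \<phi>\<^sub>0 (d 2) (x $ 2)"
  for x :: "real ^ 2"
  by (simp add: tensor_cutoff_def UNIV_2)

definition kernel2 :: "(real \<Rightarrow> complex) \<Rightarrow> (2 \<Rightarrow> nat) \<Rightarrow> real ^ 2 \<Rightarrow> complex" where
  "kernel2 \<phi>\<^sub>0 d w = kernel \<phi>\<^sub>0 (d 1) (w $ 1) * kernel \<phi>\<^sub>0 (d 2) (w $ 2)"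

lemma integral_tensor_cutoff:
  assumes d: "\<And>j. integrable lborel (dyadic_cutoff \<phi>\<^sub>0 j)"
  shows "(LINT \<xi>|lborel. tensor_cutoff \<phi>\<^sub>0 d \<xi> * cis (\<xi> \<bullet> w)) = of_real ((2 * pi)\<^sup>2) * kernel2 \<phi>\<^sub>0 d w"
    and "integrable (lborel :: (real ^ 2) measure) (tensor_cutoff \<phi>\<^sub>0 d)"
proof -
  have [measurable]: "dyadic_cutoff \<phi>\<^sub>0 j \<in> borel_measurable borel" for j
    using borel_measurable_integrable[OF d[of j]] by simp
  have [measurable]: "cis \<in> borel_measurable borel"
    by (intro borel_measurable_continuous_onI continuous_intros)
  have i: "integrable lborel (\<lambda>t. cis (z * t) * dyadic_cutoff \<phi>\<^sub>0 j t)" for z j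
    by (rule Bochner_Integration.integrable_bound[OF d[of j]]) (auto simp: norm_mult)
  have "tensor_cutoff \<phi>\<^sub>0 d \<xi> * cis (\<xi> \<bullet> w) =
     (cis (w $ 1 * \<xi> $ 1) * dyadic_cutoff \<phi>\<^sub>0 (d 1) (\<xi> $ 1)) * (cis (w $ 2 * \<xi> $ 2) * dyadic_cutoff \<phi>\<^sub>0 (d 2) (\<xi> $ 2))" for \<xi>
    by (simp add: tensor_cutoff_2 inner_vec_def sum_2 cis_mult[symmetric] mult_ac)
  then show "(LINT \<xi>|lborel. tensor_cutoff \<phi>\<^sub>0 d \<xi> * cis (\<xi> \<bullet> w)) = of_real ((2 * pi)\<^sup>2) * kernel2 \<phi>\<^sub>0 d w"
    using integral_vec2(2)[OF i i, of "w $ 1" "d 1" "w $ 2" "d 2"]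
    by (simp add: kernel2_def kernel_def power2_eq_square)
  show "integrable (lborel :: (real ^ 2) measure) (tensor_cutoff \<phi>\<^sub>0 d)"
    using integral_vec2(1)[OF d d, of "d 1" "d 2"] by (simp add: tensor_cutoff_2[abs_def])
qed

text \<open>Unfolding the duality, a block at the test function \<open>\<psi>\<close> is the
  distribution at the function on the left. Fubini integrates over the frequency first and leaves
  the kernel at \<open>y - x\<close>: this is the transpose of the convolution.\<close>

lemma fourier_multiplier_convolution:
  fixes \<psi> :: "real ^ 2 \<Rightarrow> complex"
  assumes d: "\<And>j. integrable lborel (dyadic_cutoff \<phi>\<^sub>0 j)" and \<psi>: "\<psi> \<in> schwartz"
  shows "fourier (\<lambda>\<xi>. tensor_cutoff \<phi>\<^sub>0 d \<xi> * inverse_fourier \<psi> \<xi>) x = (LINT y|lborel. \<psi> y * kernel2 \<phi>\<^sub>0 d (y - x))"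
proof -
  have c: "complex_of_real ((2 * pi) powr (- real DIM(real ^ 2) / 2)) = of_real (1 / (2 * pi))"
    by (simp add: powr_minus_divide)
  have [measurable]: "cis \<in> borel_measurable borel"
    by (intro borel_measurable_continuous_onI continuous_intros)
  let ?f = "\<lambda>\<xi> y. tensor_cutoff \<phi>\<^sub>0 d \<xi> * \<psi> y * cis (\<xi> \<bullet> (y - x))"
  have int: "integrable (lborel \<Otimes>\<^sub>M lborel) (case_prod ?f)"
    using integrable_pair_mult_bounded[OF integral_tensor_cutoff(2)[OF d, of d] schwartz_integrable[OF \<psi>],
        of "\<lambda>z. cis (fst z \<bullet> (snd z - x))" 1]
    by (simp add: case_prod_beta')
  have "fourier (\<lambda>\<xi>. tensor_cutoff \<phi>\<^sub>0 d \<xi> * inverse_fourier \<psi> \<xi>) x =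
     of_real (1 / (2 * pi)) * (LINT \<xi>|lborel. cis (- (\<xi> \<bullet> x)) * (tensor_cutoff \<phi>\<^sub>0 d \<xi> *
       (of_real (1 / (2 * pi)) * (LINT y|lborel. cis (\<xi> \<bullet> y) * \<psi> y))))"
    unfolding fourier_def inverse_fourier_def c ..
  also have "(\<lambda>\<xi>. cis (- (\<xi> \<bullet> x)) * (tensor_cutoff \<phi>\<^sub>0 d \<xi> * (of_real (1 / (2 * pi)) * (LINT y|lborel. cis (\<xi> \<bullet> y) * \<psi> y))))
     = (\<lambda>\<xi>. of_real (1 / (2 * pi)) * (LINT y|lborel. ?f \<xi> y))"
  proof
    fix \<xi>
    have fy: "?f \<xi> y = (cis (- (\<xi> \<bullet> x)) * tensor_cutoff \<phi>\<^sub>0 d \<xi>) * (cis (\<xi> \<bullet> y) * \<psi> y)" for y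
    proof -
      have "cis (\<xi> \<bullet> (y - x)) = cis (- (\<xi> \<bullet> x)) * cis (\<xi> \<bullet> y)"
        by (simp only: cis_mult inner_diff_right) simp
      then show ?thesis by simp
    qed
    show "cis (- (\<xi> \<bullet> x)) * (tensor_cutoff \<phi>\<^sub>0 d \<xi> * (of_real (1 / (2 * pi)) * (LINT y|lborel. cis (\<xi> \<bullet> y) * \<psi> y))) =
       of_real (1 / (2 * pi)) * (LINT y|lborel. ?f \<xi> y)"
    proof -
      have "(LINT y|lborel. ?f \<xi> y) = (cis (- (\<xi> \<bullet> x)) * tensor_cutoff \<phi>\<^sub>0 d \<xi>) * (LINT y|lborel. cis (\<xi> \<bullet> y) * \<psi> y)"
        by (simp only: fy integral_mult_right_zero)
      then show ?thesis by simp
    qed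
  qed
  also have "of_real (1 / (2 * pi)) * (LINT \<xi>|lborel. of_real (1 / (2 * pi)) * (LINT y|lborel. ?f \<xi> y)) =
     of_real (1 / (2 * pi)) * (of_real (1 / (2 * pi)) * (LINT \<xi>|lborel. LINT y|lborel. ?f \<xi> y))"
    by (simp only: integral_mult_right_zero)
  also have "(LINT \<xi>|lborel. LINT y|lborel. ?f \<xi> y) = (LINT y|lborel. LINT \<xi>|lborel. ?f \<xi> y)"
    by (rule lborel_pair.Fubini_integral[OF int, symmetric])
  also have "(\<lambda>y. LINT \<xi>|lborel. ?f \<xi> y) = (\<lambda>y. of_real ((2 * pi)\<^sup>2) * (\<psi> y * kernel2 \<phi>\<^sub>0 d (y - x)))"
  proof
    fix y
    have "?f \<xi> y = \<psi> y * (tensor_cutoff \<phi>\<^sub>0 d \<xi> * cis (\<xi> \<bullet> (y - x)))" for \<xi> by simp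
    then show "(LINT \<xi>|lborel. ?f \<xi> y) = of_real ((2 * pi)\<^sup>2) * (\<psi> y * kernel2 \<phi>\<^sub>0 d (y - x))"
      by (simp only: integral_mult_right_zero integral_tensor_cutoff(1)[OF d] mult.left_commute)
  qed
  also have "(LINT y|lborel. of_real ((2 * pi)\<^sup>2) * (\<psi> y * kernel2 \<phi>\<^sub>0 d (y - x))) =
     of_real ((2 * pi)\<^sup>2) * (LINT y|lborel. \<psi> y * kernel2 \<phi>\<^sub>0 d (y - x))"
    by (simp only: integral_mult_right_zero)
  finally show ?thesis by (simp add: power2_eq_square)
qed

text \<open>A second use of Fubini moves the convolution from the test function to \<open>h\<close>;
  boundedness of the kernels and integrability of \<open>h\<close> on the cube make the double
  integral absolutely convergent.\<close>

lemma frequency_block_represents: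
  fixes h :: "real ^ 2 \<Rightarrow> complex"
  assumes d: "\<And>j. integrable lborel (dyadic_cutoff \<phi>\<^sub>0 j)"
    and k: "\<And>j. continuous_on UNIV (kernel \<phi>\<^sub>0 j)" "\<And>j. \<exists>B. \<forall>w. norm (kernel \<phi>\<^sub>0 j w) \<le> B"
    and h[measurable]: "h \<in> borel_measurable borel" and hB: "\<And>x. x \<in> unit_cube \<Longrightarrow> norm (h x) \<le> Bh"
  shows "represents_distr (\<lambda>y. LINT x:unit_cube|lborel. h x * kernel2 \<phi>\<^sub>0 d (y - x))
    (frequency_block \<phi>\<^sub>0 d (regular_distr unit_cube h))"
proof -
  have [measurable]: "kernel \<phi>\<^sub>0 j \<in> borel_measurable borel" for j
    by (intro borel_measurable_continuous_onI k)
  have k2[measurable]: "kernel2 \<phi>\<^sub>0 d \<in> borel_measurable borel"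
    unfolding kernel2_def[abs_def] by simp
  obtain B1 B2 where B: "\<And>w. norm (kernel \<phi>\<^sub>0 (d 1) w) \<le> B1" "\<And>w. norm (kernel \<phi>\<^sub>0 (d 2) w) \<le> B2"
    using k(2) by metis
  have B10: "0 \<le> B1" using order_trans[OF norm_ge_zero B(1)] .
  have kB: "norm (kernel2 \<phi>\<^sub>0 d w) \<le> B1 * B2" for w
    unfolding kernel2_def norm_mult by (intro mult_mono B B10) simp
  let ?h = "\<lambda>x. indicator unit_cube x * h x"
  have hi: "integrable lborel ?h" by (rule integrable_unit_cube_mult[OF h hB])
  let ?g = "\<lambda>y. LINT x:unit_cube|lborel. h x * kernel2 \<phi>\<^sub>0 d (y - x)"
  have g: "?g y = (LINT x|lborel. ?h x * kernel2 \<phi>\<^sub>0 d (y - x))" for y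
    unfolding set_lebesgue_integral_def by (intro Bochner_Integration.integral_cong) (auto simp: indicator_def)
  show ?thesis unfolding represents_distr_def
  proof (intro conjI ballI)
    show "?g \<in> borel_measurable lborel" unfolding g by (intro lborel.borel_measurable_lebesgue_integral) simp
    fix \<psi> :: "real ^ 2 \<Rightarrow> complex" assume \<psi>: "\<psi> \<in> schwartz"
    let ?F = "\<lambda>x y. ?h x * \<psi> y * kernel2 \<phi>\<^sub>0 d (y - x)"
    have int: "integrable (lborel \<Otimes>\<^sub>M lborel) (case_prod ?F)"
      using integrable_pair_mult_bounded[OF hi schwartz_integrable[OF \<psi>],
          of "\<lambda>z. kernel2 \<phi>\<^sub>0 d (snd z - fst z)" "B1 * B2"] kB
      by (simp add: case_prod_beta')
    have g\<psi>: "?g y * \<psi> y = (LINT x|lborel. ?F x y)" for y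
      unfolding g integral_mult_left_zero[symmetric] by (simp add: mult_ac)
    show "integrable lborel (\<lambda>y. ?g y * \<psi> y)"
      unfolding g\<psi> using lborel_pair.integrable_fst'[OF lborel_pair.integrable_product_swap[OF int]] by simp
    have "frequency_block \<phi>\<^sub>0 d (regular_distr unit_cube h) \<psi> =
       (LINT x:unit_cube|lborel. h x * (LINT y|lborel. \<psi> y * kernel2 \<phi>\<^sub>0 d (y - x)))"
      unfolding frequency_block_def inverse_fourier_distr_def mult_distr_def fourier_distr_def regular_distr_def
        fourier_multiplier_convolution[OF d \<psi>] ..
    also have "\<dots> = (LINT x|lborel. LINT y|lborel. ?F x y)"
      unfolding set_lebesgue_integral_def
    proof (intro Bochner_Integration.integral_cong refl)
      fix x
      have "(LINT y|lborel. ?F x y) = (LINT y|lborel. ?h x * (\<psi> y * kernel2 \<phi>\<^sub>0 d (y - x)))"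
        by (simp only: mult.assoc)
      also have "\<dots> = ?h x * (LINT y|lborel. \<psi> y * kernel2 \<phi>\<^sub>0 d (y - x))" by (rule integral_mult_right_zero)
      finally show "indicator unit_cube x *\<^sub>R (h x * (LINT y|lborel. \<psi> y * kernel2 \<phi>\<^sub>0 d (y - x))) = (LINT y|lborel. ?F x y)"
        by (simp add: indicator_def)
    qed
    also have "\<dots> = (LINT y|lborel. LINT x|lborel. ?F x y)"
      by (rule lborel_pair.Fubini_integral[OF int, symmetric])
    finally show "frequency_block \<phi>\<^sub>0 d (regular_distr unit_cube h) \<psi> = (LINT y|lborel. ?g y * \<psi> y)"
      unfolding g\<psi> .
  qed
qed

lemma dyadic_cutoff_integrable:
  assumes c: "continuous_on UNIV \<phi>\<^sub>0" and supp: "\<And>t. \<bar>t\<bar> > 3 / 2 \<Longrightarrow> \<phi>\<^sub>0 t = 0"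
  shows "integrable lborel (dyadic_cutoff \<phi>\<^sub>0 j)"
proof -
  have i: "integrable lborel \<phi>\<^sub>0"
    using lborel_integral_trunc_fourier(2)[OF c supp, of 0] by simp
  have s: "integrable lborel (\<lambda>t. \<phi>\<^sub>0 (a * t))" if "a \<noteq> 0" for a
    using lborel_integrable_real_affine[OF i that, of 0] by simp
  show ?thesis
    unfolding dyadic_cutoff_def[abs_def] by (cases "j = 0") (auto intro!: i s)
qed

text \<open>A bounded function on the unit cube is integrable, so the supremum seminorm alone
  dominates: the sum of seminorms is taken with \<open>m = 0\<close> and has a single term.\<close>

lemma regular_distr_tempered:
  fixes h :: "real ^ 2 \<Rightarrow> complex"
  assumes h[measurable]: "h \<in> borel_measurable borel" and hB: "\<And>x. x \<in> unit_cube \<Longrightarrow> norm (h x) \<le> Bh"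
  shows "tempered_distribution (regular_distr unit_cube h)"
proof -
  let ?h = "\<lambda>x. indicator unit_cube x * h x"
  have hi: "integrable lborel ?h" by (rule integrable_unit_cube_mult[OF h hB])
  have e: "regular_distr unit_cube h f = (LINT x|lborel. ?h x * f x)" for f
    unfolding regular_distr_def set_lebesgue_integral_def
    by (intro Bochner_Integration.integral_cong) (auto simp: indicator_def)
  have sn: "norm (f x) \<le> schwartz_seminorm 0 [] f" if f: "f \<in> schwartz" for f and x :: "real ^ 2"
  proof -
    have "bounded (range (\<lambda>x. norm x ^ 0 * norm (iterated_partial [] f x)))"
      using f unfolding schwartz_def by (auto dest!: spec[of _ 0] spec[of _ "[]"])
    then have "bdd_above (range (\<lambda>x. norm x ^ 0 * norm (iterated_partial [] f x)))"
      by (rule bounded_imp_bdd_above)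
    from cSUP_upper[OF UNIV_I this, of x] show ?thesis by (simp add: schwartz_seminorm_def)
  qed
  have fm: "f \<in> borel_measurable borel" if "f \<in> schwartz" for f :: "real ^ 2 \<Rightarrow> complex"
    by (intro borel_measurable_continuous_onI schwartz_continuous that)
  have i: "integrable lborel (\<lambda>x. ?h x * f x)" if f: "f \<in> schwartz" for f
  proof (rule Bochner_Integration.integrable_bound)
    have [measurable]: "f \<in> borel_measurable borel" by (rule fm[OF f])
    show "integrable lborel (\<lambda>x. of_real (schwartz_seminorm 0 [] f) * ?h x)"
      by (intro integrable_mult_right hi)
    show "(\<lambda>x. ?h x * f x) \<in> borel_measurable lborel" by simp
    have "0 \<le> schwartz_seminorm 0 [] f" by (rule order_trans[OF norm_ge_zero sn[OF f]])
    then show "AE x in lborel. norm (?h x * f x) \<le> norm (of_real (schwartz_seminorm 0 [] f) * ?h x)"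
      by (auto simp: norm_mult mult.commute[of "schwartz_seminorm 0 [] f"] intro!: AE_I2 mult_left_mono sn[OF f])
  qed
  show ?thesis unfolding tempered_distribution_def e
  proof (intro conjI ballI allI exI)
    fix f g :: "real ^ 2 \<Rightarrow> complex" assume "f \<in> schwartz" "g \<in> schwartz"
    then show "(LINT x|lborel. ?h x * (f x + g x)) = (LINT x|lborel. ?h x * f x) + (LINT x|lborel. ?h x * g x)"
      using i by (simp add: distrib_left)
  next
    fix c :: complex and f :: "real ^ 2 \<Rightarrow> complex"
    show "(LINT x|lborel. ?h x * (c * f x)) = c * (LINT x|lborel. ?h x * f x)"
      unfolding integral_mult_right_zero[symmetric] by (simp add: mult_ac)
  next
    fix f :: "real ^ 2 \<Rightarrow> complex" assume f: "f \<in> schwartz"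
    have "norm (LINT x|lborel. ?h x * f x) \<le> (LINT x|lborel. norm (?h x * f x))" by (rule integral_norm_bound)
    also have "\<dots> \<le> (LINT x|lborel. norm (?h x) * schwartz_seminorm 0 [] f)"
    proof (rule integral_mono)
      show "integrable lborel (\<lambda>x. norm (?h x * f x))" by (rule integrable_norm[OF i[OF f]])
      show "integrable lborel (\<lambda>x. norm (?h x) * schwartz_seminorm 0 [] f)"
        by (rule integrable_mult_left) (rule integrable_norm[OF hi])
      show "norm (?h x * f x) \<le> norm (?h x) * schwartz_seminorm 0 [] f" for x
        unfolding norm_mult[of "?h x"] by (rule mult_left_mono[OF sn[OF f] norm_ge_zero])
    qed
    also have "\<dots> = (LINT x|lborel. norm (?h x)) * schwartz_seminorm 0 [] f" by simp
    also have "\<dots> = (LINT x|lborel. norm (?h x)) * (\<Sum>(k, vs)\<in>{..0} \<times> {vs. set vs \<subseteq> Basis \<and> length vs \<le> 0}. schwartz_seminorm k vs f)"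
    proof -
      have "{..0::nat} \<times> {vs::(real ^ 2) list. set vs \<subseteq> Basis \<and> length vs \<le> 0} = {(0, [])}" by auto
      then show ?thesis by simp
    qed
    finally show "norm (LINT x|lborel. ?h x * f x) \<le> (LINT x|lborel. norm (?h x)) *
       (\<Sum>(k, vs)\<in>{..0} \<times> {vs. set vs \<subseteq> Basis \<and> length vs \<le> 0}. schwartz_seminorm k vs f)" .
  qed
qed

section \<open>Digits of Hammersley points\<close>

text \<open>The first \<open>j\<close> digits of the first coordinate of a Hammersley point, and the matching
  part of its second coordinate.\<close>

definition digit_prefix :: "nat \<Rightarrow> nat \<Rightarrow> (nat \<Rightarrow> nat \<Rightarrow> nat) \<Rightarrow> (nat \<Rightarrow> nat) \<Rightarrow> nat \<Rightarrow> nat" where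
  "digit_prefix b n \<Sigma> a j = (\<Sum>t<j. \<Sigma> (n - t) (a (n - t)) * b ^ (j - Suc t))"

definition digit_suffix :: "nat \<Rightarrow> nat \<Rightarrow> (nat \<Rightarrow> nat) \<Rightarrow> nat \<Rightarrow> real" where
  "digit_suffix b n a j = (\<Sum>t<j. real (a (n - t)) / real b ^ (j - t))"

lemma digit_prefix_Suc:
  "digit_prefix b n \<Sigma> a (Suc j) = digit_prefix b n \<Sigma> a j * b + \<Sigma> (n - j) (a (n - j))"
proof -
  have "(\<Sum>t<j. \<Sigma> (n - t) (a (n - t)) * b ^ (Suc j - Suc t)) = (\<Sum>t<j. \<Sigma> (n - t) (a (n - t)) * b ^ (j - Suc t) * b)"
  proof (rule sum.cong[OF refl])
    fix t assume "t \<in> {..<j}"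
    then have "Suc j - Suc t = Suc (j - Suc t)" by simp
    then show "\<Sigma> (n - t) (a (n - t)) * b ^ (Suc j - Suc t) = \<Sigma> (n - t) (a (n - t)) * b ^ (j - Suc t) * b"
      by (simp only: power_Suc mult_ac)
  qed
  then show ?thesis by (simp add: digit_prefix_def sum_distrib_right)
qed

lemma digit_suffix_Suc:
  assumes "b > 0"
  shows "digit_suffix b n a (Suc j) = (real (a (n - j)) + digit_suffix b n a j) / real b"
proof -
  have "(\<Sum>t<j. real (a (n - t)) / real b ^ (Suc j - t)) = (\<Sum>t<j. real (a (n - t)) / real b ^ (j - t) / real b)"
    by (rule sum.cong) (auto simp: Suc_diff_le)
  then show ?thesis
    by (simp add: digit_suffix_def sum_divide_distrib add_divide_distrib add.commute)
qed

text \<open>Recovers the digit \<open>a (n - j)\<close> of the second coordinate from the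
  corresponding digit of the first. The value \<open>id\<close> beyond the range makes every index a
  bijection, as the lemmas on \<open>radinv\<close> demand.\<close>

definition inv_digit :: "nat \<Rightarrow> nat \<Rightarrow> (nat \<Rightarrow> nat \<Rightarrow> nat) \<Rightarrow> nat \<Rightarrow> nat \<Rightarrow> nat" where
  "inv_digit b n \<Sigma> j = (if j < n then inv_into {..<b} (\<Sigma> (n - j)) else id)"

lemma inv_digit_bij:
  assumes "\<And>i. i \<in> {1..n} \<Longrightarrow> bij_betw (\<Sigma> i) {..<b} {..<b}"
  shows "bij_betw (inv_digit b n \<Sigma> j) {..<b} {..<b}"
  using assms[of "n - j"] by (auto simp: inv_digit_def intro: bij_betw_inv_into)

text \<open>Lengthening the prefix appends a least significant digit to the first coordinate and
  puts its preimage in front of the second, which is the recursion of \<open>radinv\<close>.\<close>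

lemma digit_prefix_radinv:
  assumes b: "b > 0" and \<Sigma>: "\<And>i. i \<in> {1..n} \<Longrightarrow> bij_betw (\<Sigma> i) {..<b} {..<b}"
    and a: "a \<in> {1..n} \<rightarrow> {0..b - 1}" and j: "j \<le> n"
  shows "digit_prefix b n \<Sigma> a j < b ^ j \<and>
    radinv b (inv_digit b n \<Sigma>) j (digit_prefix b n \<Sigma> a j) = digit_suffix b n a j"
  using j
proof (induction j)
  case 0
  show ?case by (simp add: digit_prefix_def digit_suffix_def)
next
  case (Suc j)
  have nj: "n - j \<in> {1..n}" using Suc.prems by auto
  have aj: "a (n - j) \<in> {..<b}" using funcset_mem[OF a nj] b by auto
  have c: "\<Sigma> (n - j) (a (n - j)) < b" using bij_betwE[OF \<Sigma>[OF nj]] aj by blast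
  have i: "inv_digit b n \<Sigma> j (\<Sigma> (n - j) (a (n - j))) = a (n - j)"
    using bij_betw_inv_into_left[OF \<Sigma>[OF nj] aj] Suc.prems by (simp add: inv_digit_def)
  have IH: "digit_prefix b n \<Sigma> a j < b ^ j" "radinv b (inv_digit b n \<Sigma>) j (digit_prefix b n \<Sigma> a j) = digit_suffix b n a j"
    using Suc by auto
  have "digit_prefix b n \<Sigma> a j * b + \<Sigma> (n - j) (a (n - j)) < (digit_prefix b n \<Sigma> a j + 1) * b" using c by simp
  also have "\<dots> \<le> b ^ j * b" using IH(1) by (intro mult_right_mono) auto
  finally have "digit_prefix b n \<Sigma> a (Suc j) < b ^ Suc j" by (simp add: digit_prefix_Suc mult.commute)
  then show ?case using c b IH(2) by (simp add: digit_prefix_Suc i digit_suffix_Suc)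
qed

lemma digit_prefix_surj:
  assumes b: "b > 0" and \<Sigma>: "\<And>i. i \<in> {1..n} \<Longrightarrow> bij_betw (\<Sigma> i) {..<b} {..<b}"
    and j: "j \<le> n" and u: "u < b ^ j"
  shows "\<exists>a \<in> {1..n} \<rightarrow> {0..b - 1}. digit_prefix b n \<Sigma> a j = u"
  using j u
proof (induction j arbitrary: u)
  case 0
  then show ?case by (intro bexI[of _ "\<lambda>_. 0"]) (auto simp: digit_prefix_def)
next
  case (Suc j)
  have nj: "n - j \<in> {1..n}" using Suc.prems by auto
  have "u div b < b ^ j" using Suc.prems b by (simp add: less_mult_imp_div_less mult.commute)
  then obtain a where a: "a \<in> {1..n} \<rightarrow> {0..b - 1}" "digit_prefix b n \<Sigma> a j = u div b"
    using Suc by auto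
  have "u mod b \<in> \<Sigma> (n - j) ` {..<b}" using \<Sigma>[OF nj] b by (simp add: bij_betw_def)
  then obtain c where c: "c < b" "\<Sigma> (n - j) c = u mod b" by auto
  \<comment> \<open>The prefix of length \<open>j\<close> involves only arguments above
    \<open>n - j\<close>, so the digit at \<open>n - j\<close> is still free.\<close>
  have "digit_prefix b n \<Sigma> (a(n - j := c)) j = digit_prefix b n \<Sigma> a j"
    unfolding digit_prefix_def using Suc.prems by (intro sum.cong) auto
  then have "digit_prefix b n \<Sigma> (a(n - j := c)) (Suc j) = u" by (simp add: digit_prefix_Suc a(2) c(2))
  moreover have "a(n - j := c) \<in> {1..n} \<rightarrow> {0..b - 1}"
  proof
    fix i assume "i \<in> {1..n}"
    then show "(a(n - j := c)) i \<in> {0..b - 1}"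
      using funcset_mem[OF a(1), of i] c(1) by (cases "i = n - j") auto
  qed
  ultimately show ?case by blast
qed

text \<open>A digit and its flip add up to \<open>b - 1\<close>, so the two prefixes add up to the
  largest number with \<open>j\<close> digits.\<close>

lemma digit_prefix_flip:
  assumes b: "b > 0" and \<Sigma>: "\<And>i. i \<in> {1..n} \<Longrightarrow> bij_betw (\<Sigma> i) {..<b} {..<b}"
    and a: "a \<in> {1..n} \<rightarrow> {0..b - 1}" and j: "j \<le> n"
  shows "digit_prefix b n (\<lambda>i. flip b \<circ> \<Sigma> i) a j + digit_prefix b n \<Sigma> a j + 1 = b ^ j"
  using j
proof (induction j)
  case 0
  show ?case by (simp add: digit_prefix_def)
next
  case (Suc j)
  have nj: "n - j \<in> {1..n}" using Suc.prems by auto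
  have aj: "a (n - j) \<in> {..<b}" using funcset_mem[OF a nj] b by auto
  have c: "\<Sigma> (n - j) (a (n - j)) < b" using bij_betwE[OF \<Sigma>[OF nj]] aj by blast
  have *: "digit_prefix b n (\<lambda>i. flip b \<circ> \<Sigma> i) a (Suc j) + digit_prefix b n \<Sigma> a (Suc j) + 1 =
     (digit_prefix b n (\<lambda>i. flip b \<circ> \<Sigma> i) a j + digit_prefix b n \<Sigma> a j + 1) * b"
    using c by (simp add: digit_prefix_Suc flip_def algebra_simps)
  show ?case unfolding * Suc.IH[OF Suc_leD[OF Suc.prems]] by (simp only: power_Suc2)
qed

lemma sum_reindex_digits: "(\<Sum>i = 1..n. f i) = (\<Sum>t<n. f (n - t))" for n :: nat
proof (rule sum.reindex_bij_witness[of _ "\<lambda>t. n - t" "\<lambda>i. n - i"])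
qed auto

lemma digit_prefix_full:
  assumes "b > 0"
  shows "(\<Sum>i=1..n. real (\<Sigma> i (a i)) / real b ^ (n + 1 - i)) = real (digit_prefix b n \<Sigma> a n) / real b ^ n"
    and "(\<Sum>i=1..n. real (a i) / real b ^ i) = digit_suffix b n a n"
proof -
  have "real (\<Sigma> (n - t) (a (n - t))) / real b ^ (n + 1 - (n - t)) = real (\<Sigma> (n - t) (a (n - t)) * b ^ (n - Suc t)) / real b ^ n"
    if "t < n" for t
  proof -
    have e: "n + 1 - (n - t) + (n - Suc t) = n" using that by simp
    have "real b ^ n = real b ^ (n + 1 - (n - t)) * real b ^ (n - Suc t)"
      by (simp only: power_add[symmetric] e)
    then show ?thesis using assms by simp
  qed
  then show "(\<Sum>i=1..n. real (\<Sigma> i (a i)) / real b ^ (n + 1 - i)) = real (digit_prefix b n \<Sigma> a n) / real b ^ n"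
    unfolding sum_reindex_digits digit_prefix_def of_nat_sum sum_divide_distrib
    by (intro sum.cong) auto
  show "(\<Sum>i=1..n. real (a i) / real b ^ i) = digit_suffix b n a n"
    unfolding sum_reindex_digits digit_suffix_def ..
qed

lemma vector_eq_vec2: "vector [x, y] = vec2 (x, y)"
  by (simp add: vec_eq_iff forall_2)

text \<open>Both sets are enumerated by the prefix \<open>u\<close> of the unflipped point. Flipping
  keeps the second coordinate and replaces \<open>u\<close> by \<open>b ^ n - 1 - u\<close>, whence
  the shift by one in the reflected coordinate.\<close>

lemma hammersley_eq:
  assumes b: "b > 0" and \<Sigma>: "\<And>i. i \<in> {1..n} \<Longrightarrow> bij_betw (\<Sigma> i) {..<b} {..<b}"
  shows "hammersley b n \<Sigma> = (\<lambda>u. vec2 (real u / real b ^ n, radinv b (inv_digit b n \<Sigma>) n u)) ` {..<b ^ n}"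
    and "hammersley b n (\<lambda>i. flip b \<circ> \<Sigma> i) =
      (\<lambda>u. vec2 (1 - (real u + 1) / real b ^ n, radinv b (inv_digit b n \<Sigma>) n u)) ` {..<b ^ n}"
proof -
  let ?R = "radinv b (inv_digit b n \<Sigma>) n"
  let ?A = "{1..n} \<rightarrow> {0..b - 1}"
  have im: "digit_prefix b n \<Sigma> a n < b ^ n" "?R (digit_prefix b n \<Sigma> a n) = digit_suffix b n a n" if "a \<in> ?A" for a
    using digit_prefix_radinv[OF b \<Sigma> that le_refl] by auto
  have img: "(\<lambda>a. digit_prefix b n \<Sigma> a n) ` ?A = {..<b ^ n}"
  proof (intro equalityI subsetI)
    fix u assume "u \<in> (\<lambda>a. digit_prefix b n \<Sigma> a n) ` ?A"
    then show "u \<in> {..<b ^ n}" using im(1) by blast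
  next
    fix u assume "u \<in> {..<b ^ n}"
    then have "\<exists>a \<in> ?A. digit_prefix b n \<Sigma> a n = u"
      by (intro digit_prefix_surj[OF b \<Sigma> le_refl]) simp_all
    then show "u \<in> (\<lambda>a. digit_prefix b n \<Sigma> a n) ` ?A" by blast
  qed
  have "hammersley b n \<Sigma> = (\<lambda>a. vec2 (real (digit_prefix b n \<Sigma> a n) / real b ^ n, digit_suffix b n a n)) ` ?A"
    unfolding hammersley_def digit_prefix_full[OF b] vector_eq_vec2 by blast
  also have "\<dots> = (\<lambda>a. (\<lambda>u. vec2 (real u / real b ^ n, ?R u)) (digit_prefix b n \<Sigma> a n)) ` ?A"
    by (intro image_cong refl) (simp add: im)
  finally show "hammersley b n \<Sigma> = (\<lambda>u. vec2 (real u / real b ^ n, ?R u)) ` {..<b ^ n}"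
    unfolding img[symmetric] image_image .
  have fl: "real (digit_prefix b n (\<lambda>i. flip b \<circ> \<Sigma> i) a n) / real b ^ n = 1 - (real (digit_prefix b n \<Sigma> a n) + 1) / real b ^ n"
    if "a \<in> ?A" for a
  proof -
    have "real (digit_prefix b n (\<lambda>i. flip b \<circ> \<Sigma> i) a n + digit_prefix b n \<Sigma> a n + 1) = real (b ^ n)"
      by (simp only: digit_prefix_flip[OF b \<Sigma> that le_refl])
    then have "real (digit_prefix b n (\<lambda>i. flip b \<circ> \<Sigma> i) a n) = real b ^ n - (real (digit_prefix b n \<Sigma> a n) + 1)"
      by simp
    then show ?thesis using b by (simp add: diff_divide_distrib)
  qed
  have "hammersley b n (\<lambda>i. flip b \<circ> \<Sigma> i) =
      (\<lambda>a. vec2 (real (digit_prefix b n (\<lambda>i. flip b \<circ> \<Sigma> i) a n) / real b ^ n, digit_suffix b n a n)) ` ?A"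
    unfolding hammersley_def digit_prefix_full(1)[OF b, where \<Sigma> = "\<lambda>i. flip b \<circ> \<Sigma> i"]
      digit_prefix_full(2)[OF b] vector_eq_vec2 by blast
  also have "\<dots> = (\<lambda>a. (\<lambda>u. vec2 (1 - (real u + 1) / real b ^ n, ?R u)) (digit_prefix b n \<Sigma> a n)) ` ?A"
    by (intro image_cong refl) (simp add: im fl)
  finally show "hammersley b n (\<lambda>i. flip b \<circ> \<Sigma> i) = (\<lambda>u. vec2 (1 - (real u + 1) / real b ^ n, ?R u)) ` {..<b ^ n}"
    unfolding img[symmetric] image_image .
qed

lemma vec2_eq_iff: "vec2 z = vec2 w \<longleftrightarrow> z = w"
  by (metis vec2_nth prod.collapse)

lemma sum_sym_hammersley:
  fixes f :: "real ^ 2 \<Rightarrow> 'a::comm_monoid_add"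
  assumes b: "b > 0" and \<Sigma>: "\<And>i. i \<in> {1..n} \<Longrightarrow> bij_betw (\<Sigma> i) {..<b} {..<b}"
  shows "(\<Sum>x\<in>#sym_hammersley b n \<Sigma>. f x) =
     (\<Sum>u<b ^ n. f (vec2 (real u / real b ^ n, radinv b (inv_digit b n \<Sigma>) n u))) +
     (\<Sum>u<b ^ n. f (vec2 (1 - (real u + 1) / real b ^ n, radinv b (inv_digit b n \<Sigma>) n u)))"
    and "size (sym_hammersley b n \<Sigma>) = 2 * b ^ n"
    and "set_mset (sym_hammersley b n \<Sigma>) \<subseteq> unit_cube"
proof -
  let ?R = "radinv b (inv_digit b n \<Sigma>) n"
  let ?p = "\<lambda>u. vec2 (real u / real b ^ n, ?R u)" and ?p' = "\<lambda>u. vec2 (1 - (real u + 1) / real b ^ n, ?R u)"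
  have eq: "hammersley b n \<Sigma> = ?p ` {..<b ^ n}" "hammersley b n (\<lambda>i. flip b \<circ> \<Sigma> i) = ?p' ` {..<b ^ n}"
    by (rule hammersley_eq[OF b \<Sigma>], assumption)+
  \<comment> \<open>Injectivity turns the sum over each set into a sum over \<open>u\<close>; a
    point common to both sets appears in both sums, as in the multiset.\<close>
  have inj: "inj_on ?p {..<b ^ n}" "inj_on ?p' {..<b ^ n}"
    using b by (auto simp: inj_on_def vec2_eq_iff)
  show "(\<Sum>x\<in>#sym_hammersley b n \<Sigma>. f x) = (\<Sum>u<b ^ n. f (?p u)) + (\<Sum>u<b ^ n. f (?p' u))"
    unfolding sym_hammersley_def eq
    unfolding image_mset_union sum_mset.union sum_unfold_sum_mset[symmetric]
      sum.reindex[OF inj(1)] sum.reindex[OF inj(2)] o_def ..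
  show "size (sym_hammersley b n \<Sigma>) = 2 * b ^ n"
    unfolding sym_hammersley_def eq size_union size_mset_set card_image[OF inj(1)] card_image[OF inj(2)]
    by simp
  have lt: "inv_digit b n \<Sigma> j c < b" if "c < b" for j c
    using bij_betwE[OF inv_digit_bij[OF \<Sigma>]] that by auto
  have R: "0 \<le> ?R u" "?R u < 1" for u using radinv_bounds[OF b lt] by auto
  have u: "(real u + 1) / real b ^ n \<le> 1" if "u < b ^ n" for u
  proof -
    have "real (u + 1) \<le> real (b ^ n)" using that by (intro of_nat_mono) simp
    then show ?thesis using b by (simp add: divide_le_eq)
  qed
  have u': "real u / real b ^ n < 1" if "u < b ^ n" for u
    using that b by (simp add: divide_less_eq flip: of_nat_power)
  show "set_mset (sym_hammersley b n \<Sigma>) \<subseteq> unit_cube"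
    unfolding sym_hammersley_def eq using R u u' b
    by (auto simp: unit_cube_def forall_2 divide_pos_pos add_nonneg_pos)
qed

section \<open>Convolution of the discrepancy function\<close>

text \<open>The half-line \<open>{z<..}\<close> arises because \<open>z\<close> lies in
  \<open>[0, t)\<close> exactly when \<open>t > z\<close>. The primitive \<open>F\<close> turns the
  integral of the kernel over it into boundary values.\<close>

lemma kernel_tail_integral:
  fixes F :: "real \<Rightarrow> complex"
  assumes F: "C1_fun F (\<lambda>z. - k (y - z))" and z: "0 \<le> z" "z \<le> 1"
  shows "integrable lborel (\<lambda>t. indicator {0..<1} t * (indicator {z<..} t * k (y - t)))"
    and "(LINT t|lborel. indicator {0..<1} t * (indicator {z<..} t * k (y - t))) = F z - F 1"
proof -
  have ck: "continuous_on A (\<lambda>t. k (y - t))" for A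
    using continuous_on_minus[OF C1_funD(3)[OF F]] by simp
  have si: "set_integrable lborel {z..1} (\<lambda>t. k (y - t))"
    by (intro borel_integrable_atLeastAtMost' ck)
  have so: "set_integrable lborel {z<..<1} (\<lambda>t. k (y - t))"
    by (rule set_integrable_subset[OF si]) auto
  have e: "indicator {0..<1} t * (indicator {z<..} t * k (y - t)) = indicator {z<..<1} t *\<^sub>R k (y - t)" for t
    using z by (auto simp: indicator_def)
  show "integrable lborel (\<lambda>t. indicator {0..<1} t * (indicator {z<..} t * k (y - t)))"
    using so unfolding set_integrable_def e .
  have "(LINT t|lborel. indicator {0..<1} t * (indicator {z<..} t * k (y - t))) = (LINT t:{z<..<1}|lborel. k (y - t))"
    unfolding set_lebesgue_integral_def e ..
  also have "\<dots> = integral {z<..<1} (\<lambda>t. k (y - t))" by (rule set_borel_integral_eq_integral(2)[OF so])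
  also have "\<dots> = integral {z..1} (\<lambda>t. k (y - t))" by (rule integral_open_interval_real[symmetric])
  also have "\<dots> = F z - F 1"
  proof (rule integral_unique)
    have "((\<lambda>t. - k (y - t)) has_integral (F 1 - F z)) {z..1}"
      using z by (intro fundamental_theorem_of_calculus has_vector_derivative_at_within[OF C1_funD(1)[OF F]]) auto
    from has_integral_neg[OF this] show "((\<lambda>t. k (y - t)) has_integral (F z - F 1)) {z..1}" by simp
  qed
  finally show "(LINT t|lborel. indicator {0..<1} t * (indicator {z<..} t * k (y - t))) = F z - F 1" .
qed

text \<open>Integration by parts for one factor of the volume term of the discrepancy.\<close>

lemma kernel_moment_integral:
  fixes F :: "real \<Rightarrow> complex"
  assumes F: "C1_fun F (\<lambda>z. - k (y - z))"
  shows "integrable lborel (\<lambda>t. indicator {0..<1} t * (of_real t * k (y - t)))"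
    and "(LINT t|lborel. indicator {0..<1} t * (of_real t * k (y - t))) = integral {0..1} F - F 1"
proof -
  have ck: "continuous_on A (\<lambda>t. of_real t * k (y - t))" for A
    using continuous_on_minus[OF C1_funD(3)[OF F]] by (intro continuous_intros) simp
  have si: "set_integrable lborel {0..1} (\<lambda>t. of_real t * k (y - t))"
    by (intro borel_integrable_atLeastAtMost' ck)
  have so: "set_integrable lborel {0<..<1} (\<lambda>t. of_real t * k (y - t))"
    by (rule set_integrable_subset[OF si]) auto
  have e: "indicator {0..<1} t * (of_real t * k (y - t)) = indicator {0<..<1} t *\<^sub>R (of_real t * k (y - t))" for t
    by (auto simp: indicator_def)
  show "integrable lborel (\<lambda>t. indicator {0..<1} t * (of_real t * k (y - t)))"
    using so unfolding set_integrable_def e .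
  have "(LINT t|lborel. indicator {0..<1} t * (of_real t * k (y - t))) = (LINT t:{0<..<1}|lborel. of_real t * k (y - t))"
    unfolding set_lebesgue_integral_def e ..
  also have "\<dots> = integral {0<..<1} (\<lambda>t. of_real t * k (y - t))" by (rule set_borel_integral_eq_integral(2)[OF so])
  also have "\<dots> = integral {0..1} (\<lambda>t. of_real t * k (y - t))" by (rule integral_open_interval_real[symmetric])
  also have "\<dots> = integral {0..1} F - F 1"
  proof (rule integral_unique)
    have id: "(of_real has_vector_derivative (1::complex)) (at t within A)" for t :: real and A
      using has_vector_derivative_of_real[OF DERIV_ident[of "at t within A"]] by simp
    have 1: "((\<lambda>t. of_real t * - k (y - t) + 1 * F t) has_integral (of_real 1 * F 1 - of_real 0 * F 0)) {0..1}"
      by (intro fundamental_theorem_of_calculus has_vector_derivative_mult id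
          has_vector_derivative_at_within[OF C1_funD(1)[OF F]]) auto
    have 2: "(F has_integral integral {0..1} F) {0..1}"
      by (intro integrable_integral integrable_continuous_real C1_funD[OF F])
    from has_integral_diff[OF 2 1]
    show "((\<lambda>t. of_real t * k (y - t)) has_integral (integral {0..1} F - F 1)) {0..1}" by simp
  qed
  finally show "(LINT t|lborel. indicator {0..<1} t * (of_real t * k (y - t))) = integral {0..1} F - F 1" .
qed

lemma integrable_sum_mset:
  fixes f :: "'b \<Rightarrow> 'a \<Rightarrow> complex"
  assumes "\<And>z. z \<in># P \<Longrightarrow> integrable M (f z)"
  shows "integrable M (\<lambda>x. \<Sum>z\<in>#P. f z x) \<and> (LINT x|M. (\<Sum>z\<in>#P. f z x)) = (\<Sum>z\<in>#P. (LINT x|M. f z x))"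
  using assms by (induction P) auto

text \<open>The counting part and the volume part are sums of tensor products, so the convolution
  factors into the two one-dimensional integrals above. The outcome is the error of the mean over
  \<open>P\<close> for the product of the functions \<open>F1 - F1 1\<close> and
  \<open>F2 - F2 1\<close>.\<close>

lemma discrepancy_convolution:
  fixes F1 F2 :: "real \<Rightarrow> complex" and P :: "(real ^ 2) multiset"
  assumes F1: "C1_fun F1 (\<lambda>z. - k1 (y1 - z))" and F2: "C1_fun F2 (\<lambda>z. - k2 (y2 - z))"
    and P: "set_mset P \<subseteq> unit_cube"
  shows "(LINT x:unit_cube|lborel. of_real (discrepancy P x) * (k1 (y1 - x $ 1) * k2 (y2 - x $ 2))) =
     (\<Sum>z\<in>#P. (F1 (z $ 1) - F1 1) * (F2 (z $ 2) - F2 1)) / of_nat (size P)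
     - (integral {0..1} F1 - F1 1) * (integral {0..1} F2 - F2 1)"
proof -
  let ?I = "\<lambda>t::real. indicator {0..<1} t :: complex"
  define u1 where "u1 = (\<lambda>z t. ?I t * (indicator {z<..} t * k1 (y1 - t)))"
  define u2 where "u2 = (\<lambda>z t. ?I t * (indicator {z<..} t * k2 (y2 - t)))"
  define v1 where "v1 = (\<lambda>t. ?I t * (of_real t * k1 (y1 - t)))"
  define v2 where "v2 = (\<lambda>t. ?I t * (of_real t * k2 (y2 - t)))"
  have z01: "0 \<le> z $ i" "z $ i \<le> 1" if "z \<in># P" for z i
    using P that by (auto simp: unit_cube_def intro: less_imp_le)
  have u1: "integrable lborel (u1 (z $ 1))" "(LINT t|lborel. u1 (z $ 1) t) = F1 (z $ 1) - F1 1" if "z \<in># P" for z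
    unfolding u1_def using kernel_tail_integral[OF F1 z01[OF that]] by auto
  have u2: "integrable lborel (u2 (z $ 2))" "(LINT t|lborel. u2 (z $ 2) t) = F2 (z $ 2) - F2 1" if "z \<in># P" for z
    unfolding u2_def using kernel_tail_integral[OF F2 z01[OF that]] by auto
  have v: "integrable lborel v1" "(LINT t|lborel. v1 t) = integral {0..1} F1 - F1 1"
    "integrable lborel v2" "(LINT t|lborel. v2 t) = integral {0..1} F2 - F2 1"
    unfolding v1_def v2_def using kernel_moment_integral[OF F1] kernel_moment_integral[OF F2] by auto
  have pt: "indicator unit_cube x *\<^sub>R (of_real (discrepancy P x) * (k1 (y1 - x $ 1) * k2 (y2 - x $ 2))) =
      (\<Sum>z\<in>#P. u1 (z $ 1) (x $ 1) * u2 (z $ 2) (x $ 2)) / of_nat (size P) - v1 (x $ 1) * v2 (x $ 2)" for x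
  proof -
    have ind: "(indicator {w. \<forall>i. 0 \<le> w $ i \<and> w $ i < x $ i} z :: real) =
        indicator {z $ 1<..} (x $ 1) * indicator {z $ 2<..} (x $ 2)" if "z \<in># P" for z :: "real ^ 2"
      using z01[OF that] by (auto simp: indicator_def forall_2)
    have "(\<Sum>z\<in>#P. indicator {w. \<forall>i. 0 \<le> w $ i \<and> w $ i < x $ i} z :: real) =
        (\<Sum>z\<in>#P. indicator {z $ 1<..} (x $ 1) * indicator {z $ 2<..} (x $ 2))"
      by (intro arg_cong[where f = sum_mset] image_mset_cong ind)
    then have disc: "complex_of_real (discrepancy P x) =
       (\<Sum>z\<in>#P. indicator {z $ 1<..} (x $ 1) * indicator {z $ 2<..} (x $ 2)) / of_nat (size P) - of_real (x $ 1) * of_real (x $ 2)"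
    proof -
      have o: "complex_of_real (\<Sum>z\<in>#P. f z) = (\<Sum>z\<in>#P. of_real (f z))" for f
        by (induction P) auto
      show ?thesis unfolding discrepancy_def \<open>sum_mset _ = _\<close> by (simp add: UNIV_2 o of_real_indicator)
    qed
    have m: "(\<Sum>z\<in>#P. f z) * c = (\<Sum>z\<in>#P. f z * c)" for f and c :: complex
      by (induction P) (auto simp: distrib_right)
    have "indicator unit_cube x *\<^sub>R (of_real (discrepancy P x) * (k1 (y1 - x $ 1) * k2 (y2 - x $ 2))) =
       (\<Sum>z\<in>#P. indicator {z $ 1<..} (x $ 1) * indicator {z $ 2<..} (x $ 2)) *
         (?I (x $ 1) * ?I (x $ 2) * (k1 (y1 - x $ 1) * k2 (y2 - x $ 2))) / of_nat (size P) - v1 (x $ 1) * v2 (x $ 2)"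
    proof -
      have "(indicator unit_cube x :: real) *\<^sub>R c = ?I (x $ 1) * ?I (x $ 2) * c" for c :: complex
        by (simp add: indicator_unit_cube scaleR_conv_of_real of_real_indicator)
      then show ?thesis unfolding disc v1_def v2_def by (simp add: algebra_simps)
    qed
    also have "(\<Sum>z\<in>#P. indicator {z $ 1<..} (x $ 1) * indicator {z $ 2<..} (x $ 2)) *
         (?I (x $ 1) * ?I (x $ 2) * (k1 (y1 - x $ 1) * k2 (y2 - x $ 2))) = (\<Sum>z\<in>#P. u1 (z $ 1) (x $ 1) * u2 (z $ 2) (x $ 2))"
      unfolding m u1_def u2_def by (intro arg_cong[where f = sum_mset] image_mset_cong) (simp add: mult_ac)
    finally show ?thesis .
  qed
  have int: "integrable (lborel :: (real ^ 2) measure) (\<lambda>x. u1 (z $ 1) (x $ 1) * u2 (z $ 2) (x $ 2))"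
    "(LINT x|(lborel :: (real ^ 2) measure). u1 (z $ 1) (x $ 1) * u2 (z $ 2) (x $ 2)) = (F1 (z $ 1) - F1 1) * (F2 (z $ 2) - F2 1)"
    if "z \<in># P" for z
    using integral_vec2[OF u1(1)[OF that] u2(1)[OF that]] u1(2)[OF that] u2(2)[OF that] by auto
  have S: "integrable (lborel :: (real ^ 2) measure) (\<lambda>x. \<Sum>z\<in>#P. u1 (z $ 1) (x $ 1) * u2 (z $ 2) (x $ 2))"
    "(LINT x|(lborel :: (real ^ 2) measure). (\<Sum>z\<in>#P. u1 (z $ 1) (x $ 1) * u2 (z $ 2) (x $ 2))) = (\<Sum>z\<in>#P. (F1 (z $ 1) - F1 1) * (F2 (z $ 2) - F2 1))"
  proof -
    note i = integrable_sum_mset[of P "lborel :: (real ^ 2) measure" "\<lambda>z x. u1 (z $ 1) (x $ 1) * u2 (z $ 2) (x $ 2)"]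
    show "integrable (lborel :: (real ^ 2) measure) (\<lambda>x. \<Sum>z\<in>#P. u1 (z $ 1) (x $ 1) * u2 (z $ 2) (x $ 2))"
      using i int(1) by blast
    have "(LINT x|(lborel :: (real ^ 2) measure). (\<Sum>z\<in>#P. u1 (z $ 1) (x $ 1) * u2 (z $ 2) (x $ 2))) =
       (\<Sum>z\<in>#P. (LINT x|(lborel :: (real ^ 2) measure). u1 (z $ 1) (x $ 1) * u2 (z $ 2) (x $ 2)))"
      using i int(1) by blast
    also have "\<dots> = (\<Sum>z\<in>#P. (F1 (z $ 1) - F1 1) * (F2 (z $ 2) - F2 1))"
      by (intro arg_cong[where f = sum_mset] image_mset_cong int(2))
    finally show "(LINT x|(lborel :: (real ^ 2) measure). (\<Sum>z\<in>#P. u1 (z $ 1) (x $ 1) * u2 (z $ 2) (x $ 2))) = (\<Sum>z\<in>#P. (F1 (z $ 1) - F1 1) * (F2 (z $ 2) - F2 1))" .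
  qed
  show ?thesis
    unfolding set_lebesgue_integral_def pt
    using S integral_vec2[OF v(1) v(3)] v(2) v(4) by (subst Bochner_Integration.integral_diff) auto
qed

section \<open>Bounds in \<open>L\<^sub>p\<close>\<close>

text \<open>Formulated for nonnegative majorants with an explicit real bound, so that majorants are
  combined without evaluating any norm.\<close>

definition Lp_le :: "real \<Rightarrow> ('a::euclidean_space \<Rightarrow> real) \<Rightarrow> real \<Rightarrow> bool" where
  "Lp_le P f A \<longleftrightarrow> f \<in> borel_measurable borel \<and> (\<forall>x. 0 \<le> f x) \<and> 0 \<le> A \<and>
     (\<integral>\<^sup>+x. ennreal (f x powr P) \<partial>lborel) \<le> ennreal (A powr P)"

lemma Lp_leD:
  assumes "Lp_le P f A"
  shows "f \<in> borel_measurable borel" "0 \<le> f x" "0 \<le> A"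
    "(\<integral>\<^sup>+x. ennreal (f x powr P) \<partial>lborel) \<le> ennreal (A powr P)"
  using assms by (auto simp: Lp_le_def)

lemma Lp_le_mono:
  assumes "Lp_le P g A" and "f \<in> borel_measurable borel" and "\<And>x. 0 \<le> f x" "\<And>x. f x \<le> g x" and "A \<le> B"
    and "P \<ge> 0"
  shows "Lp_le P f B"
proof -
  note g = Lp_leD[OF assms(1)]
  have "(\<integral>\<^sup>+x. ennreal (f x powr P) \<partial>lborel) \<le> (\<integral>\<^sup>+x. ennreal (g x powr P) \<partial>lborel)"
    using assms by (intro nn_integral_mono ennreal_leI powr_mono2) auto
  also have "\<dots> \<le> ennreal (A powr P)" by (rule g)
  also have "\<dots> \<le> ennreal (B powr P)" using g(3) assms by (intro ennreal_leI powr_mono2) auto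
  finally show ?thesis using assms g(3) by (simp add: Lp_le_def)
qed

lemma Lp_le_cmult:
  assumes "Lp_le P f A" and "c \<ge> 0"
  shows "Lp_le P (\<lambda>x. c * f x) (c * A)"
proof -
  note f = Lp_leD[OF assms(1)]
  have [measurable]: "f \<in> borel_measurable borel" by (rule f(1))
  have "(\<integral>\<^sup>+x. ennreal ((c * f x) powr P) \<partial>lborel) = (\<integral>\<^sup>+x. ennreal (c powr P) * ennreal (f x powr P) \<partial>lborel)"
    using assms(2) f(2) by (simp add: powr_mult ennreal_mult')
  also have "\<dots> = ennreal (c powr P) * (\<integral>\<^sup>+x. ennreal (f x powr P) \<partial>lborel)" by (simp add: nn_integral_cmult)
  also have "\<dots> \<le> ennreal (c powr P) * ennreal (A powr P)" by (intro mult_left_mono f) simp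
  also have "\<dots> = ennreal ((c * A) powr P)" using assms(2) f(3) by (simp add: powr_mult ennreal_mult')
  finally show ?thesis using assms(2) f(2,3) by (simp add: Lp_le_def)
qed

text \<open>A crude substitute for the triangle inequality, from
  \<open>(s + t) powr P \<le> (2 * max s t) powr P\<close>. The factor \<open>4\<close> is harmless
  because only two or three majorants are ever added this way.\<close>

lemma Lp_le_add:
  assumes "Lp_le P f A" and "Lp_le P g B" and P: "P \<ge> 1"
  shows "Lp_le P (\<lambda>x. f x + g x) (4 * (A + B))"
proof -
  note f = Lp_leD[OF assms(1)] and g = Lp_leD[OF assms(2)]
  have [measurable]: "f \<in> borel_measurable borel" "g \<in> borel_measurable borel" by (rule f(1), rule g(1))
  have pw: "(s + t) powr P \<le> 2 powr P * (s powr P + t powr P)" if "0 \<le> s" "0 \<le> t" for s t :: real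
  proof -
    have "(s + t) powr P \<le> (2 * max s t) powr P" using that P by (intro powr_mono2) auto
    also have "\<dots> = 2 powr P * max s t powr P" using that by (simp add: powr_mult)
    also have "max s t powr P \<le> s powr P + t powr P" by (cases "s \<le> t") (auto simp: max_def)
    finally show ?thesis by simp
  qed
  have "(\<integral>\<^sup>+x. ennreal ((f x + g x) powr P) \<partial>lborel) \<le>
     (\<integral>\<^sup>+x. ennreal (2 powr P) * (ennreal (f x powr P) + ennreal (g x powr P)) \<partial>lborel)"
    using pw f(2) g(2) by (intro nn_integral_mono) (simp flip: ennreal_plus ennreal_mult')
  also have "\<dots> = ennreal (2 powr P) * ((\<integral>\<^sup>+x. ennreal (f x powr P) \<partial>lborel) + (\<integral>\<^sup>+x. ennreal (g x powr P) \<partial>lborel))"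
    by (simp add: nn_integral_cmult nn_integral_add)
  also have "\<dots> \<le> ennreal (2 powr P) * (ennreal (A powr P) + ennreal (B powr P))"
    by (intro mult_left_mono add_mono f g) simp
  also have "\<dots> = ennreal (2 powr P * (A powr P + B powr P))"
    by (simp add: ennreal_mult' flip: ennreal_plus)
  also have "\<dots> \<le> ennreal ((4 * (A + B)) powr P)"
  proof (rule ennreal_leI)
    have "A powr P \<le> (A + B) powr P" "B powr P \<le> (A + B) powr P"
      using f(3) g(3) P by (auto intro: powr_mono2)
    moreover have "2 * (A + B) powr P \<le> 2 powr P * (A + B) powr P"
      using powr_mono[of 1 P 2] P by (intro mult_right_mono) auto
    ultimately have "A powr P + B powr P \<le> 2 powr P * (A + B) powr P" by linarith
    then have "2 powr P * (A powr P + B powr P) \<le> 2 powr P * (2 powr P * (A + B) powr P)"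
      by (intro mult_left_mono) auto
    also have "\<dots> = (2 * (2 * (A + B))) powr P"
      using f(3) g(3) by (simp only: powr_mult) 
    finally show "2 powr P * (A powr P + B powr P) \<le> (4 * (A + B)) powr P" by simp
  qed
  finally show ?thesis using f(2,3) g(2,3) by (simp add: Lp_le_def)
qed

lemma Lp_le_tensor:
  fixes f g :: "real \<Rightarrow> real"
  assumes "Lp_le P f A" and "Lp_le P g B"
  shows "Lp_le P (\<lambda>x::real ^ 2. f (x $ 1) * g (x $ 2)) (A * B)"
proof -
  note f = Lp_leD[OF assms(1)] and g = Lp_leD[OF assms(2)]
  have [measurable]: "f \<in> borel_measurable borel" "g \<in> borel_measurable borel" by (rule f(1), rule g(1))
  have "(\<integral>\<^sup>+x. ennreal ((f (x $ 1) * g (x $ 2)) powr P) \<partial>(lborel :: (real ^ 2) measure)) =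
     (\<integral>\<^sup>+x. ennreal (f (x $ 1) powr P) * ennreal (g (x $ 2) powr P) \<partial>(lborel :: (real ^ 2) measure))"
    using f(2) g(2) by (simp add: powr_mult ennreal_mult')
  also have "\<dots> = (\<integral>\<^sup>+x. ennreal (f x powr P) \<partial>lborel) * (\<integral>\<^sup>+x. ennreal (g x powr P) \<partial>lborel)"
    by (rule nn_integral_vec2) simp_all
  also have "\<dots> \<le> ennreal (A powr P) * ennreal (B powr P)" by (intro mult_mono f g) simp_all
  also have "\<dots> = ennreal ((A * B) powr P)" using f(3) g(3) by (simp add: powr_mult ennreal_mult')
  finally show ?thesis using f(2,3) g(2,3) by (simp add: Lp_le_def)
qed

text \<open>Interpolation between \<open>L\<^sub>\<infinity>\<close> and \<open>L\<^sub>1\<close>.\<close>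

lemma Lp_le_interpolate:
  fixes f :: "'a::euclidean_space \<Rightarrow> real"
  assumes [measurable]: "f \<in> borel_measurable borel" and f: "\<And>x. 0 \<le> f x" "\<And>x. f x \<le> K / N"
    and int: "(\<integral>\<^sup>+x. ennreal (f x) \<partial>lborel) \<le> ennreal (K / T)"
    and pos: "K > 0" "N > 0" "T > 0" and P: "P \<ge> 1"
  shows "Lp_le P f (K / N * (N / T) powr (1 / P))"
proof -
  have "f x powr P \<le> f x * (K / N) powr (P - 1)" for x
  proof (cases "f x = 0")
    case False
    then have fx: "f x > 0" using f(1)[of x] by simp
    then have "f x powr P = f x * f x powr (P - 1)" by (simp add: powr_mult_base)
    also have "\<dots> \<le> f x * (K / N) powr (P - 1)"
      using fx f P by (intro mult_left_mono powr_mono2) auto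
    finally show ?thesis .
  qed simp
  then have "(\<integral>\<^sup>+x. ennreal (f x powr P) \<partial>lborel) \<le> (\<integral>\<^sup>+x. ennreal (f x) * ennreal ((K / N) powr (P - 1)) \<partial>lborel)"
    using f by (intro nn_integral_mono) (simp flip: ennreal_mult')
  also have "\<dots> = (\<integral>\<^sup>+x. ennreal (f x) \<partial>lborel) * ennreal ((K / N) powr (P - 1))"
    by (simp add: nn_integral_multc)
  also have "\<dots> \<le> ennreal (K / T) * ennreal ((K / N) powr (P - 1))" by (intro mult_right_mono int) simp
  also have "\<dots> = ennreal (K / T * (K / N) powr (P - 1))"
    using pos by (intro ennreal_mult[symmetric]) auto
  also have "K / T * (K / N) powr (P - 1) = (K / N * (N / T) powr (1 / P)) powr P"
  proof -
    have "(K / N * (N / T) powr (1 / P)) powr P = (K / N) powr P * (N / T)"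
    proof -
      have "((N / T) powr (1 / P)) powr P = N / T" using pos P by (simp add: powr_powr)
      moreover have "(K / N * (N / T) powr (1 / P)) powr P = (K / N) powr P * ((N / T) powr (1 / P)) powr P"
        by (rule powr_mult)
      ultimately show ?thesis by simp
    qed
    also have "(K / N) powr P = K / N * (K / N) powr (P - 1)"
      using powr_mult_base[of "K / N" "P - 1"] pos by simp
    finally show ?thesis using pos by simp
  qed
  finally show ?thesis using f pos by (simp add: Lp_le_def)
qed

section \<open>Integrals and sums of peaks\<close>

lemma nn_integral_peak: "(\<integral>\<^sup>+x. ennreal (peak x) \<partial>lborel) = ennreal pi"
proof -
  have e: "peak = (\<lambda>x. inverse (1 + x\<^sup>2))" by (simp add: peak_def fun_eq_iff divide_inverse)
  have "(LINT x|lborel. peak x) = pi"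
    using LBINT_inverse_1_plus_square
    by (simp add: e interval_lebesgue_integral_def set_lebesgue_integral_def einterval_def)
  then show ?thesis
    using nn_integral_eq_integral[OF integrable_peak] peak_bounds by (simp add: less_imp_le)
qed

lemma nn_integral_peak_scaled:
  assumes "s > 0"
  shows "(\<integral>\<^sup>+x. ennreal (peak (s * (x - a))) \<partial>lborel) = ennreal (pi / s)"
proof -
  have "(\<integral>\<^sup>+x. ennreal (peak (s * (x - a))) \<partial>lborel) =
     ennreal \<bar>1 / s\<bar> * (\<integral>\<^sup>+x. ennreal (peak (s * ((a + 1 / s * x) - a))) \<partial>lborel)"
    using assms by (intro nn_integral_real_affine) auto
  also have "\<dots> = ennreal (1 / s) * ennreal pi"
    using assms by (simp add: nn_integral_peak)
  also have "\<dots> = ennreal (pi / s)" using assms by (simp flip: ennreal_mult')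
  finally show ?thesis .
qed

lemma Lp_le_peak_scaled:
  assumes "s > 0" and P: "P \<ge> 1"
  shows "Lp_le P (\<lambda>x. peak (s * (x - a))) (4 * (1 / s) powr (1 / P))"
proof -
  have "Lp_le P (\<lambda>x. peak (s * (x - a))) (4 / 1 * (1 / s) powr (1 / P))"
  proof (rule Lp_le_interpolate)
    show "0 \<le> peak (s * (x - a))" "peak (s * (x - a)) \<le> 4 / 1" for x
      using peak_bounds[of "s * (x - a)"] by auto
    show "(\<integral>\<^sup>+x. ennreal (peak (s * (x - a))) \<partial>lborel) \<le> ennreal (4 / s)"
      unfolding nn_integral_peak_scaled[OF assms(1)] using assms pi_less_4
      by (intro ennreal_leI divide_right_mono) auto
  qed (use assms in auto)
  then show ?thesis by simp
qed

lemma peak_arctan: "((\<lambda>z. - arctan (s * (x - z))) has_real_derivative s * peak (s * (x - z))) (at z within A)"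
proof -
  have "1 + (s * (x - z))\<^sup>2 \<noteq> 0" using zero_le_power2[of "s * (x - z)"] by linarith
  then show ?thesis
    by (auto intro!: derivative_eq_intros simp: peak_def divide_inverse)
qed

lemma peak_integral_arctan:
  assumes "a \<le> c"
  shows "((\<lambda>z. s * peak (s * (x - z))) has_integral (arctan (s * (x - a)) - arctan (s * (x - c)))) {a..c}"
  using fundamental_theorem_of_calculus[OF assms, of "\<lambda>z. - arctan (s * (x - z))" "\<lambda>z. s * peak (s * (x - z))"]
    peak_arctan by (simp add: has_real_derivative_iff_has_vector_derivative)

lemma arctan_diff_le: "arctan s - arctan t \<le> 4"
  using arctan_bounded[of s] arctan_bounded[of t] pi_less_4 by linarith

lemma continuous_on_peak_scaled: "continuous_on A (\<lambda>z. peak (s * (x - z)))"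
  by (intro continuous_on_compose2[OF continuous_on_peak[of UNIV]] continuous_intros) auto

text \<open>For \<open>\<bar>x\<bar> \<le> 2\<close> the mass of the rescaled peak, at most
  \<open>4\<close> by \<open>arctan\<close>, is compared with \<open>peak x \<ge> 1 / 5\<close>;
  this fixes the constant \<open>20\<close>. Farther away
  \<open>\<bar>x - z\<bar> \<ge> \<bar>x\<bar> / 2\<close>, and the factor \<open>s\<close> is
  offset by its square in the denominator.\<close>

lemma peak_integral_le:
  assumes s: "s \<ge> 1"
  shows "integral {0..1} (\<lambda>z. s * peak (s * (x - z))) \<le> 20 * peak x"
proof (cases "\<bar>x\<bar> \<le> 2")
  case True
  then have "x\<^sup>2 \<le> 2\<^sup>2" by (intro power2_le_iff_abs_le[THEN iffD2]) auto
  then have "1 + x\<^sup>2 \<le> 5" by simp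
  moreover have "1 + x\<^sup>2 > 0" using zero_le_power2[of x] by linarith
  ultimately have "4 \<le> 20 * peak x" by (simp add: peak_def field_simps)
  then show ?thesis
    using integral_unique[OF peak_integral_arctan[of 0 1 s x]] arctan_diff_le[of "s * (x - 0)" "s * (x - 1)"]
    by simp
next
  case False
  have x4: "x\<^sup>2 \<ge> 4" using False abs_le_square_iff[of 2 x] by simp
  show ?thesis
  proof (rule integral_le_const01)
    show "continuous_on {0..1} (\<lambda>z. s * peak (s * (x - z)))"
      by (intro continuous_intros continuous_on_peak_scaled)
    fix z :: real assume z: "z \<in> {0..1}"
    have "\<bar>x\<bar> - 1 \<le> \<bar>x - z\<bar>" using z by (auto simp: abs_if)
    then have "\<bar>x\<bar> / 2 \<le> \<bar>x - z\<bar>" using False by linarith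
    then have "(\<bar>x\<bar> / 2)\<^sup>2 \<le> \<bar>x - z\<bar>\<^sup>2" by (intro power_mono) auto
    then have sq: "x\<^sup>2 / 4 \<le> (x - z)\<^sup>2" by (simp add: power_divide)
    have "s * x\<^sup>2 \<le> s\<^sup>2 * x\<^sup>2" using s by (intro mult_right_mono) (auto simp: power2_eq_square)
    then have "s * (1 + x\<^sup>2) \<le> 20 * (1 + s\<^sup>2 * (x\<^sup>2 / 4))"
    proof -
      have "s * 4 \<le> s * x\<^sup>2" using x4 s by (intro mult_left_mono) auto
      then have "s * (1 + x\<^sup>2) \<le> 5 / 4 * (s * x\<^sup>2)" by (simp add: distrib_left)
      also have "\<dots> \<le> 5 / 4 * (s\<^sup>2 * x\<^sup>2)" using \<open>s * x\<^sup>2 \<le> s\<^sup>2 * x\<^sup>2\<close> by simp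
      also have "\<dots> \<le> 20 * (1 + s\<^sup>2 * (x\<^sup>2 / 4))" by (simp add: distrib_left)
      finally show ?thesis .
    qed
    also have "\<dots> \<le> 20 * (1 + s\<^sup>2 * (x - z)\<^sup>2)" using sq by (intro mult_left_mono add_left_mono) auto
    finally have "s * (1 + x\<^sup>2) \<le> 20 * (1 + (s * (x - z))\<^sup>2)" by (simp add: power_mult_distrib)
    moreover have "1 + x\<^sup>2 > 0" "1 + (s * (x - z))\<^sup>2 > 0"
      using zero_le_power2[of x] zero_le_power2[of "s * (x - z)"] by linarith+
    ultimately show "s * peak (s * (x - z)) \<le> 20 * peak x" by (simp add: peak_def field_simps)
  qed
qed

text \<open>Each term is at most three times the integral of the peak over a unit interval, by
  \<open>peak_shift\<close>; the integrals telescope to a difference of values of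
  \<open>arctan\<close>, at most \<open>4\<close>.\<close>

lemma sum_peak_le: "(\<Sum>v<M. peak (t - real v)) \<le> 12"
proof -
  have "peak (t - real v) \<le> 3 * (arctan (t - real v) - arctan (t - real (Suc v)))" for v
  proof -
    have i1: "((\<lambda>z. peak (t - z)) has_integral (arctan (t - real v) - arctan (t - real (Suc v)))) {real v..real (Suc v)}"
      using peak_integral_arctan[of "real v" "real (Suc v)" 1 t] by simp
    have i2: "((\<lambda>z::real. peak (t - real v) / 3) has_integral
        (real (Suc v) - real v) *\<^sub>R (peak (t - real v) / 3)) {real v..real (Suc v)}"
      using has_integral_const_real[of "peak (t - real v) / 3" "real v" "real (Suc v)"]
      by (simp only: measure_lborel_Icc of_nat_le_iff le_SucI[OF le_refl])
    have le: "peak (t - real v) / 3 \<le> peak (t - z)" if "z \<in> {real v..real (Suc v)}" for z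
      using peak_shift[of "t - real v" "t - z"] that by auto
    have "(real (Suc v) - real v) *\<^sub>R (peak (t - real v) / 3) \<le> arctan (t - real v) - arctan (t - real (Suc v))"
      by (rule has_integral_le[OF i2 i1 le])
    then show ?thesis by simp
  qed
  then have "(\<Sum>v<M. peak (t - real v)) \<le> (\<Sum>v<M. 3 * (arctan (t - real v) - arctan (t - real (Suc v))))"
    by (rule sum_mono)
  also have "\<dots> = 3 * (arctan (t - real 0) - arctan (t - real M))"
    using sum_lessThan_telescope'[of "\<lambda>v. arctan (t - real v)" M]
    by (simp only: sum_distrib_left[symmetric])
  also have "\<dots> \<le> 3 * 4" by (intro mult_left_mono arctan_diff_le) simp
  finally show ?thesis by simp
qed

lemma peak_mono:
  assumes "\<bar>s\<bar> \<le> \<bar>t\<bar>"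
  shows "peak t \<le> peak s"
proof -
  have "s\<^sup>2 \<le> t\<^sup>2" using assms by (simp add: abs_le_square_iff)
  moreover have "1 + s\<^sup>2 > 0" using zero_le_power2[of s] by linarith
  ultimately show ?thesis by (simp add: peak_def frac_le)
qed

lemma peak_divide:
  assumes "b \<ge> 1"
  shows "peak (t / b) \<le> b\<^sup>2 * peak t"
proof -
  have b2: "b\<^sup>2 \<ge> 1" using assms by (simp add: one_le_power)
  have p: "1 + t\<^sup>2 > 0" "1 + (t / b)\<^sup>2 > 0" using zero_le_power2[of t] zero_le_power2[of "t / b"] by linarith+
  have "1 + t\<^sup>2 \<le> b\<^sup>2 * (1 + (t / b)\<^sup>2)" using b2 assms by (simp add: power_divide distrib_left)
  then show ?thesis using p by (simp add: peak_def field_simps)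
qed

text \<open>Replaces a point of a cell of length \<open>1 / M\<close> by the cell. The slack
  \<open>b\<close> lets \<open>M\<close> exceed \<open>D\<close> by one step in the powers of
  \<open>b\<close>.\<close>

lemma peak_cell:
  assumes b: "b \<ge> 1" and D: "M \<le> b * D" "D > 0" "M > 0" and z: "\<bar>M * z - v\<bar> \<le> 1"
  shows "peak (D * (x - z)) \<le> 3 * b\<^sup>2 * peak (M * x - v)"
proof -
  have "peak (D * (x - z)) \<le> peak (M * (x - z) / b)"
  proof (rule peak_mono)
    have "M / b \<le> D" using D b by (simp add: divide_le_eq mult.commute)
    then have "M / b * \<bar>x - z\<bar> \<le> D * \<bar>x - z\<bar>" by (rule mult_right_mono) simp
    then show "\<bar>M * (x - z) / b\<bar> \<le> \<bar>D * (x - z)\<bar>" using b D by (simp add: abs_mult)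
  qed
  also have "\<dots> \<le> b\<^sup>2 * peak (M * (x - z))" by (rule peak_divide[OF b])
  also have "\<dots> \<le> b\<^sup>2 * (3 * peak (M * x - v))"
    using z by (intro mult_left_mono peak_shift) (auto simp: algebra_simps)
  finally show ?thesis by simp
qed

text \<open>The sum is bounded because every elementary \<open>b\<close>-adic box of volume \<open>b\<^sup>-\<^sup>n\<close> contains exactly one
  point; \<open>e = 1\<close> covers the reflected points.\<close>

lemma net_overlap:
  assumes b: "b \<ge> 2" and \<pi>: "\<And>j. bij_betw (\<pi> j) {..<b} {..<b}"
    and D: "D1 \<ge> 1" "D2 \<ge> 1" "D1 * D2 \<ge> real b ^ n" and e: "e = 0 \<or> e = 1"
  shows "(\<Sum>u<b ^ n. peak (D1 * (x - (real u + e) / real b ^ n)) * peak (D2 * (y - radinv b \<pi> n u)))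
    \<le> 1296 * real b ^ 4"
proof -
  have b0: "b > 0" "real b \<ge> 1" using b by auto
  \<comment> \<open>The cell has area exactly \<open>b^-n\<close> and is, up to a factor
    \<open>b\<close>, no finer than the kernel widths. If \<open>D1\<close> nearly resolves the
    finest scale, all digits go to the first coordinate.\<close>
  obtain i k where ik: "n = k + i" "real b ^ k \<le> real b * D1" "real b ^ i \<le> real b * D2"
  proof (cases "real b ^ n \<le> real b * D1")
    case True
    moreover have "1 * 1 \<le> real b * D2" using b0 D by (intro mult_mono) auto
    ultimately show thesis using that[of n 0] by simp
  next
    case False
    have "nat \<lfloor>D1\<rfloor> \<ge> 1" using D by linarith
    then obtain k where k: "b ^ k \<le> nat \<lfloor>D1\<rfloor>" "nat \<lfloor>D1\<rfloor> < b ^ (k + 1)"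
      using ex_power_ivl1[OF b] by blast
    have k1: "real b ^ k \<le> D1"
    proof -
      have "real (b ^ k) \<le> real (nat \<lfloor>D1\<rfloor>)" using k(1) by linarith
      also have "\<dots> \<le> D1" using D by linarith
      finally show ?thesis by simp
    qed
    have k2: "D1 < real b ^ (k + 1)"
    proof -
      have "real (nat \<lfloor>D1\<rfloor>) + 1 \<le> real (b ^ (k + 1))" using k(2) by linarith
      then show ?thesis using D by simp linarith
    qed
    have "real b ^ (k + 1) \<le> real b * D1" using k1 b0 by simp
    then have "real b ^ (k + 1) < real b ^ n" using False by linarith
    then have "k + 1 < n" by (rule power_less_imp_less_exp[rotated]) (use b in simp)
    then obtain i where i: "n = (k + 1) + i" using less_imp_add_positive by blast
    have "real b ^ (k + 1) * real b ^ i \<le> D1 * D2" using D(3) i by (simp add: power_add)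
    also have "\<dots> \<le> real b ^ (k + 1) * D2" using k2 D by (intro mult_right_mono) auto
    finally have "real b ^ i \<le> D2" using b0 by simp
    also have "\<dots> \<le> real b * D2" using b0 D by simp
    finally show thesis using that[of "k + 1" i] i k1 b0 by simp
  qed
  have pos: "real b ^ k > 0" "real b ^ i > 0" using b0 by auto
  have \<pi>lt: "\<pi> j c < b" if "c < b" for j c using bij_betwE[OF \<pi>[of j]] that by auto
  define \<rho> where "\<rho> w = radinv b (\<lambda>t. \<pi> (k + t)) i w" for w
  have bn: "b ^ n = b ^ k * b ^ i" by (simp add: ik(1) power_add)
  \<comment> \<open>The majorant is a factor in \<open>q\<close> times a factor in \<open>w\<close>,
    so the double sum becomes a product. Each factor contributes \<open>3 * b^2\<close> from
    \<open>peak_cell\<close> and \<open>12\<close> from \<open>sum_peak_le\<close>, and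
    \<open>36^2 = 1296\<close>.\<close>
  have cell: "peak (D1 * (x - (real (q * b ^ i + w) + e) / real b ^ n)) * peak (D2 * (y - radinv b \<pi> n (q * b ^ i + w)))
     \<le> (3 * (real b)\<^sup>2 * peak (real b ^ k * x - real q)) * (3 * (real b)\<^sup>2 * peak (real b ^ i * y - real b ^ i * \<rho> w))"
    if w: "w < b ^ i" for q w
  proof (rule mult_mono)
    have "real (w + 1) \<le> real (b ^ i)" using w by (intro of_nat_mono) simp
    then have "real w + 1 \<le> real b ^ i" by simp
    then have "0 \<le> real w + e" "real w + e \<le> real b ^ i" using e by linarith+
    then have wo: "0 \<le> (real w + e) / real b ^ i" "(real w + e) / real b ^ i \<le> 1"
      using pos by (auto simp: divide_le_eq)
    have N: "real b ^ n = real b ^ k * real b ^ i" by (simp add: ik(1) power_add)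
    have "real b ^ k * ((real (q * b ^ i + w) + e) / real b ^ n) = real q + (real w + e) / real b ^ i"
    proof -
      have g: "A * ((t * B + s) / (A * B)) = t + s / B" if "A > 0" "B > 0" for A B t s :: real
        using that by (simp add: field_simps)
      have h: "real (q * b ^ i + w) + e = real q * real b ^ i + (real w + e)" by simp
      show ?thesis unfolding N h by (rule g[OF pos])
    qed
    then have z1: "\<bar>real b ^ k * ((real (q * b ^ i + w) + e) / real b ^ n) - real q\<bar> \<le> 1"
      using wo by linarith
    show "peak (D1 * (x - (real (q * b ^ i + w) + e) / real b ^ n)) \<le> 3 * (real b)\<^sup>2 * peak (real b ^ k * x - real q)"
      by (rule peak_cell[OF b0(2) ik(2) _ pos(1) z1]) (use D in linarith)
    have dm: "(q * b ^ i + w) mod b ^ i = w" "(q * b ^ i + w) div b ^ i = q" using w b0 by auto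
    have "radinv b \<pi> n (q * b ^ i + w) = \<rho> w + radinv b \<pi> k q / real b ^ i"
      unfolding ik(1) radinv_split[OF b0(1)] dm \<rho>_def ..
    then have "real b ^ i * radinv b \<pi> n (q * b ^ i + w) = real b ^ i * \<rho> w + radinv b \<pi> k q"
      using pos(2) by (simp only: distrib_left) simp
    moreover have "0 \<le> radinv b \<pi> k q \<and> radinv b \<pi> k q < 1" by (rule radinv_bounds[OF b0(1) \<pi>lt])
    ultimately have z2: "\<bar>real b ^ i * radinv b \<pi> n (q * b ^ i + w) - real b ^ i * \<rho> w\<bar> \<le> 1"
      by linarith
    show "peak (D2 * (y - radinv b \<pi> n (q * b ^ i + w))) \<le> 3 * (real b)\<^sup>2 * peak (real b ^ i * y - real b ^ i * \<rho> w)"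
      by (rule peak_cell[OF b0(2) ik(3) _ pos(2) z2]) (use D in linarith)
    show "0 \<le> 3 * (real b)\<^sup>2 * peak (real b ^ k * x - real q)"
      using less_imp_le[OF peak_bounds(1)] by simp
    show "0 \<le> peak (D2 * (y - radinv b \<pi> n (q * b ^ i + w)))"
      by (rule less_imp_le[OF peak_bounds(1)])
  qed
  have "(\<Sum>u<b ^ n. peak (D1 * (x - (real u + e) / real b ^ n)) * peak (D2 * (y - radinv b \<pi> n u)))
     = (\<Sum>q<b ^ k. \<Sum>w<b ^ i. peak (D1 * (x - (real (q * b ^ i + w) + e) / real b ^ n)) * peak (D2 * (y - radinv b \<pi> n (q * b ^ i + w))))"
    by (subst bn) (rule sum_lessThan_mult)
  also have "\<dots> \<le> (\<Sum>q<b ^ k. \<Sum>w<b ^ i. (3 * (real b)\<^sup>2 * peak (real b ^ k * x - real q)) * (3 * (real b)\<^sup>2 * peak (real b ^ i * y - real b ^ i * \<rho> w)))"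
    by (intro sum_mono cell) auto
  also have "\<dots> = (\<Sum>q<b ^ k. 3 * (real b)\<^sup>2 * peak (real b ^ k * x - real q)) * (\<Sum>w<b ^ i. 3 * (real b)\<^sup>2 * peak (real b ^ i * y - real b ^ i * \<rho> w))"
    by (rule sum_product[symmetric])
  also have "(\<Sum>w<b ^ i. 3 * (real b)\<^sup>2 * peak (real b ^ i * y - real b ^ i * \<rho> w)) = 3 * (real b)\<^sup>2 * (\<Sum>v<b ^ i. peak (real b ^ i * y - real v))"
    unfolding \<rho>_def sum_radinv[OF b0(1) \<pi>, of "\<lambda>t. 3 * (real b)\<^sup>2 * peak (real b ^ i * y - real b ^ i * t)"]
    using pos by (simp add: sum_distrib_left)
  also have "(\<Sum>q<b ^ k. 3 * (real b)\<^sup>2 * peak (real b ^ k * x - real q)) = 3 * (real b)\<^sup>2 * (\<Sum>q<b ^ k. peak (real b ^ k * x - real q))"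
    by (simp add: sum_distrib_left)
  also have "3 * (real b)\<^sup>2 * (\<Sum>q<b ^ k. peak (real b ^ k * x - real q)) * (3 * (real b)\<^sup>2 * (\<Sum>v<b ^ i. peak (real b ^ i * y - real v)))
     \<le> (3 * (real b)\<^sup>2 * 12) * (3 * (real b)\<^sup>2 * 12)"
  proof -
    have pos0: "0 \<le> (\<Sum>v<M. peak (t - real v))" for M t
      by (rule sum_nonneg) (rule less_imp_le[OF peak_bounds(1)])
    have mm: "c * S * (c * S') \<le> (c * 12) * (c * 12)"
      if "0 \<le> c" "0 \<le> S" "S \<le> 12" "0 \<le> S'" "S' \<le> 12" for c S S' :: real
      by (intro mult_mono mult_left_mono mult_nonneg_nonneg that) simp_all
    show ?thesis by (rule mm[OF _ pos0 sum_peak_le pos0 sum_peak_le]) simp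
  qed
  finally show ?thesis by (simp add: power4_eq_xxxx power2_eq_square mult_ac)
qed

section \<open>Norms of the frequency blocks\<close>

text \<open>Size in \<open>L_p\<close> of the grid error of an antiderivative at scale
  \<open>2 ^ d\<close>: remainder and boundary jump while the grid resolves the scale, afterwards
  grid mean and integral separately.\<close>

definition mean_rate :: "real \<Rightarrow> real \<Rightarrow> nat \<Rightarrow> real" where
  "mean_rate P N d = (if 2 ^ d \<le> N then 1 / N * (2 ^ d / N + (1 / 2 ^ d) powr (1 / P))
     else 1 / N * (N / 2 ^ d) powr (1 / P) + 1 / 2 ^ d)"

text \<open>The output of \<open>kernel_family\<close>; the estimates below depend on the cutoff
  only through \<open>C\<close>.\<close>

locale kernel_bounds =
  fixes k :: "nat \<Rightarrow> real \<Rightarrow> complex" and H :: "nat \<Rightarrow> real \<Rightarrow> real \<Rightarrow> complex"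
    and k' :: "nat \<Rightarrow> real \<Rightarrow> complex" and C :: real
  assumes C: "C > 0"
    and H_C1: "\<And>d x. C1_fun (H d x) (\<lambda>z. - k d (x - z))"
    and k_C1: "\<And>d x. C1_fun (\<lambda>z. - k d (x - z)) (\<lambda>z. k' d (x - z))"
    and H_le: "\<And>d x z. z \<in> {0..1} \<Longrightarrow> norm (H d x z) \<le> C * peak (2 ^ d * (x - z))"
    and k_le: "\<And>d w. norm (k d w) \<le> C * 2 ^ d * peak (2 ^ d * w)"
    and k'_le: "\<And>d w. norm (k' d w) \<le> C * 4 ^ d * peak (2 ^ d * w)"
begin

text \<open>Majorant of the integrals in \<open>integral_bounds\<close> and, by
  \<open>H_sup\<close>, of the values of \<open>H\<close>; \<open>20\<close> is the constant of
  \<open>peak_integral_le\<close>.\<close>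

definition X :: "real \<Rightarrow> real" where "X x = 20 * C * peak x"

text \<open>Majorant of the boundary values of \<open>H\<close>. It is concentrated near the two
  ends, so that its \<open>L_p\<close> norm, unlike that of \<open>X\<close>, decays like
  \<open>2 powr (- d / P)\<close>.\<close>

definition \<beta> :: "nat \<Rightarrow> real \<Rightarrow> real" where
  "\<beta> d x = C * (peak (2 ^ d * (x - 1)) + peak (2 ^ d * (x - 0)))"

lemma X_nonneg: "X x \<ge> 0" using C peak_bounds[of x] by (simp add: X_def less_imp_le)

lemma \<beta>_nonneg: "\<beta> d x \<ge> 0"
  using C peak_bounds by (simp add: \<beta>_def less_imp_le)

lemma norm_integral_peak_le:
  assumes c: "continuous_on {0..1} f" and f: "\<And>z. z \<in> {0..1} \<Longrightarrow> norm (f z) \<le> a * peak (2 ^ d * (x - z))" and a: "a \<ge> 0"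
  shows "integral {0..1} (\<lambda>z. norm (f z)) \<le> a / 2 ^ d * (20 * peak x)"
proof -
  have "integral {0..1} (\<lambda>z. norm (f z)) \<le> integral {0..1} (\<lambda>z. a / 2 ^ d * (2 ^ d * peak (2 ^ d * (x - z))))"
    using f by (intro Henstock_Kurzweil_Integration.integral_le integrable_continuous_real continuous_intros
        c continuous_on_peak_scaled) auto
  also have "\<dots> = a / 2 ^ d * integral {0..1} (\<lambda>z. 2 ^ d * peak (2 ^ d * (x - z)))"
    by (rule integral_mult_right)
  also have "\<dots> \<le> a / 2 ^ d * (20 * peak x)"
    using a by (intro mult_left_mono peak_integral_le) auto
  finally show ?thesis .
qed

lemma integral_bounds:
  "integral {0..1} (\<lambda>z. norm (H d x z)) \<le> X x / 2 ^ d"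
  "integral {0..1} (\<lambda>z. norm (- k d (x - z))) \<le> X x"
  "integral {0..1} (\<lambda>z. norm (k' d (x - z))) \<le> 2 ^ d * X x"
proof -
  have p4: "(4::real) ^ d = 2 ^ d * 2 ^ d" by (simp flip: power_mult_distrib)
  show "integral {0..1} (\<lambda>z. norm (H d x z)) \<le> X x / 2 ^ d"
    using norm_integral_peak_le[OF C1_funD(2)[OF H_C1] H_le less_imp_le[OF C]] by (simp add: X_def mult_ac)
  show "integral {0..1} (\<lambda>z. norm (- k d (x - z))) \<le> X x"
    using norm_integral_peak_le[OF C1_funD(2)[OF k_C1], where a = "C * 2 ^ d" and d = d and x = x] k_le[of d] C by (simp add: X_def mult_ac)
  show "integral {0..1} (\<lambda>z. norm (k' d (x - z))) \<le> 2 ^ d * X x"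
    using norm_integral_peak_le[OF C1_funD(3)[OF k_C1], where a = "C * 4 ^ d" and d = d and x = x] k'_le[of d] C by (simp add: X_def p4 mult_ac)
qed

lemma H_sup:
  assumes z: "z \<in> {0..1}" shows "norm (H d x z) \<le> X x"
proof -
  have "peak (2 ^ d * (x - z)) \<le> peak (x - z)"
  proof (rule peak_mono)
    have "1 * \<bar>x - z\<bar> \<le> 2 ^ d * \<bar>x - z\<bar>" by (intro mult_right_mono) auto
    then show "\<bar>x - z\<bar> \<le> \<bar>2 ^ d * (x - z)\<bar>" by (simp add: abs_mult)
  qed
  also have "\<dots> \<le> 3 * peak x" using z by (intro peak_shift) auto
  finally have "C * peak (2 ^ d * (x - z)) \<le> C * (3 * peak x)" using C by (intro mult_left_mono) auto
  also have "\<dots> \<le> X x" using C peak_bounds[of x] by (simp add: X_def)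
  finally show ?thesis using H_le[OF z, of d x] by linarith
qed

lemma H_jump: "norm (H d x 1 - H d x 0) \<le> \<beta> d x"
proof -
  have "norm (H d x 1 - H d x 0) \<le> norm (H d x 1) + norm (H d x 0)" by (rule norm_triangle_ineq4)
  also have "\<dots> \<le> \<beta> d x" using H_le[of 1 d x] H_le[of 0 d x] by (simp add: \<beta>_def distrib_left)
  finally show ?thesis .
qed

lemma measurable_X [measurable]: "X \<in> borel_measurable borel"
  unfolding X_def[abs_def] by simp

lemma measurable_\<beta> [measurable]: "\<beta> d \<in> borel_measurable borel"
  unfolding \<beta>_def[abs_def] by simp

lemma Lp_le_X: "P \<ge> 1 \<Longrightarrow> Lp_le P X (80 * C)"
  using Lp_le_cmult[OF Lp_le_peak_scaled[of 1 P 0], of "20 * C"] C by (simp add: X_def[abs_def])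

lemma Lp_le_\<beta>: "P \<ge> 1 \<Longrightarrow> Lp_le P (\<beta> d) (32 * C * (1 / 2 ^ d) powr (1 / P))"
  using Lp_le_cmult[OF Lp_le_add[OF Lp_le_peak_scaled[of "2 ^ d" P 1] Lp_le_peak_scaled[of "2 ^ d" P 0]], of C] C
  unfolding \<beta>_def[abs_def] by (simp add: mult_ac)

lemma norm_H1: "norm (H d x 1) \<le> \<beta> d x"
  using H_le[of 1 d x] mult_pos_pos[OF C peak_bounds(1)[of "2 ^ d * (x - 0)"]] by (simp add: \<beta>_def distrib_left)

definition mean_error :: "nat \<Rightarrow> nat \<Rightarrow> nat \<Rightarrow> real \<Rightarrow> real" where
  "mean_error b n d x =
    (if 2 ^ d \<le> real b ^ n then 1 / real b ^ n * (2 * (2 ^ d / real b ^ n) * X x + \<beta> d x)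
     else C / real b ^ n * (\<Sum>v<b ^ n. peak (2 ^ d * (x - real v / real b ^ n))) + 1 / 2 ^ d * X x)"

lemma mean_error_bound:
  assumes b: "b > 0"
  shows "norm (fold_average b (H d x) n 0 - integral {0..1} (H d x)) \<le> mean_error b n d x"
proof (cases "2 ^ d \<le> real b ^ n")
  case True
  let ?N = "real b ^ n"
  have N: "?N > 0" using b by simp
  note Cs = H_C1[of d x] k_C1[of d x]
  let ?R = "fold_remainder b (H d x) n 0"
  have "fold_average b (H d x) n 0 - integral {0..1} (H d x) = ?R - of_real (1 / (2 * ?N)) * (H d x 1 - H d x 0)"
    by (simp add: fold_remainder_def)
  then have "norm (fold_average b (H d x) n 0 - integral {0..1} (H d x)) \<le> norm ?R + norm (of_real (1 / (2 * ?N)) * (H d x 1 - H d x 0))"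
    by (simp only: norm_triangle_ineq4)
  moreover have "norm (of_real (1 / (2 * ?N)) * (H d x 1 - H d x 0)) = 1 / (2 * ?N) * norm (H d x 1 - H d x 0)"
    by (simp only: norm_mult norm_of_real) simp
  moreover have "1 / (2 * ?N) * norm (H d x 1 - H d x 0) \<le> 1 / ?N * \<beta> d x"
    using N by (intro mult_mono H_jump) (auto simp: frac_le)
  moreover have "norm ?R \<le> 2 * X x / ?N * min 1 (2 ^ d / ?N)"
    by (rule fold_remainder_bounds(3)[OF b Cs integral_bounds(2,3)]) simp
  moreover have "2 * X x / ?N * min 1 (2 ^ d / ?N) \<le> 2 * X x / ?N * (2 ^ d / ?N)"
    using X_nonneg[of x] N by (intro mult_left_mono) auto
  ultimately show ?thesis using True by (simp add: mean_error_def algebra_simps)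
next
  case False
  let ?N = "real b ^ n"
  have N: "?N > 0" using b by simp
  have "norm (fold_average b (H d x) n 0) = norm (\<Sum>v<b ^ n. H d x (real v / ?N)) / ?N"
    by (simp add: fold_average_def norm_divide norm_power)
  also have "\<dots> \<le> (\<Sum>v<b ^ n. C * peak (2 ^ d * (x - real v / ?N))) / ?N"
  proof (intro divide_right_mono sum_norm_le)
    fix v assume "v \<in> {..<b ^ n}"
    then have "real v \<le> real (b ^ n)" by (intro of_nat_mono) simp
    then show "norm (H d x (real v / ?N)) \<le> C * peak (2 ^ d * (x - real v / ?N))"
      using N by (intro H_le) (auto simp: divide_le_eq)
  qed (use N in simp)
  finally have 1: "norm (fold_average b (H d x) n 0) \<le> C / ?N * (\<Sum>v<b ^ n. peak (2 ^ d * (x - real v / ?N)))"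
    by (simp only: sum_distrib_left[symmetric]) simp
  have "norm (integral {0..1} (H d x)) \<le> integral {0..1} (\<lambda>z. norm (H d x z))"
    by (intro integral_norm_bound_integral integrable_continuous_real C1_funD[OF H_C1]) auto
  then have 2: "norm (integral {0..1} (H d x)) \<le> 1 / 2 ^ d * X x" using integral_bounds(1)[of d x] by simp
  have "norm (fold_average b (H d x) n 0 - integral {0..1} (H d x)) \<le> norm (fold_average b (H d x) n 0) + norm (integral {0..1} (H d x))"
    by (rule norm_triangle_ineq4)
  with 1 2 show ?thesis using False unfolding mean_error_def by (simp only: if_False)
qed

lemma mean_error_measurable [measurable]: "mean_error b n d \<in> borel_measurable borel"
  unfolding mean_error_def[abs_def] by simp

text \<open>In the unresolved case the peaks are narrower than the mesh: their sum stays below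
  \<open>12\<close> while its integral is small, and interpolation between the two gives the
  bound.\<close>

lemma Lp_le_mean_error:
  assumes b: "b > 0" and P: "P \<ge> 1"
  shows "Lp_le P (mean_error b n d) (800 * (C + 1) * mean_rate P (real b ^ n) d)"
proof (cases "2 ^ d \<le> real b ^ n")
  case True
  let ?N = "real b ^ n"
  have N: "?N > 0" using b by simp
  have "Lp_le P (\<lambda>x. 1 / ?N * (2 * (2 ^ d / ?N) * X x + \<beta> d x))
     (1 / ?N * (4 * (2 * (2 ^ d / ?N) * (80 * C) + 32 * C * (1 / 2 ^ d) powr (1 / P))))"
    using N P by (intro Lp_le_cmult Lp_le_add Lp_le_X Lp_le_\<beta>) auto
  then show ?thesis
  proof (rule Lp_le_mono)
    have "4 * (2 * (2 ^ d / ?N) * (80 * C) + 32 * C * (1 / 2 ^ d) powr (1 / P)) \<le>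
       800 * (C + 1) * (2 ^ d / ?N + (1 / 2 ^ d) powr (1 / P))"
    proof -
      have "640 * C * t + 128 * C * s \<le> 800 * (C + 1) * (t + s)" if "t \<ge> 0" "s \<ge> 0" for t s
      proof -
        have "640 * (C * t) + 128 * (C * s) \<le> 800 * (C * t) + 800 * (C * s) + 800 * t + 800 * s"
          using that C by simp
        then show ?thesis by (simp add: algebra_simps)
      qed
      from this[of "2 ^ d / ?N" "(1 / 2 ^ d) powr (1 / P)"] show ?thesis using N by (simp add: mult_ac)
    qed
    from mult_left_mono[OF this, of "1 / ?N"] N
    show "1 / ?N * (4 * (2 * (2 ^ d / ?N) * (80 * C) + 32 * C * (1 / 2 ^ d) powr (1 / P))) \<le> 800 * (C + 1) * mean_rate P ?N d"
      using True by (simp add: mean_rate_def mult_ac)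
  qed (use True N X_nonneg \<beta>_nonneg P in \<open>auto simp: mean_error_def\<close>)
next
  case False
  let ?N = "real b ^ n"
  have N: "?N > 0" using b by simp
  have p0: "0 \<le> peak t" for t using peak_bounds[of t] by simp
  let ?V = "\<lambda>x. 1 / ?N * (\<Sum>v<b ^ n. peak (2 ^ d * (x - real v / ?N)))"
  have V: "Lp_le P ?V (12 / ?N * (?N / 2 ^ d) powr (1 / P))"
  proof (rule Lp_le_interpolate)
    show "?V \<in> borel_measurable borel" by simp
    show "0 \<le> ?V x" for x using N by (intro mult_nonneg_nonneg sum_nonneg p0) auto
    show "?V x \<le> 12 / ?N" for x
    proof -
      have "(\<Sum>v<b ^ n. peak (2 ^ d * (x - real v / ?N))) \<le> (\<Sum>v<b ^ n. peak (?N * x - real v))"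
      proof (intro sum_mono peak_mono)
        fix v
        have e: "?N * x - real v = ?N * (x - real v / ?N)" using N by (simp add: right_diff_distrib)
        have "?N * \<bar>x - real v / ?N\<bar> \<le> 2 ^ d * \<bar>x - real v / ?N\<bar>" using False by (intro mult_right_mono) auto
        then show "\<bar>?N * x - real v\<bar> \<le> \<bar>2 ^ d * (x - real v / ?N)\<bar>"
          unfolding e abs_mult using N by simp
      qed
      also have "\<dots> \<le> 12" by (rule sum_peak_le)
      finally show ?thesis using N by (simp add: divide_right_mono)
    qed
    have "(\<integral>\<^sup>+x. ennreal (?V x) \<partial>lborel) = (\<integral>\<^sup>+x. ennreal (1 / ?N) * (\<Sum>v<b ^ n. ennreal (peak (2 ^ d * (x - real v / ?N)))) \<partial>lborel)"
      using N p0 by (intro nn_integral_cong) (simp add: sum_ennreal sum_nonneg flip: ennreal_mult')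
    also have "\<dots> = ennreal (1 / ?N) * (\<Sum>v<b ^ n. ennreal (pi / 2 ^ d))"
      by (simp add: nn_integral_cmult nn_integral_sum nn_integral_peak_scaled)
    also have "\<dots> = ennreal (1 / ?N * (?N * (pi / 2 ^ d)))"
      using N pi_gt_zero by (simp add: sum_ennreal flip: ennreal_mult' del: sum_constant) simp
    also have "\<dots> \<le> ennreal (12 / 2 ^ d)"
      using N pi_less_4 by (intro ennreal_leI) (simp add: divide_right_mono)
    finally show "(\<integral>\<^sup>+x. ennreal (?V x) \<partial>lborel) \<le> ennreal (12 / 2 ^ d)" .
  qed (use N P in auto)
  have "Lp_le P (\<lambda>x. C * ?V x + 1 / 2 ^ d * X x) (4 * (C * (12 / ?N * (?N / 2 ^ d) powr (1 / P)) + 1 / 2 ^ d * (80 * C)))"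
    using C P by (intro Lp_le_add Lp_le_cmult V Lp_le_X) auto
  then show ?thesis
  proof (rule Lp_le_mono)
    have "48 * (C * t) + 320 * (C * s) \<le> 800 * (C * t) + 800 * (C * s) + 800 * t + 800 * s" if "t \<ge> 0" "s \<ge> 0" for t s
      using that C by simp
    from this[of "1 / ?N * (?N / 2 ^ d) powr (1 / P)" "1 / 2 ^ d"]
    show "4 * (C * (12 / ?N * (?N / 2 ^ d) powr (1 / P)) + 1 / 2 ^ d * (80 * C)) \<le> 800 * (C + 1) * mean_rate P ?N d"
      using False N by (simp add: mean_rate_def algebra_simps)
  next
    show "0 \<le> mean_error b n d x" for x
      using False N C p0 X_nonneg by (auto simp: mean_error_def intro!: add_nonneg_nonneg sum_nonneg divide_nonneg_nonneg mult_nonneg_nonneg)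
  qed (use False N P in \<open>auto simp: mean_error_def\<close>)
qed

end

section \<open>The two-dimensional quadrature error\<close>

lemma peak_minus [simp]: "peak (- t) = peak t"
  by (simp add: peak_def)

text \<open>Size in \<open>L_p\<close> of the quadrature error for \<open>H d1\<close> and
  \<open>H d2\<close>: the first case follows \<open>quadrature_bound\<close>, the second
  \<open>net_overlap\<close> with interpolation.\<close>

definition main_rate :: "real \<Rightarrow> real \<Rightarrow> nat \<Rightarrow> nat \<Rightarrow> real" where
  "main_rate P N d1 d2 = (if 2 ^ (d1 + d2) \<le> N
     then 1 / N * (sqrt (2 ^ (d1 + d2) / N) + (1 / 2 ^ d1) powr (1 / P) + (1 / 2 ^ d2) powr (1 / P))
     else 1 / N * (N / 2 ^ (d1 + d2)) powr (1 / P) + 1 / 2 ^ (d1 + d2))"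

text \<open>Adds the grid errors multiplied by boundary values of \<open>H\<close> that
  \<open>sym_average_shift\<close> produces.\<close>

definition block_rate :: "real \<Rightarrow> real \<Rightarrow> nat \<Rightarrow> nat \<Rightarrow> real" where
  "block_rate P N d1 d2 = main_rate P N d1 d2 + (1 / 2 ^ d1) powr (1 / P) * mean_rate P N d2
     + mean_rate P N d1 * (1 / 2 ^ d2) powr (1 / P)"

lemma reflected_node: "u < M \<Longrightarrow> 1 - (real u + 1) / real M = real (M - Suc u) / real M"
proof -
  assume u: "u < M"
  then have "real (M - Suc u) = real M - (real u + 1)" by (simp add: of_nat_diff)
  then show ?thesis using u by (simp add: diff_divide_distrib)
qed

definition sym_average :: "nat \<Rightarrow> nat \<Rightarrow> (nat \<Rightarrow> nat \<Rightarrow> nat) \<Rightarrow> (real \<Rightarrow> complex) \<Rightarrow> (real \<Rightarrow> complex) \<Rightarrow> complex" where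
  "sym_average b n \<pi> F G = ((\<Sum>u<b ^ n. F (real u / real b ^ n) * G (radinv b \<pi> n u)) +
     (\<Sum>u<b ^ n. F (1 - (real u + 1) / real b ^ n) * G (radinv b \<pi> n u))) / of_real (2 * real b ^ n)"

text \<open>A constant in one factor leaves a mean over the other coordinate, and each half of the
  point set projects onto the full grid in both coordinates; for the reflected half the nodes are
  only reversed. Subtracting constants therefore costs one-dimensional errors only.\<close>

lemma sym_average_shift:
  assumes b: "b > 0" and \<pi>: "\<And>j. bij_betw (\<pi> j) {..<b} {..<b}"
  shows "sym_average b n \<pi> (\<lambda>t. F t - p) (\<lambda>t. G t - q) - (I - p) * (J - q) =
    (sym_average b n \<pi> F G - I * J) - p * (fold_average b G n 0 - J) - q * (fold_average b F n 0 - I)"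
proof -
  let ?N = "of_nat b ^ n :: complex"
  have N: "?N \<noteq> 0" using b by simp
  have SG: "(\<Sum>u<b ^ n. G (radinv b \<pi> n u)) = ?N * fold_average b G n 0"
  proof -
    have "(\<Sum>u<b ^ n. G (radinv b \<pi> n u)) = (\<Sum>v<b ^ n. G (real v / real b ^ n))"
      by (rule sum_radinv[OF b \<pi>])
    then show ?thesis using N by (simp add: fold_average_def)
  qed
  have SF: "(\<Sum>u<b ^ n. F (real u / real b ^ n)) = ?N * fold_average b F n 0"
    using N by (simp add: fold_average_def)
  have SF': "(\<Sum>u<b ^ n. F (1 - (real u + 1) / real b ^ n)) = ?N * fold_average b F n 0"
  proof -
    have "(\<Sum>u<b ^ n. F (1 - (real u + 1) / real b ^ n)) = (\<Sum>u<b ^ n. F (real (b ^ n - Suc u) / real b ^ n))"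
      using reflected_node[of _ "b ^ n"] by (intro sum.cong) auto
    also have "\<dots> = (\<Sum>u<b ^ n. F (real u / real b ^ n))" by (rule sum.nat_diff_reindex)
    finally show ?thesis by (simp only: SF)
  qed
  have e: "(\<Sum>u<b ^ n. (f u - p) * (g u - q)) = (\<Sum>u<b ^ n. f u * g u) - p * (\<Sum>u<b ^ n. g u) - q * (\<Sum>u<b ^ n. f u) + ?N * (p * q)"
    for f g :: "nat \<Rightarrow> complex"
    by (simp add: algebra_simps sum.distrib sum_subtractf sum_distrib_left)
  have "sym_average b n \<pi> (\<lambda>t. F t - p) (\<lambda>t. G t - q) =
     sym_average b n \<pi> F G - p * fold_average b G n 0 - q * fold_average b F n 0 + p * q"
    unfolding sym_average_def e SG SF SF' using N by (simp add: field_simps)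
  then show ?thesis by (simp add: algebra_simps)
qed

context kernel_bounds
begin

text \<open>This is \<open>quadrature_bound\<close> with \<open>D1 = 2 ^ d1\<close> and
  \<open>D2 = 2 ^ d2\<close>, endpoint differences being majorized by \<open>\<beta>\<close>. The
  constant is \<open>16 * 80^2\<close>, from two nested uses of \<open>Lp_le_add\<close> and the
  norm \<open>80 * C\<close> of \<open>X\<close>.\<close>

lemma quadrature_small:
  assumes b: "b \<ge> 2" and P: "P \<ge> 1" and \<pi>: "\<And>j. bij_betw (\<pi> j) {..<b} {..<b}"
    and N2: "2 ^ (d1 + d2) \<le> real b ^ n"
  shows "\<exists>g. Lp_le P g (quadrature_const b * (102400 * C\<^sup>2) * main_rate P (real b ^ n) d1 d2) \<and>
       (\<forall>w::real ^ 2. norm (sym_average b n \<pi> (H d1 (w $ 1)) (H d2 (w $ 2))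
          - integral {0..1} (H d1 (w $ 1)) * integral {0..1} (H d2 (w $ 2))) \<le> g w)"
proof -
  define Q where "Q = quadrature_const b"
  have Q: "Q > 0" unfolding Q_def by (rule quadrature_const_pos[OF b])
  let ?N = "real b ^ n"
  have N: "?N > 0" using b by simp
  define s where "s = sqrt (2 ^ (d1 + d2) / ?N)"
  have s0: "s \<ge> 0" using N by (simp add: s_def)
  define g where "g = (\<lambda>w::real ^ 2. Q / ?N * ((s * (X (w $ 1) * X (w $ 2)) + X (w $ 1) * \<beta> d2 (w $ 2)) + \<beta> d1 (w $ 1) * X (w $ 2)))"
  define p1 p2 where "p1 = (1 / 2 ^ d1) powr (1 / P)" and "p2 = (1 / 2 ^ d2) powr (1 / P)"
  have "Lp_le P g (Q / ?N * (4 * (4 * (s * ((80 * C) * (80 * C)) + (80 * C) * (32 * C * p2)) + (32 * C * p1) * (80 * C))))"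
    unfolding g_def p1_def p2_def using N Q s0 P
    by (intro Lp_le_cmult Lp_le_add Lp_le_tensor Lp_le_X Lp_le_\<beta>) auto
  then have "Lp_le P g (Q * (102400 * C\<^sup>2) * main_rate P ?N d1 d2)"
  proof (rule Lp_le_mono)
    show "g \<in> borel_measurable borel" unfolding g_def by simp
    show "0 \<le> g w" for w unfolding g_def
      using N Q s0 X_nonneg \<beta>_nonneg by (intro mult_nonneg_nonneg add_nonneg_nonneg) auto
    have "4 * (4 * (s * ((80 * C) * (80 * C)) + (80 * C) * (32 * C * p2)) + (32 * C * p1) * (80 * C))
       \<le> 102400 * C\<^sup>2 * (s + p1 + p2)"
      proof -
        have "0 \<le> C * C * p1" "0 \<le> C * C * p2" using C by (simp_all add: p1_def p2_def)
        then show ?thesis by (simp add: power2_eq_square algebra_simps)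
      qed
    from mult_left_mono[OF this, of "Q / ?N"] Q N
    show "Q / ?N * (4 * (4 * (s * ((80 * C) * (80 * C)) + (80 * C) * (32 * C * p2)) + (32 * C * p1) * (80 * C)))
       \<le> Q * (102400 * C\<^sup>2) * main_rate P ?N d1 d2"
      using N2 by (simp add: main_rate_def s_def p1_def p2_def mult_ac)
  qed (use P in auto)
  moreover have "norm (sym_average b n \<pi> (H d1 (w $ 1)) (H d2 (w $ 2))
        - integral {0..1} (H d1 (w $ 1)) * integral {0..1} (H d2 (w $ 2))) \<le> g w" for w
  proof -
    let ?x = "w $ 1" and ?y = "w $ 2"
    have "norm (sym_average b n \<pi> (H d1 ?x) (H d2 ?y) - integral {0..1} (H d1 ?x) * integral {0..1} (H d2 ?y))
      \<le> Q / ?N * (X ?x * X ?y * sqrt (2 ^ d1 * 2 ^ d2 / ?N) + X ?x * norm (H d2 ?y 1 - H d2 ?y 0) + norm (H d1 ?x 1 - H d1 ?x 0) * X ?y)"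
      unfolding sym_average_def Q_def
      by (rule quadrature_bound[OF b \<pi> H_C1 k_C1 H_C1 k_C1 integral_bounds(1) integral_bounds(2) integral_bounds(3) integral_bounds(2) integral_bounds(3) H_sup])
        (use N2 in \<open>auto simp: power_add\<close>)
    also have "\<dots> \<le> Q / ?N * (X ?x * X ?y * s + X ?x * \<beta> d2 ?y + \<beta> d1 ?x * X ?y)"
      using Q N X_nonneg unfolding s_def power_add
      by (intro mult_left_mono add_mono mult_right_mono H_jump order_refl) auto
    finally show ?thesis by (simp add: g_def mult_ac)
  qed
  ultimately show ?thesis unfolding Q_def by blast
qed

text \<open>The mean and the product of the integrals are estimated separately. The mean is of order
  \<open>1 / N\<close> pointwise by \<open>net_overlap\<close>, and its integral is of order
  \<open>2^-(d1 + d2)\<close>.\<close>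

lemma quadrature_large:
  assumes b: "b \<ge> 2" and P: "P \<ge> 1" and \<pi>: "\<And>j. bij_betw (\<pi> j) {..<b} {..<b}" and N2: "2 ^ (d1 + d2) > real b ^ n"
  shows "\<exists>g. Lp_le P g (25600 * real b ^ 4 * C\<^sup>2 * main_rate P (real b ^ n) d1 d2) \<and>
       (\<forall>w::real ^ 2. norm (sym_average b n \<pi> (H d1 (w $ 1)) (H d2 (w $ 2))
          - integral {0..1} (H d1 (w $ 1)) * integral {0..1} (H d2 (w $ 2))) \<le> g w)"
proof -
  let ?N = "real b ^ n" and ?T = "2 ^ (d1 + d2) :: real"
  have N: "?N > 0" using b by simp
  have b0: "b > 0" using b by simp
  have b4: "real b ^ 4 \<ge> 1" using b by (simp add: one_le_power)
  have p0: "0 \<le> peak t" for t using peak_bounds[of t] by simp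
  define Y where "Y u = radinv b \<pi> n u" for u
  have \<pi>lt: "\<pi> j c < b" if "c < b" for j c using bij_betwE[OF \<pi>[of j]] that by auto
  have Y01: "Y u \<in> {0..1}" for u 
  proof -
    have "0 \<le> radinv b \<pi> n u \<and> radinv b \<pi> n u < 1" by (rule radinv_bounds[OF b0 \<pi>lt])
    then show ?thesis by (simp add: Y_def)
  qed
  define z0 where "z0 u = real u / ?N" for u
  define z1 where "z1 u = 1 - (real u + 1) / ?N" for u
  have z01: "z0 u \<in> {0..1}" "z1 u \<in> {0..1}" if "u < b ^ n" for u
  proof -
    have "real (u + 1) \<le> real (b ^ n)" using that by (intro of_nat_mono) simp
    then have "real u + 1 \<le> ?N" by simp
    then have "real u \<le> ?N" "real u + 1 \<le> ?N" by linarith+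
    then have "real u / ?N \<le> 1" "(real u + 1) / ?N \<le> 1"
      using N by (simp_all only: divide_le_eq_1_pos)
    moreover have "0 \<le> real u / ?N" "0 \<le> (real u + 1) / ?N" using N by simp_all
    ultimately show "z0 u \<in> {0..1}" "z1 u \<in> {0..1}" unfolding z0_def z1_def atLeastAtMost_iff by linarith+
  qed
  define pk where "pk a c = (\<lambda>w::real ^ 2. peak (2 ^ d1 * (w $ 1 - a)) * peak (2 ^ d2 * (w $ 2 - c)))" for a c
  have pk0: "0 \<le> pk a c w" for a c w unfolding pk_def by (intro mult_nonneg_nonneg p0)
  have [measurable]: "pk a c \<in> borel_measurable borel" for a c unfolding pk_def by simp
  define V where "V = (\<lambda>w. 1 / (2 * ?N) * (\<Sum>u<b ^ n. pk (z0 u) (Y u) w + pk (z1 u) (Y u) w))"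
  let ?K = "1296 * real b ^ 4"
  have LV: "Lp_le P V (?K / ?N * (?N / ?T) powr (1 / P))"
  proof (rule Lp_le_interpolate)
    show "V \<in> borel_measurable borel" unfolding V_def by simp
    show "0 \<le> V w" for w unfolding V_def using N by (intro mult_nonneg_nonneg sum_nonneg add_nonneg_nonneg pk0) auto
    show "V w \<le> ?K / ?N" for w
    proof -
      have D: "(1::real) \<le> 2 ^ d1" "(1::real) \<le> 2 ^ d2" "?N \<le> 2 ^ d1 * 2 ^ d2" using N2 by (auto simp: power_add)
      have no: "(\<Sum>u<b ^ n. peak (2 ^ d1 * (x - (real u + e) / ?N)) * peak (2 ^ d2 * (y - radinv b \<pi> n u))) \<le> ?K"
        if "e = 0 \<or> e = 1" for e x y
        using that by (rule net_overlap[OF b \<pi> D])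
      have "(\<Sum>u<b ^ n. pk (z0 u) (Y u) w) \<le> ?K"
        using no[of 0 "w $ 1" "w $ 2"] by (simp add: pk_def z0_def Y_def)
      moreover have "(\<Sum>u<b ^ n. pk (z1 u) (Y u) w) \<le> ?K"
      proof -
        \<comment> \<open>Since \<open>peak\<close> is even, reflecting the argument instead of the
          nodes reduces this half to \<open>net_overlap\<close> with \<open>e = 1\<close>.\<close>
        have "peak (2 ^ d1 * (w $ 1 - z1 u)) = peak (2 ^ d1 * ((1 - w $ 1) - (real u + 1) / ?N))" for u
        proof -
          have "2 ^ d1 * (w $ 1 - z1 u) = - (2 ^ d1 * ((1 - w $ 1) - (real u + 1) / ?N))"
            by (simp add: z1_def algebra_simps)
          then show ?thesis by (simp only: peak_minus)
        qed
        then show ?thesis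
          using no[of 1 "1 - w $ 1" "w $ 2"] by (simp add: pk_def Y_def)
      qed
      ultimately have "(\<Sum>u<b ^ n. pk (z0 u) (Y u) w + pk (z1 u) (Y u) w) \<le> 2 * ?K"
        by (simp add: sum.distrib)
      then have "V w \<le> 1 / (2 * ?N) * (2 * ?K)" unfolding V_def using N by (intro mult_left_mono) auto
      then show ?thesis using N by simp
    qed
    have ipk: "(\<integral>\<^sup>+w. ennreal (pk a c w) \<partial>lborel) = ennreal (pi / 2 ^ d1 * (pi / 2 ^ d2))" for a c
    proof -
      have "(\<integral>\<^sup>+w. ennreal (pk a c w) \<partial>lborel) = (\<integral>\<^sup>+w. ennreal (peak (2 ^ d1 * (w $ 1 - a))) * ennreal (peak (2 ^ d2 * (w $ 2 - c))) \<partial>(lborel :: (real ^ 2) measure))"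
        unfolding pk_def using p0 by (simp add: ennreal_mult')
      also have "\<dots> = ennreal (pi / 2 ^ d1) * ennreal (pi / 2 ^ d2)"
        by (subst nn_integral_vec2) (simp_all add: nn_integral_peak_scaled)
      also have "\<dots> = ennreal (pi / 2 ^ d1 * (pi / 2 ^ d2))" by (rule ennreal_mult'[symmetric]) simp
      finally show ?thesis .
    qed
    have "(\<integral>\<^sup>+w. ennreal (V w) \<partial>lborel) = (\<integral>\<^sup>+w. ennreal (1 / (2 * ?N)) * (\<Sum>u<b ^ n. ennreal (pk (z0 u) (Y u) w) + ennreal (pk (z1 u) (Y u) w)) \<partial>lborel)"
    proof (intro nn_integral_cong)
      fix w
      have "(\<Sum>u<b ^ n. ennreal (pk (z0 u) (Y u) w) + ennreal (pk (z1 u) (Y u) w)) = ennreal (\<Sum>u<b ^ n. pk (z0 u) (Y u) w + pk (z1 u) (Y u) w)"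
        using pk0 by (simp flip: ennreal_plus add: sum_ennreal)
      then show "ennreal (V w) = ennreal (1 / (2 * ?N)) * (\<Sum>u<b ^ n. ennreal (pk (z0 u) (Y u) w) + ennreal (pk (z1 u) (Y u) w))"
        unfolding V_def using N by (simp only:) (intro ennreal_mult', simp)
    qed
    also have "\<dots> = ennreal (1 / (2 * ?N)) * (\<Sum>u<b ^ n. ennreal (pi / 2 ^ d1 * (pi / 2 ^ d2)) + ennreal (pi / 2 ^ d1 * (pi / 2 ^ d2)))"
      by (simp add: nn_integral_cmult nn_integral_sum nn_integral_add ipk del: sum_constant)
    also have "\<dots> = ennreal (1 / (2 * ?N) * (\<Sum>u<b ^ n. pi / 2 ^ d1 * (pi / 2 ^ d2) + pi / 2 ^ d1 * (pi / 2 ^ d2)))"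
      using N by (simp flip: ennreal_plus ennreal_mult' add: sum_ennreal del: sum_constant)
    also have "1 / (2 * ?N) * (\<Sum>u<b ^ n. pi / 2 ^ d1 * (pi / 2 ^ d2) + pi / 2 ^ d1 * (pi / 2 ^ d2)) = pi * pi / ?T"
      using N by (simp add: power_add)
    also have "ennreal (pi * pi / ?T) \<le> ennreal (?K / ?T)"
    proof (intro ennreal_leI divide_right_mono)
      have "pi * pi \<le> 4 * 4" using pi_less_4 by (intro mult_mono) auto
      then show "pi * pi \<le> ?K" using b4 by linarith
    qed simp
    finally show "(\<integral>\<^sup>+w. ennreal (V w) \<partial>lborel) \<le> ennreal (?K / ?T)" .
  qed (use N P b in auto)
  define g where "g = (\<lambda>w::real ^ 2. C\<^sup>2 * V w + 1 / ?T * (X (w $ 1) * X (w $ 2)))"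
  have "Lp_le P g (4 * (C\<^sup>2 * (?K / ?N * (?N / ?T) powr (1 / P)) + 1 / ?T * ((80 * C) * (80 * C))))"
    unfolding g_def using P by (intro Lp_le_cmult Lp_le_add Lp_le_tensor Lp_le_X LV) auto
  then have "Lp_le P g (25600 * real b ^ 4 * C\<^sup>2 * main_rate P ?N d1 d2)"
  proof (rule Lp_le_mono)
    show "g \<in> borel_measurable borel" unfolding g_def using Lp_leD(1)[OF LV] by simp
    show "0 \<le> g w" for w unfolding g_def
      using Lp_leD(2)[OF LV] X_nonneg by (intro add_nonneg_nonneg mult_nonneg_nonneg) auto
    define t s where "t = 1 / ?N * (?N / ?T) powr (1 / P)" and "s = 1 / ?T"
    have ts: "t \<ge> 0" "s \<ge> 0" using N by (auto simp: t_def s_def)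
    have B: "5184 * (real b ^ 4 * (C\<^sup>2 * t)) \<le> 25600 * (real b ^ 4 * (C\<^sup>2 * t))"
      using ts by (intro mult_right_mono) auto
    have "25600 * (C\<^sup>2 * s) * 1 \<le> 25600 * (C\<^sup>2 * s) * real b ^ 4" using ts b4 by (intro mult_left_mono) auto
    with B have "5184 * (real b ^ 4 * (C\<^sup>2 * t)) + 25600 * (C\<^sup>2 * s) \<le> 25600 * real b ^ 4 * C\<^sup>2 * (t + s)"
      by (simp add: algebra_simps)
    moreover have "4 * (C\<^sup>2 * (?K / ?N * (?N / ?T) powr (1 / P)) + 1 / ?T * ((80 * C) * (80 * C))) =
        5184 * (real b ^ 4 * (C\<^sup>2 * t)) + 25600 * (C\<^sup>2 * s)"
      by (simp add: t_def s_def power2_eq_square)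
    moreover have "main_rate P ?N d1 d2 = t + s" using N2 by (simp add: main_rate_def t_def s_def)
    ultimately show "4 * (C\<^sup>2 * (?K / ?N * (?N / ?T) powr (1 / P)) + 1 / ?T * ((80 * C) * (80 * C)))
      \<le> 25600 * real b ^ 4 * C\<^sup>2 * main_rate P ?N d1 d2" by simp
  qed (use P in auto)
  moreover have "norm (sym_average b n \<pi> (H d1 (w $ 1)) (H d2 (w $ 2))
          - integral {0..1} (H d1 (w $ 1)) * integral {0..1} (H d2 (w $ 2))) \<le> g w" for w
  proof -
    let ?F = "H d1 (w $ 1)" and ?G = "H d2 (w $ 2)"
    have FG: "norm (?F a * ?G c) \<le> C\<^sup>2 * pk a c w" if "a \<in> {0..1}" "c \<in> {0..1}" for a c
    proof -
      have "norm (?F a) * norm (?G c) \<le> (C * peak (2 ^ d1 * (w $ 1 - a))) * (C * peak (2 ^ d2 * (w $ 2 - c)))"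
        using C p0 by (intro mult_mono H_le that) auto
      then show ?thesis by (simp add: norm_mult pk_def power2_eq_square mult_ac)
    qed
    have "norm ((\<Sum>u<b ^ n. ?F (z0 u) * ?G (Y u)) + (\<Sum>u<b ^ n. ?F (z1 u) * ?G (Y u))) \<le>
        (\<Sum>u<b ^ n. C\<^sup>2 * (pk (z0 u) (Y u) w + pk (z1 u) (Y u) w))"
      unfolding sum.distrib[symmetric]
    proof (rule sum_norm_le)
      fix u assume "u \<in> {..<b ^ n}"
      then have u: "u < b ^ n" by simp
      show "norm (?F (z0 u) * ?G (Y u) + ?F (z1 u) * ?G (Y u)) \<le> C\<^sup>2 * (pk (z0 u) (Y u) w + pk (z1 u) (Y u) w)"
        unfolding distrib_left by (rule norm_triangle_mono[OF FG[OF z01(1)[OF u] Y01] FG[OF z01(2)[OF u] Y01]])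
    qed
    also have "\<dots> = 2 * ?N * (C\<^sup>2 * V w)" using N by (simp add: V_def sum_distrib_left)
    finally have a: "norm (sym_average b n \<pi> ?F ?G) \<le> C\<^sup>2 * V w"
      using N unfolding sym_average_def norm_divide z0_def z1_def Y_def
      by (simp only: norm_of_real) (simp add: divide_le_eq mult_ac)
    have I: "norm (integral {0..1} (H d x)) \<le> X x / 2 ^ d" for d x
    proof -
      have "norm (integral {0..1} (H d x)) \<le> integral {0..1} (\<lambda>z. norm (H d x z))"
        by (intro integral_norm_bound_integral integrable_continuous_real C1_funD[OF H_C1]) auto
      then show ?thesis using integral_bounds(1)[of d x] by simp
    qed
    have "norm (integral {0..1} ?F * integral {0..1} ?G) \<le> (X (w $ 1) / 2 ^ d1) * (X (w $ 2) / 2 ^ d2)"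
      unfolding norm_mult using X_nonneg by (intro mult_mono I) auto
    then have c: "norm (integral {0..1} ?F * integral {0..1} ?G) \<le> 1 / ?T * (X (w $ 1) * X (w $ 2))"
      by (simp add: power_add)
    have "norm (sym_average b n \<pi> ?F ?G - integral {0..1} ?F * integral {0..1} ?G) \<le>
       norm (sym_average b n \<pi> ?F ?G) + norm (integral {0..1} ?F * integral {0..1} ?G)" by (rule norm_triangle_ineq4)
    with a c show ?thesis unfolding g_def by linarith
  qed
  ultimately show ?thesis by blast
qed

definition block_const :: "nat \<Rightarrow> real" where
  "block_const b = 16 * (quadrature_const b * (102400 * C\<^sup>2) + 25600 * real b ^ 4 * C\<^sup>2 + 32 * C * (800 * (C + 1)))"

lemma block_const_pos: "b \<ge> 2 \<Longrightarrow> block_const b > 0"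
  using quadrature_const_pos[of b] C unfolding block_const_def
  by (intro mult_pos_pos add_pos_pos) auto

text \<open>By \<open>sym_average_shift\<close> the block is the quadrature error minus two products
  of a boundary value and a grid error. The outer \<open>16\<close> of \<open>block_const\<close>
  pays for the two nested uses of \<open>Lp_le_add\<close>.\<close>

lemma block_bound:
  assumes b: "b \<ge> 2" and P: "P \<ge> 1" and \<pi>: "\<And>j. bij_betw (\<pi> j) {..<b} {..<b}"
  shows "\<exists>g. Lp_le P g (block_const b * block_rate P (real b ^ n) d1 d2) \<and>
       (\<forall>w::real ^ 2. norm (sym_average b n \<pi> (\<lambda>t. H d1 (w $ 1) t - H d1 (w $ 1) 1) (\<lambda>t. H d2 (w $ 2) t - H d2 (w $ 2) 1)
          - (integral {0..1} (H d1 (w $ 1)) - H d1 (w $ 1) 1) * (integral {0..1} (H d2 (w $ 2)) - H d2 (w $ 2) 1)) \<le> g w)"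
proof -
  define K1 where "K1 = quadrature_const b * (102400 * C\<^sup>2)"
  have K1: "K1 > 0" using quadrature_const_pos[OF b] C by (simp add: K1_def)
  define K2 where "K2 = 25600 * real b ^ 4 * C\<^sup>2"
  have K2: "K2 > 0" using b C by (simp add: K2_def)
  define K3 where "K3 = 32 * C * (800 * (C + 1))"
  have K3: "K3 > 0" using C by (simp add: K3_def)
  have bc: "block_const b = 16 * (K1 + K2 + K3)" by (simp add: block_const_def K1_def K2_def K3_def)
  have b0: "b > 0" using b by simp
  let ?N = "real b ^ n"
  have N: "?N > 0" using b by simp
  let ?M = "main_rate P ?N d1 d2"
  have mr0: "mean_rate P ?N d \<ge> 0" for d using N by (simp add: mean_rate_def)
  have M0: "?M \<ge> 0" using N by (simp add: main_rate_def)
  obtain g0 where g0: "Lp_le P g0 ((K1 + K2) * ?M)"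
    "\<And>w::real ^ 2. norm (sym_average b n \<pi> (H d1 (w $ 1)) (H d2 (w $ 2))
        - integral {0..1} (H d1 (w $ 1)) * integral {0..1} (H d2 (w $ 2))) \<le> g0 w"
  proof -
    define Bd where "Bd g \<longleftrightarrow> (\<forall>w::real ^ 2. norm (sym_average b n \<pi> (H d1 (w $ 1)) (H d2 (w $ 2))
        - integral {0..1} (H d1 (w $ 1)) * integral {0..1} (H d2 (w $ 2))) \<le> g w)" for g
    obtain g K where g: "K \<le> K1 + K2" "Lp_le P g (K * ?M)" "Bd g"
    proof (cases "2 ^ (d1 + d2) \<le> ?N")
      case True
      have "\<exists>g. Lp_le P g (K1 * ?M) \<and> Bd g" unfolding Bd_def K1_def by (rule quadrature_small[OF b P \<pi> True])
      then obtain g where "Lp_le P g (K1 * ?M)" "Bd g" by blast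
      then show thesis using that[of K1 g] K2 by simp
    next
      case False
      then have "2 ^ (d1 + d2) > ?N" by simp
      have "\<exists>g. Lp_le P g (K2 * ?M) \<and> Bd g"
        unfolding Bd_def K2_def by (rule quadrature_large[OF b P \<pi>]) fact
      then obtain g where "Lp_le P g (K2 * ?M)" "Bd g" by blast
      then show thesis using that[of K2 g] K1 by simp
    qed
    have "K * ?M \<le> (K1 + K2) * ?M" by (rule mult_right_mono[OF g(1) M0])
    then have L: "Lp_le P g ((K1 + K2) * ?M)"
      using P by (intro Lp_le_mono[OF g(2)] Lp_leD(1,2)[OF g(2)]) simp_all
    show thesis by (rule that[OF L]) (use g(3) in \<open>simp add: Bd_def\<close>)
  qed
  define g where "g = (\<lambda>w::real ^ 2. (g0 w + \<beta> d1 (w $ 1) * mean_error b n d2 (w $ 2)) + mean_error b n d1 (w $ 1) * \<beta> d2 (w $ 2))"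
  define p1 p2 where "p1 = (1 / 2 ^ d1) powr (1 / P)" and "p2 = (1 / 2 ^ d2) powr (1 / P)"
  define r1 r2 where "r1 = mean_rate P ?N d1" and "r2 = mean_rate P ?N d2"
  have "Lp_le P g (4 * (4 * ((K1 + K2) * ?M + (32 * C * p1) * (800 * (C + 1) * r2)) + (800 * (C + 1) * r1) * (32 * C * p2)))"
    unfolding g_def p1_def p2_def r1_def r2_def
    by (intro Lp_le_add Lp_le_tensor g0(1) Lp_le_\<beta> Lp_le_mean_error b0 P)
  then have "Lp_le P g (16 * (K1 + K2 + K3) * block_rate P ?N d1 d2)"
  proof (rule Lp_le_mono)
    note L = \<open>Lp_le P g _\<close>
    show "g \<in> borel_measurable borel" "0 \<le> g w" for w by (rule Lp_leD[OF L])+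
    have nn: "0 \<le> p1 * r2" "0 \<le> r1 * p2" using mr0 by (auto simp: p1_def p2_def r1_def r2_def)
    have e: "4 * (4 * ((K1 + K2) * ?M + (32 * C * p1) * (800 * (C + 1) * r2)) + (800 * (C + 1) * r1) * (32 * C * p2))
      = 16 * (K1 + K2) * ?M + 16 * K3 * (p1 * r2) + 4 * K3 * (r1 * p2)"
      by (simp add: K3_def algebra_simps)
    have "16 * (K1 + K2) * ?M \<le> 16 * (K1 + K2 + K3) * ?M" using M0 K3 by (intro mult_right_mono) auto
    moreover have "16 * K3 * (p1 * r2) \<le> 16 * (K1 + K2 + K3) * (p1 * r2)" using nn K1 K2 by (intro mult_right_mono) auto
    moreover have "4 * K3 * (r1 * p2) \<le> 16 * (K1 + K2 + K3) * (r1 * p2)" using nn K1 K2 K3 by (intro mult_right_mono) auto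
    moreover have "16 * (K1 + K2 + K3) * block_rate P ?N d1 d2 =
       16 * (K1 + K2 + K3) * ?M + 16 * (K1 + K2 + K3) * (p1 * r2) + 16 * (K1 + K2 + K3) * (r1 * p2)"
      by (simp add: block_rate_def p1_def p2_def r1_def r2_def distrib_left)
    ultimately show "4 * (4 * ((K1 + K2) * ?M + (32 * C * p1) * (800 * (C + 1) * r2)) + (800 * (C + 1) * r1) * (32 * C * p2))
       \<le> 16 * (K1 + K2 + K3) * block_rate P ?N d1 d2" unfolding e by linarith
  qed (use P in auto)
  moreover have "norm (sym_average b n \<pi> (\<lambda>t. H d1 (w $ 1) t - H d1 (w $ 1) 1) (\<lambda>t. H d2 (w $ 2) t - H d2 (w $ 2) 1)
        - (integral {0..1} (H d1 (w $ 1)) - H d1 (w $ 1) 1) * (integral {0..1} (H d2 (w $ 2)) - H d2 (w $ 2) 1)) \<le> g w" for w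
  proof -
    let ?F = "H d1 (w $ 1)" and ?G = "H d2 (w $ 2)"
    let ?m1 = "fold_average b ?F n 0 - integral {0..1} ?F" and ?m2 = "fold_average b ?G n 0 - integral {0..1} ?G"
    let ?Q = "sym_average b n \<pi> ?F ?G - integral {0..1} ?F * integral {0..1} ?G"
    have "norm (?Q - ?F 1 * ?m2 - ?G 1 * ?m1) \<le> norm ?Q + norm (?F 1 * ?m2) + norm (?G 1 * ?m1)"
      by (smt (verit) norm_triangle_ineq4)
    moreover have "norm (?F 1 * ?m2) \<le> \<beta> d1 (w $ 1) * mean_error b n d2 (w $ 2)"
      unfolding norm_mult by (intro mult_mono norm_H1 mean_error_bound b0 \<beta>_nonneg) simp
    moreover have "norm (?G 1 * ?m1) \<le> \<beta> d2 (w $ 2) * mean_error b n d1 (w $ 1)"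
      unfolding norm_mult by (intro mult_mono norm_H1 mean_error_bound b0 \<beta>_nonneg) simp
    moreover note g0(2)[of w]
    ultimately show ?thesis
      unfolding sym_average_shift[OF b0 \<pi>] g_def by (simp add: mult.commute)
  qed
  ultimately show ?thesis unfolding bc by blast
qed

end

section \<open>Summation over the blocks\<close>

text \<open>Weights for the summation over the blocks. The cuts at \<open>N\<close> are essential:
  without them the last two terms would not be summable in the other index; beyond them the first
  term takes over.\<close>

definition decay :: "real \<Rightarrow> real \<Rightarrow> nat \<Rightarrow> nat \<Rightarrow> real" where
  "decay \<epsilon> N d1 d2 = min ((2 ^ (d1 + d2) / N) powr \<epsilon>) ((N / 2 ^ (d1 + d2)) powr \<epsilon>)
     + (if 2 ^ d2 \<le> N then (1 / 2 ^ d1) powr \<epsilon> else 0) + (if 2 ^ d1 \<le> N then (1 / 2 ^ d2) powr \<epsilon> else 0)"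

lemma decay_bounds:
  assumes "N > 0" "\<epsilon> > 0"
  shows "0 \<le> decay \<epsilon> N d1 d2" "decay \<epsilon> N d1 d2 \<le> 3"
proof -
  show "0 \<le> decay \<epsilon> N d1 d2" using assms by (simp add: decay_def)
  have a: "(1 / 2 ^ d) powr \<epsilon> \<le> 1" for d :: nat
    using powr_mono2[of \<epsilon> "1 / 2 ^ d" 1] assms by simp
  have "min (t powr \<epsilon>) ((1 / t) powr \<epsilon>) \<le> 1" if "t > 0" for t
  proof (cases "t \<le> 1")
    case True
    then show ?thesis using powr_mono2[of \<epsilon> t 1] assms that by (simp add: min.coboundedI1)
  next
    case False
    then show ?thesis using powr_mono2[of \<epsilon> "1 / t" 1] assms that by (simp add: min.coboundedI2)
  qed
  from this[of "2 ^ (d1 + d2) / N"] assms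
  have "min ((2 ^ (d1 + d2) / N) powr \<epsilon>) ((N / 2 ^ (d1 + d2)) powr \<epsilon>) \<le> 1" by simp
  then show "decay \<epsilon> N d1 d2 \<le> 3" unfolding decay_def using a[of d1] a[of d2] by auto
qed

lemma powr_le_of_le_one:
  fixes t :: real
  assumes "0 < t" "t \<le> 1" "a \<le> c"
  shows "t powr c \<le> t powr a"
  using assms by (simp add: powr_mono')

lemma ratio_powr_le:
  fixes s t a :: real
  assumes "0 < s" "s \<le> t" "0 \<le> a"
  shows "(s / t) powr a \<le> (t / s) powr a"
proof (rule powr_mono2)
  have "s / t \<le> 1" "1 \<le> t / s" using assms by (simp_all add: divide_le_eq le_divide_eq)
  then show "s / t \<le> t / s" by linarith
qed (use assms in auto)

text \<open>With \<open>t = N / T\<close> the two summands are \<open>N powr (r - 1)\<close> times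
  \<open>t powr (\<rho> - r)\<close> and \<open>t powr (1 - r)\<close>. For
  \<open>\<rho> = 1 / P\<close> the decay requires the smoothness to lie below
  \<open>1 / P\<close>.\<close>

lemma weighted_tail:
  fixes T N r \<rho> :: real
  assumes "N > 0" "T > N" "r < \<rho>" "\<rho> \<le> 1" "\<epsilon> \<le> \<rho> - r"
  shows "T powr r * (1 / N * (N / T) powr \<rho> + 1 / T) \<le> 2 * N powr (r - 1) * (N / T) powr \<epsilon>"
proof -
  define t where "t = N / T"
  have t: "0 < t" "t \<le> 1" "T = N / t" using assms by (auto simp: t_def)
  have 1: "T powr r * (1 / N * t powr \<rho>) = N powr (r - 1) * t powr (\<rho> - r)"
    using t assms by (simp add: powr_divide powr_diff)
  have 2: "T powr r * (1 / T) = N powr (r - 1) * t powr (1 - r)"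
    using t assms by (simp add: powr_divide powr_diff)
  have "t powr (\<rho> - r) \<le> t powr \<epsilon>" "t powr (1 - r) \<le> t powr \<epsilon>"
    using t assms by (auto intro!: powr_le_of_le_one)
  then have "N powr (r - 1) * t powr (\<rho> - r) + N powr (r - 1) * t powr (1 - r) \<le> N powr (r - 1) * t powr \<epsilon> + N powr (r - 1) * t powr \<epsilon>"
    by (intro add_mono mult_left_mono) auto
  then show ?thesis unfolding distrib_left t_def[symmetric] 1 2 by (simp add: mult_ac)
qed

text \<open>If the second scale exceeds \<open>N\<close>, the factors
  \<open>(1 / 2 ^ d1) powr \<epsilon>\<close> and \<open>(N / 2 ^ d2) powr \<epsilon>\<close>
  combine to a power of \<open>N / 2 ^ (d1 + d2)\<close>, so this case falls under the first term of
  \<open>decay\<close>.\<close>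

lemma weighted_mean_rate:
  assumes N: "N \<ge> 1" and r: "0 \<le> r" "r < 1 / P" "P \<ge> 1" and \<epsilon>: "0 < \<epsilon>" "\<epsilon> \<le> 1 / P - r"
  shows "(2 ^ d1 * 2 ^ d2) powr r * ((1 / 2 ^ d1) powr (1 / P) * mean_rate P N d2) \<le>
    2 * N powr (r - 1) * (min ((2 ^ (d1 + d2) / N) powr \<epsilon>) ((N / 2 ^ (d1 + d2)) powr \<epsilon>) + (if 2 ^ d2 \<le> N then (1 / 2 ^ d1) powr \<epsilon> else 0))"
    (is "?L \<le> _")
proof -
  define a c :: real where "a = 2 ^ d1" and "c = 2 ^ d2"
  have ac: "a \<ge> 1" "c \<ge> 1" by (auto simp: a_def c_def)
  have P1: "1 / P \<le> 1" using r by simp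
  have E: "(a * c) powr r * ((1 / a) powr (1 / P) * mean_rate P N d2) = (1 / a) powr (1 / P - r) * (c powr r * mean_rate P N d2)"
    using ac by (simp add: powr_mult powr_diff powr_divide)
  have A: "(1 / a) powr (1 / P - r) \<le> (1 / a) powr \<epsilon>"
    using ac \<epsilon> by (intro powr_le_of_le_one) auto
  have mr0: "mean_rate P N d2 \<ge> 0" using N by (simp add: mean_rate_def)
  then have L: "?L \<le> (1 / a) powr \<epsilon> * (c powr r * mean_rate P N d2)"
    unfolding a_def[symmetric] c_def[symmetric] E by (intro mult_right_mono[OF A] mult_nonneg_nonneg) simp_all
  show ?thesis
  proof (cases "c \<le> N")
    case True
    have "c powr r * mean_rate P N d2 \<le> N powr r * (2 / N)"
    proof (rule mult_mono)
      show "c powr r \<le> N powr r" using True ac r by (intro powr_mono2) auto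
      have "(1 / c) powr (1 / P) \<le> 1 powr (1 / P)" using ac r by (intro powr_mono2) auto
      moreover have "c / N \<le> 1" using True N by (simp add: divide_le_eq)
      ultimately have "c / N + (1 / c) powr (1 / P) \<le> 2" by simp
      then have "1 / N * (c / N + (1 / c) powr (1 / P)) \<le> 1 / N * 2" using N by (intro mult_left_mono) auto
      then show "mean_rate P N d2 \<le> 2 / N" using True by (simp add: mean_rate_def c_def)
    qed (use mr0 in auto)
    also have "\<dots> = 2 * N powr (r - 1)" using N by (simp add: powr_diff)
    finally have "(1 / a) powr \<epsilon> * (c powr r * mean_rate P N d2) \<le> (1 / a) powr \<epsilon> * (2 * N powr (r - 1))"
      by (rule mult_left_mono) simp
    also have "\<dots> \<le> 2 * N powr (r - 1) * (min ((2 ^ (d1 + d2) / N) powr \<epsilon>) ((N / 2 ^ (d1 + d2)) powr \<epsilon>) + (1 / a) powr \<epsilon>)"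
      by (simp add: distrib_left)
    finally show ?thesis using L True by (simp add: a_def c_def)
  next
    case False
    have "c powr r * mean_rate P N d2 \<le> 2 * N powr (r - 1) * (N / c) powr \<epsilon>"
      using weighted_tail[of N c r "1 / P" \<epsilon>] False N r P1 \<epsilon> by (simp add: mean_rate_def c_def)
    then have "(1 / a) powr \<epsilon> * (c powr r * mean_rate P N d2) \<le> (1 / a) powr \<epsilon> * (2 * N powr (r - 1) * (N / c) powr \<epsilon>)"
      by (rule mult_left_mono) simp
    also have "\<dots> = 2 * N powr (r - 1) * (N / (a * c)) powr \<epsilon>"
    proof -
      have "(1 / a) powr \<epsilon> * (N / c) powr \<epsilon> = (1 / a * (N / c)) powr \<epsilon>" by (rule powr_mult[symmetric])
      then show ?thesis by simp
    qed
    also have "(N / (a * c)) powr \<epsilon> = min ((2 ^ (d1 + d2) / N) powr \<epsilon>) ((N / 2 ^ (d1 + d2)) powr \<epsilon>)"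
    proof -
      have "1 * c \<le> a * c" using ac by (intro mult_right_mono) auto
      then have "N < a * c" using False by linarith
      then have "(N / (a * c)) powr \<epsilon> \<le> (a * c / N) powr \<epsilon>"
        using \<epsilon> N ac by (intro ratio_powr_le) auto
      then show ?thesis by (simp add: a_def c_def power_add)
    qed
    finally show ?thesis using L False by (simp add: c_def)
  qed
qed

text \<open>The square root in \<open>main_rate\<close> is the reason for
  \<open>\<epsilon> \<le> 1 / 2\<close>. Each of the three parts of \<open>block_rate\<close> is at
  most twice the weight, whence \<open>6\<close>.\<close>

lemma weighted_block_rate:
  assumes N: "N \<ge> 1" and r: "0 \<le> r" "r < 1 / P" "P \<ge> 1" and \<epsilon>: "0 < \<epsilon>" "\<epsilon> \<le> 1 / P - r" "\<epsilon> \<le> 1 / 2"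
  shows "(2 ^ d1 * 2 ^ d2) powr r * block_rate P N d1 d2 \<le> 6 * N powr (r - 1) * decay \<epsilon> N d1 d2"
proof -
  define T :: real where "T = 2 ^ (d1 + d2)"
  define \<nu> where "\<nu> = min ((2 ^ (d1 + d2) / N) powr \<epsilon>) ((N / 2 ^ (d1 + d2)) powr \<epsilon>)"
  have T: "T \<ge> 1" "2 ^ d1 * 2 ^ d2 = T"
    unfolding T_def by (rule one_le_power, simp, rule power_add[symmetric])
  have P1: "1 / P \<le> 1" using r by simp
  have \<nu>0: "\<nu> \<ge> 0" by (simp add: \<nu>_def)
  let ?i1 = "if 2 ^ d2 \<le> N then (1 / 2 ^ d1) powr \<epsilon> else 0" and ?i2 = "if 2 ^ d1 \<le> N then (1 / 2 ^ d2) powr \<epsilon> else 0"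
  have main: "T powr r * main_rate P N d1 d2 \<le> 2 * N powr (r - 1) * (\<nu> + ?i1 + ?i2)"
  proof (cases "T \<le> N")
    case True
    have dN: "2 ^ d1 \<le> N" "2 ^ d2 \<le> N"
    proof -
      have "(2::real) ^ d1 \<le> T" "(2::real) ^ d2 \<le> T" unfolding T_def by (auto intro: power_increasing)
      then show "2 ^ d1 \<le> N" "2 ^ d2 \<le> N" using True by auto
    qed
    have s: "sqrt (T / N) \<le> \<nu>"
    proof -
      have t: "0 < T / N" "T / N \<le> 1" using T N True by auto
      have "sqrt (T / N) = (T / N) powr (1 / 2)" using t by (simp add: powr_half_sqrt)
      also have "\<dots> \<le> (T / N) powr \<epsilon>" using t \<epsilon> by (intro powr_le_of_le_one) auto
      also have "(T / N) powr \<epsilon> \<le> (N / T) powr \<epsilon>"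
        using T N True \<epsilon> by (intro ratio_powr_le) auto
      then have "(T / N) powr \<epsilon> = \<nu>" by (simp add: \<nu>_def T_def)
      finally show ?thesis .
    qed
    have p: "(1 / 2 ^ d) powr (1 / P) \<le> (1 / 2 ^ d) powr \<epsilon>" for d :: nat
      using \<epsilon> r by (intro powr_le_of_le_one) auto
    have "T powr r * main_rate P N d1 d2 \<le> N powr r * (1 / N * (\<nu> + ?i1 + ?i2))"
    proof (rule mult_mono)
      show "T powr r \<le> N powr r" using True T r by (intro powr_mono2) auto
      have "1 / N * (sqrt (T / N) + (1 / 2 ^ d1) powr (1 / P) + (1 / 2 ^ d2) powr (1 / P)) \<le> 1 / N * (\<nu> + ?i1 + ?i2)"
        using s p[of d1] p[of d2] dN N by (intro mult_left_mono) auto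
      then show "main_rate P N d1 d2 \<le> 1 / N * (\<nu> + ?i1 + ?i2)" using True by (simp add: main_rate_def T_def)
    qed (use N in \<open>auto simp: main_rate_def\<close>)
    also have "\<dots> = N powr (r - 1) * (\<nu> + ?i1 + ?i2)" using N by (simp add: powr_diff)
    also have "\<dots> \<le> 2 * N powr (r - 1) * (\<nu> + ?i1 + ?i2)" using \<nu>0 by (intro mult_right_mono) auto
    finally show ?thesis .
  next
    case False
    have "T powr r * main_rate P N d1 d2 \<le> 2 * N powr (r - 1) * (N / T) powr \<epsilon>"
      using weighted_tail[of N T r "1 / P" \<epsilon>] False N r P1 \<epsilon> by (simp add: main_rate_def T_def)
    also have "(N / T) powr \<epsilon> \<le> (T / N) powr \<epsilon>"
      using T N False \<epsilon> by (intro ratio_powr_le) auto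
    then have "(N / T) powr \<epsilon> = \<nu>" by (simp add: \<nu>_def T_def)
    also have "2 * N powr (r - 1) * \<nu> \<le> 2 * N powr (r - 1) * (\<nu> + ?i1 + ?i2)" by (intro mult_left_mono) auto
    finally show ?thesis .
  qed
  have m1: "T powr r * ((1 / 2 ^ d1) powr (1 / P) * mean_rate P N d2) \<le> 2 * N powr (r - 1) * (\<nu> + ?i1)"
    using weighted_mean_rate[OF N r \<epsilon>(1,2), of d1 d2] unfolding T(2) \<nu>_def by simp
  have m2: "T powr r * ((1 / 2 ^ d2) powr (1 / P) * mean_rate P N d1) \<le> 2 * N powr (r - 1) * (\<nu> + ?i2)"
    using weighted_mean_rate[OF N r \<epsilon>(1,2), of d2 d1] T(2) unfolding \<nu>_def by (simp add: mult.commute add.commute)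
  have "T powr r * block_rate P N d1 d2 = T powr r * main_rate P N d1 d2 + T powr r * ((1 / 2 ^ d1) powr (1 / P) * mean_rate P N d2)
     + T powr r * ((1 / 2 ^ d2) powr (1 / P) * mean_rate P N d1)"
    by (simp add: block_rate_def algebra_simps)
  also have "\<dots> \<le> 2 * N powr (r - 1) * (\<nu> + ?i1 + ?i2) + 2 * N powr (r - 1) * (\<nu> + ?i1) + 2 * N powr (r - 1) * (\<nu> + ?i2)"
    using main m1 m2 by linarith
  also have "\<dots> = 2 * N powr (r - 1) * ((\<nu> + ?i1 + ?i2) + (\<nu> + ?i1) + (\<nu> + ?i2))"
    by (simp only: distrib_left)
  also have "\<dots> \<le> 2 * N powr (r - 1) * (3 * (\<nu> + ?i1 + ?i2))"
    by (intro mult_left_mono) auto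
  also have "\<dots> = 6 * N powr (r - 1) * decay \<epsilon> N d1 d2" by (simp add: decay_def \<nu>_def)
  finally show ?thesis unfolding T(2) .
qed

lemma card_powers_le:
  assumes N: "N \<ge> 1"
  shows "real (card {d. d < D \<and> 2 ^ d \<le> N}) \<le> log 2 N + 1"
proof -
  have "{d. d < D \<and> 2 ^ d \<le> N} \<subseteq> {..nat \<lfloor>log 2 N\<rfloor>}"
  proof
    fix d assume "d \<in> {d. d < D \<and> 2 ^ d \<le> N}"
    then have "2 powr real d \<le> N" by (simp add: powr_realpow)
    then have "real d \<le> log 2 N" using N by (simp add: le_log_iff)
    then show "d \<in> {..nat \<lfloor>log 2 N\<rfloor>}" using N by (simp add: le_nat_floor)
  qed
  then have "card {d. d < D \<and> 2 ^ d \<le> N} \<le> card {..nat \<lfloor>log 2 N\<rfloor>}" by (intro card_mono) auto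
  also have "\<dots> = Suc (nat \<lfloor>log 2 N\<rfloor>)" by simp
  finally have "real (card {d. d < D \<and> 2 ^ d \<le> N}) \<le> real (Suc (nat \<lfloor>log 2 N\<rfloor>))" by (rule of_nat_mono)
  also have "\<dots> \<le> log 2 N + 1" using N by simp
  finally show ?thesis .
qed

text \<open>At most \<open>log 2 N + 1\<close> rows have \<open>2 ^ d1 \<le> N\<close>, and each has
  a bounded sum by \<open>sum_min_geometric\<close>. In later rows the scale is past the peak from
  the start, so the row sums themselves decay geometrically.\<close>

lemma sum_decay_le:
  assumes N: "N \<ge> 2" and \<epsilon>: "\<epsilon> > 0"
  defines "c \<equiv> 2 powr \<epsilon> / (2 powr \<epsilon> - 1)"
  shows "(\<Sum>d1<D. \<Sum>d2<D. decay \<epsilon> N d1 d2) \<le> (8 * c + 2 * c\<^sup>2) * ln (2 * N)"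
proof -
  define q where "q = 2 powr \<epsilon>"
  have q: "q > 1" using \<epsilon> by (simp add: q_def)
  have c: "c > 0" "c = q / (q - 1)" using q by (auto simp: c_def q_def)
  have pw: "(2 ^ d) powr \<epsilon> = q ^ d" for d :: nat
  proof -
    have "(2 ^ d :: real) powr \<epsilon> = 2 powr (real d * \<epsilon>)" by (simp add: powr_powr flip: powr_realpow)
    also have "\<dots> = q ^ d" using q by (simp add: q_def powr_powr mult.commute flip: powr_realpow)
    finally show ?thesis .
  qed
  have geo: "(\<Sum>d<D. (1 / 2 ^ d) powr \<epsilon>) \<le> c" for D :: nat
  proof -
    have "(\<Sum>d<D. (1 / 2 ^ d) powr \<epsilon>) = (\<Sum>d<D. (1 / q) ^ d)"
      by (intro sum.cong refl) (simp add: powr_divide pw power_one_over)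
    also have "\<dots> = (1 - (1 / q) ^ D) / (1 - 1 / q)"
      using q by (simp add: sum_gp_strict)
    also have "\<dots> \<le> 1 / (1 - 1 / q)" using q by (intro divide_right_mono) auto
    also have "\<dots> = c" using q c by (simp add: field_simps)
    finally show ?thesis .
  qed
  define \<nu> where "\<nu> d1 d2 = min ((2 ^ (d1 + d2) / N) powr \<epsilon>) ((N / 2 ^ (d1 + d2)) powr \<epsilon>)" for d1 d2 :: nat
  have \<nu>_eq: "\<nu> d1 d2 = min ((q ^ d1 / N powr \<epsilon>) * q ^ d2) (1 / ((q ^ d1 / N powr \<epsilon>) * q ^ d2))" for d1 d2
    using N by (simp add: \<nu>_def powr_divide powr_mult pw power_add)
  have \<nu>0: "\<nu> d1 d2 \<ge> 0" for d1 d2 by (simp add: \<nu>_def)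
  have in1: "(\<Sum>d2<D. \<nu> d1 d2) \<le> 2 * c" for d1
    unfolding \<nu>_eq using sum_min_geometric[of "q ^ d1 / N powr \<epsilon>" q D] q N c by simp
  have in2: "(\<Sum>d2<D. \<nu> d1 d2) \<le> c * \<nu> d1 0" if "2 ^ d1 > N" for d1
  proof -
    have "\<nu> d1 d2 \<le> \<nu> d1 0 * (1 / 2 ^ d2) powr \<epsilon>" for d2
    proof -
      have "(N / 2 ^ d1) powr \<epsilon> \<le> (2 ^ d1 / N) powr \<epsilon>"
        using that N \<epsilon> by (intro ratio_powr_le) auto
      then have "\<nu> d1 0 = (N / 2 ^ d1) powr \<epsilon>" by (simp add: \<nu>_def)
      moreover have "\<nu> d1 d2 \<le> (N / 2 ^ (d1 + d2)) powr \<epsilon>" by (simp add: \<nu>_def)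
      moreover have "(N / 2 ^ (d1 + d2)) powr \<epsilon> = (N / 2 ^ d1) powr \<epsilon> * (1 / 2 ^ d2) powr \<epsilon>"
        by (simp add: powr_mult[symmetric] power_add)
      ultimately show ?thesis by simp
    qed
    then have "(\<Sum>d2<D. \<nu> d1 d2) \<le> (\<Sum>d2<D. \<nu> d1 0 * (1 / 2 ^ d2) powr \<epsilon>)" by (rule sum_mono)
    also have "\<dots> = \<nu> d1 0 * (\<Sum>d2<D. (1 / 2 ^ d2) powr \<epsilon>)" by (simp only: sum_distrib_left)
    also have "\<dots> \<le> \<nu> d1 0 * c" by (intro mult_left_mono geo \<nu>0)
    finally show ?thesis by (simp add: mult.commute)
  qed
  have in0: "(\<Sum>d1<D. \<nu> d1 0) \<le> 2 * c"
  proof -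
    have "\<nu> d1 0 = \<nu> 0 d1" for d1 by (simp add: \<nu>_def)
    then show ?thesis using in1[of 0] by simp
  qed
  define m where "m = real (card {d. d < D \<and> 2 ^ d \<le> N})"
  have cnt: "(\<Sum>d<D. if 2 ^ d \<le> N then x else 0) = m * x" for x :: real
  proof -
    have "{..<D} \<inter> {d. 2 ^ d \<le> N} = {d. d < D \<and> 2 ^ d \<le> N}" by auto
    then show ?thesis by (simp add: sum.If_cases m_def)
  qed
  have S1: "(\<Sum>d1<D. \<Sum>d2<D. \<nu> d1 d2) \<le> m * (2 * c) + 2 * c\<^sup>2"
  proof -
    have "(\<Sum>d2<D. \<nu> d1 d2) \<le> (if 2 ^ d1 \<le> N then 2 * c else 0) + c * \<nu> d1 0" for d1
    proof -
      have "0 \<le> c * \<nu> d1 0" using c(1) \<nu>0[of d1 0] by (intro mult_nonneg_nonneg) auto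
      then show ?thesis using in1[of d1] in2[of d1] by auto
    qed
    then have "(\<Sum>d1<D. \<Sum>d2<D. \<nu> d1 d2) \<le> (\<Sum>d1<D. (if 2 ^ d1 \<le> N then 2 * c else 0) + c * \<nu> d1 0)" by (rule sum_mono)
    also have "\<dots> = m * (2 * c) + c * (\<Sum>d1<D. \<nu> d1 0)" by (simp only: sum.distrib cnt sum_distrib_left)
    also have "\<dots> \<le> m * (2 * c) + c * (2 * c)" using in0 c by (intro add_left_mono mult_left_mono) auto
    finally show ?thesis by (simp add: power2_eq_square)
  qed
  have S3: "(\<Sum>d1<D. \<Sum>d2<D. if 2 ^ d1 \<le> N then (1 / 2 ^ d2) powr \<epsilon> else 0) \<le> m * c"
  proof -
    have "(\<Sum>d2<D. if 2 ^ d1 \<le> N then (1 / 2 ^ d2) powr \<epsilon> else 0) \<le> (if 2 ^ d1 \<le> N then c else 0)" for d1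
      using geo[of D] by simp
    then have "(\<Sum>d1<D. \<Sum>d2<D. if 2 ^ d1 \<le> N then (1 / 2 ^ d2) powr \<epsilon> else 0) \<le> (\<Sum>d1<D. if 2 ^ d1 \<le> N then c else 0)"
      by (rule sum_mono)
    then show ?thesis unfolding cnt .
  qed
  have S2: "(\<Sum>d1<D. \<Sum>d2<D. if 2 ^ d2 \<le> N then (1 / 2 ^ d1) powr \<epsilon> else 0) \<le> m * c"
    using S3 by (subst sum.swap)
  have "(\<Sum>d1<D. \<Sum>d2<D. decay \<epsilon> N d1 d2) \<le> m * (4 * c) + 2 * c\<^sup>2"
    unfolding decay_def \<nu>_def[symmetric] sum.distrib using S1 S2 S3 by simp
  also have "\<dots> \<le> (8 * c + 2 * c\<^sup>2) * ln (2 * N)"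
  proof -
    \<comment> \<open>For \<open>N \<ge> 2\<close> the logarithm \<open>ln (2 * N)\<close> is at
      least 1 and absorbs the constant term.\<close>
    have l2: "ln 2 \<ge> (1/2 :: real)" using ln2_ge_two_thirds by linarith
    have "ln 4 = 2 * ln (2::real)" using ln_realpow[of 2 2] by simp
    moreover have "ln 4 \<le> ln (2 * N)" using N by simp
    ultimately have ln1: "ln (2 * N) \<ge> 1" using l2 by linarith
    have "m \<le> log 2 N + 1" unfolding m_def using N by (intro card_powers_le) simp
    also have "\<dots> = ln (2 * N) / ln 2" using N by (simp add: log_def ln_mult add_divide_distrib)
    also have "\<dots> \<le> ln (2 * N) / (1 / 2)" using l2 ln1 by (intro divide_left_mono) auto
    finally have "m * (4 * c) \<le> 2 * ln (2 * N) * (4 * c)" using c by (intro mult_right_mono) auto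
    moreover have "2 * c\<^sup>2 * 1 \<le> 2 * c\<^sup>2 * ln (2 * N)" using ln1 by (intro mult_left_mono) auto
    ultimately show ?thesis by (simp add: algebra_simps)
  qed
  finally show ?thesis .
qed

section \<open>From block bounds to the Besov norm\<close>

lemma epowr_mono:
  assumes "x \<le> ennreal t" "0 \<le> t" "0 \<le> a"
  shows "epowr x a \<le> ennreal (t powr a)"
proof -
  have x: "x < top" by (rule le_less_trans[OF assms(1) ennreal_less_top])
  then have "enn2real x \<le> t" using enn2real_mono[OF assms(1)] assms(2) by simp
  then show ?thesis using x assms by (auto simp: epowr_def intro!: ennreal_leI powr_mono2)
qed

lemma Lp_norm_le:
  fixes h :: "'a::euclidean_space \<Rightarrow> complex"
  assumes p: "p \<noteq> \<infinity>" "enn2real p \<ge> 1" and g: "Lp_le (enn2real p) g A" and h: "\<And>x. norm (h x) \<le> g x"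
  shows "Lp_norm p h \<le> ennreal A"
proof -
  let ?P = "enn2real p"
  have A: "A \<ge> 0" by (rule Lp_leD(3)[OF g])
  have "(\<integral>\<^sup>+x. ennreal (norm (h x) powr ?P) \<partial>lborel) \<le> (\<integral>\<^sup>+x. ennreal (g x powr ?P) \<partial>lborel)"
    using h p by (intro nn_integral_mono ennreal_leI powr_mono2) auto
  also have "\<dots> \<le> ennreal (A powr ?P)" by (rule Lp_leD(4)[OF g])
  finally have "epowr (\<integral>\<^sup>+x. ennreal (norm (h x) powr ?P) \<partial>lborel) (1 / ?P) \<le> ennreal ((A powr ?P) powr (1 / ?P))"
    using p by (intro epowr_mono) auto
  also have "(A powr ?P) powr (1 / ?P) = A" using A p by (simp add: powr_powr)
  finally show ?thesis using p by (simp add: Lp_norm_def)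
qed

lemma Lp_norm_distr_le:
  assumes "represents_distr h T" and "Lp_norm p h \<le> A"
  shows "Lp_norm_distr p T \<le> A"
  unfolding Lp_norm_distr_def using assms by (auto intro: INF_lower2)

lemma measurable_discrepancy [measurable]:
  fixes P :: "(real ^ 2) multiset"
  shows "discrepancy P \<in> borel_measurable borel"
proof -
  have 1: "(\<lambda>t. indicator {y. \<forall>i. 0 \<le> y $ i \<and> y $ i < t $ i} z :: real) \<in> borel_measurable borel" for z :: "real ^ 2"
    unfolding indicator_def mem_Collect_eq forall_2 by measurable
  have "(\<lambda>t. \<Sum>x\<in>#Q. indicator {y. \<forall>i. 0 \<le> y $ i \<and> y $ i < t $ i} x :: real) \<in> borel_measurable borel" for Q :: "(real ^ 2) multiset"
    by (induction Q) (use 1 in \<open>auto intro!: borel_measurable_add\<close>)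
  then show ?thesis unfolding discrepancy_def[abs_def] UNIV_2 by simp
qed

lemma norm_discrepancy_le:
  fixes P :: "(real ^ 2) multiset"
  assumes t: "t \<in> unit_cube"
  shows "\<bar>discrepancy P t\<bar> \<le> 2"
proof -
  have S: "0 \<le> (\<Sum>x\<in>#Q. indicator A x :: real) \<and> (\<Sum>x\<in>#Q. indicator A x :: real) \<le> real (size Q)"
    for A and Q :: "(real ^ 2) multiset"
    by (induction Q) (auto simp: indicator_def)
  let ?S = "\<Sum>x\<in>#P. indicator {y. \<forall>i. 0 \<le> y $ i \<and> y $ i < t $ i} x :: real"
  have "0 \<le> 1 / real (size P) * ?S" "1 / real (size P) * ?S \<le> 1"
    using S[of "{y. \<forall>i. 0 \<le> y $ i \<and> y $ i < t $ i}" P] by (auto simp: divide_le_eq)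
  moreover have "0 \<le> t $ 1 * t $ 2" "t $ 1 * t $ 2 \<le> 1"
    using t mult_mono[of "t $ 1" 1 "t $ 2" 1] by (auto simp: unit_cube_def less_imp_le)
  ultimately show ?thesis unfolding discrepancy_def by (simp add: UNIV_2)
qed

text \<open>Index functions on the type \<open>2\<close> are pairs, and every finite set of them
  lies in a square; bounds on square partial sums therefore control the unordered sum.\<close>

lemma sum_fun2_le:
  fixes f :: "nat \<Rightarrow> nat \<Rightarrow> real" and F :: "(2 \<Rightarrow> nat) set"
  assumes F: "finite F" and f: "\<And>i j. 0 \<le> f i j" and B: "\<And>D. (\<Sum>i<D. \<Sum>j<D. f i j) \<le> B"
  shows "(\<Sum>d\<in>F. f (d 1) (d 2)) \<le> B"
proof -
  let ?h = "\<lambda>d::2 \<Rightarrow> nat. (d 1, d 2)"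
  have inj: "inj_on ?h F" by (auto simp: inj_on_def fun_eq_iff forall_2)
  obtain D where D: "\<And>d. d \<in> F \<Longrightarrow> d 1 < D \<and> d 2 < D"
  proof
    fix d assume "d \<in> F"
    then have "d 1 \<le> Max ((\<lambda>d. d 1 + d 2) ` F)" "d 2 \<le> Max ((\<lambda>d. d 1 + d 2) ` F)"
      using F by (auto intro!: Max_ge_iff[THEN iffD2] bexI[of _ d])
    then show "d 1 < Suc (Max ((\<lambda>d. d 1 + d 2) ` F)) \<and> d 2 < Suc (Max ((\<lambda>d. d 1 + d 2) ` F))" by simp
  qed
  have "(\<Sum>d\<in>F. f (d 1) (d 2)) = (\<Sum>z\<in>?h ` F. f (fst z) (snd z))"
    by (simp add: sum.reindex[OF inj])
  also have "\<dots> \<le> (\<Sum>z\<in>{..<D} \<times> {..<D}. f (fst z) (snd z))"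
    using D f by (intro sum_mono2) auto
  also have "\<dots> = (\<Sum>i<D. \<Sum>j<D. f i j)" by (simp add: sum.cartesian_product case_prod_beta')
  also have "\<dots> \<le> B" by (rule B)
  finally show ?thesis .
qed

lemma flip_bij: "b > 0 \<Longrightarrow> bij_betw (flip b) {..<b} {..<b}"
  by (rule bij_betw_byWitness[where f' = "flip b"]) (auto simp: flip_def)

lemma bij_betw_digits:
  assumes b: "b \<ge> 2" and \<sigma>: "\<sigma> permutes {0..b - 1}" and \<Sigma>: "\<Sigma> \<in> {1..n} \<rightarrow> {\<sigma>, flip b \<circ> \<sigma>}" and i: "i \<in> {1..n}"
  shows "bij_betw (\<Sigma> i) {..<b} {..<b}"
proof -
  have e: "{0..b - 1} = {..<b}" using b by auto
  have \<sigma>b: "bij_betw \<sigma> {..<b} {..<b}" using permutes_imp_bij[OF \<sigma>] unfolding e .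
  have "bij_betw (flip b \<circ> \<sigma>) {..<b} {..<b}"
    using \<sigma>b flip_bij[of b] b by (intro bij_betw_trans) auto
  moreover have "\<Sigma> i = \<sigma> \<or> \<Sigma> i = flip b \<circ> \<sigma>" using \<Sigma> i by auto
  ultimately show ?thesis using \<sigma>b by auto
qed

context kernel_bounds
begin

text \<open>Joins three descriptions of a block: convolution of the discrepancy, quadrature error
  over the multiset, and \<open>sym_average\<close> over the radical inverse enumeration.\<close>

lemma frequency_block_norm:
  fixes d :: "2 \<Rightarrow> nat" and \<phi>\<^sub>0 :: "real \<Rightarrow> complex"
  assumes b: "b \<ge> 2" and \<Sigma>: "\<And>i. i \<in> {1..n} \<Longrightarrow> bij_betw (\<Sigma> i) {..<b} {..<b}"
    and p: "p \<noteq> \<infinity>" "enn2real p \<ge> 1"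
    and k: "\<And>j. k j = kernel \<phi>\<^sub>0 j" and dI: "\<And>j. integrable lborel (dyadic_cutoff \<phi>\<^sub>0 j)"
  shows "Lp_norm_distr p (frequency_block \<phi>\<^sub>0 d (regular_distr unit_cube (\<lambda>t. of_real (discrepancy (sym_hammersley b n \<Sigma>) t))))
     \<le> ennreal (block_const b * block_rate (enn2real p) (real b ^ n) (d 1) (d 2))"
proof -
  let ?P = "sym_hammersley b n \<Sigma>" and ?\<pi> = "inv_digit b n \<Sigma>"
  have b0: "b > 0" using b by simp
  have \<pi>: "bij_betw (?\<pi> j) {..<b} {..<b}" for j by (rule inv_digit_bij) (rule \<Sigma>)
  have ck: "continuous_on UNIV (kernel \<phi>\<^sub>0 j)" for j
  proof -
    have "continuous_on UNIV (\<lambda>z. - k j (0 - z))" by (rule C1_funD(3)[OF H_C1])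
    then have "continuous_on UNIV (\<lambda>z. k j (- z))" using continuous_on_minus[of UNIV "\<lambda>z. - k j (0 - z)"] by simp
    then have "continuous_on UNIV (\<lambda>z. k j (- (- z)))"
      by (rule continuous_on_compose2) (auto intro: continuous_intros)
    then show ?thesis by (simp add: k)
  qed
  have bk: "\<exists>B. \<forall>w. norm (kernel \<phi>\<^sub>0 j w) \<le> B" for j
  proof (intro exI allI)
    fix w
    have "C * 2 ^ j * peak (2 ^ j * w) \<le> C * 2 ^ j * 1" using C peak_bounds by (intro mult_left_mono) auto
    then show "norm (kernel \<phi>\<^sub>0 j w) \<le> C * 2 ^ j" using k_le[of j w] by (simp add: k)
  qed
  let ?D = "\<lambda>t. complex_of_real (discrepancy ?P t)"
  let ?h = "\<lambda>y. LINT x:unit_cube|lborel. ?D x * kernel2 \<phi>\<^sub>0 d (y - x)"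
  have rep: "represents_distr ?h (frequency_block \<phi>\<^sub>0 d (regular_distr unit_cube ?D))"
  proof (rule frequency_block_represents[OF dI ck bk])
    show "?D \<in> borel_measurable borel" by simp
    show "norm (?D x) \<le> 2" if "x \<in> unit_cube" for x using norm_discrepancy_le[OF that] by simp
  qed
  obtain g where g: "Lp_le (enn2real p) g (block_const b * block_rate (enn2real p) (real b ^ n) (d 1) (d 2))"
    and gb: "\<And>w::real ^ 2. norm (sym_average b n ?\<pi> (\<lambda>t. H (d 1) (w $ 1) t - H (d 1) (w $ 1) 1) (\<lambda>t. H (d 2) (w $ 2) t - H (d 2) (w $ 2) 1)
          - (integral {0..1} (H (d 1) (w $ 1)) - H (d 1) (w $ 1) 1) * (integral {0..1} (H (d 2) (w $ 2)) - H (d 2) (w $ 2) 1)) \<le> g w"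
  proof -
    have "\<exists>g. Lp_le (enn2real p) g (block_const b * block_rate (enn2real p) (real b ^ n) (d 1) (d 2)) \<and>
       (\<forall>w::real ^ 2. norm (sym_average b n ?\<pi> (\<lambda>t. H (d 1) (w $ 1) t - H (d 1) (w $ 1) 1) (\<lambda>t. H (d 2) (w $ 2) t - H (d 2) (w $ 2) 1)
          - (integral {0..1} (H (d 1) (w $ 1)) - H (d 1) (w $ 1) 1) * (integral {0..1} (H (d 2) (w $ 2)) - H (d 2) (w $ 2) 1)) \<le> g w)"
      by (rule block_bound[OF b p(2) \<pi>])
    then show thesis using that by auto
  qed
  have h: "norm (?h w) \<le> g w" for w
  proof -
    have "?h w = (LINT x:unit_cube|lborel. of_real (discrepancy ?P x) * (k (d 1) (w $ 1 - x $ 1) * k (d 2) (w $ 2 - x $ 2)))"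
      by (simp add: kernel2_def k)
    also have "\<dots> = (\<Sum>z\<in>#?P. (H (d 1) (w $ 1) (z $ 1) - H (d 1) (w $ 1) 1) * (H (d 2) (w $ 2) (z $ 2) - H (d 2) (w $ 2) 1)) / of_nat (size ?P)
       - (integral {0..1} (H (d 1) (w $ 1)) - H (d 1) (w $ 1) 1) * (integral {0..1} (H (d 2) (w $ 2)) - H (d 2) (w $ 2) 1)"
    proof (rule discrepancy_convolution[OF H_C1 H_C1])
      show "set_mset ?P \<subseteq> unit_cube" by (rule sum_sym_hammersley(3)[OF b0 \<Sigma>])
    qed
    also have "(\<Sum>z\<in>#?P. (H (d 1) (w $ 1) (z $ 1) - H (d 1) (w $ 1) 1) * (H (d 2) (w $ 2) (z $ 2) - H (d 2) (w $ 2) 1)) / of_nat (size ?P)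
       = sym_average b n ?\<pi> (\<lambda>t. H (d 1) (w $ 1) t - H (d 1) (w $ 1) 1) (\<lambda>t. H (d 2) (w $ 2) t - H (d 2) (w $ 2) 1)"
    proof -
      have s: "size ?P = 2 * b ^ n" by (rule sum_sym_hammersley(2)[OF b0 \<Sigma>])
      have S: "(\<Sum>z\<in>#?P. f z) = (\<Sum>u<b ^ n. f (vec2 (real u / real b ^ n, radinv b ?\<pi> n u))) +
        (\<Sum>u<b ^ n. f (vec2 (1 - (real u + 1) / real b ^ n, radinv b ?\<pi> n u)))" for f :: "real ^ 2 \<Rightarrow> complex"
        by (rule sum_sym_hammersley(1)[OF b0 \<Sigma>])
      show ?thesis unfolding S s sym_average_def vec2_nth fst_conv snd_conv by simp
    qed
    finally show ?thesis using gb[of w] by simp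
  qed
  show ?thesis by (rule Lp_norm_distr_le[OF rep Lp_norm_le[OF p g h]])
qed

end

text \<open>Weights of at most 1 satisfy \<open>w powr Q \<le> w\<close> for
  \<open>Q \<ge> 1\<close>, so a single bound on their sum serves every finite \<open>q\<close>, and
  the bound by 1 serves \<open>q = \<infinity>\<close>.\<close>

lemma besov_norm_le:
  fixes T :: "(real ^ 2) distr" and w :: "nat \<Rightarrow> nat \<Rightarrow> real"
  assumes q: "1 \<le> q" and A: "0 \<le> A"
    and block: "\<And>d. Lp_norm_distr p (frequency_block \<phi>\<^sub>0 d T) \<le> ennreal (B d)" "\<And>d. 0 \<le> B d"
    and w: "\<And>d. 2 powr (r * real (d 1 + d 2)) * B d \<le> A * w (d 1) (d 2)"
    and w01: "\<And>i j. 0 \<le> w i j" "\<And>i j. w i j \<le> 1"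
    and S: "\<And>D. (\<Sum>i<D. \<Sum>j<D. w i j) \<le> S"
  shows "besov_norm \<phi>\<^sub>0 p q r T \<le> ennreal (A * (if q = \<infinity> then 1 else S powr (1 / enn2real q)))"
proof (cases "q = \<infinity>")
  case True
  have "ennreal (2 powr (r * real (\<Sum>i\<in>UNIV. d i))) * Lp_norm_distr p (frequency_block \<phi>\<^sub>0 d T) \<le> ennreal A" for d
  proof -
    have "ennreal (2 powr (r * real (\<Sum>i\<in>UNIV. d i))) * Lp_norm_distr p (frequency_block \<phi>\<^sub>0 d T)
        \<le> ennreal (2 powr (r * real (d 1 + d 2))) * ennreal (B d)"
      unfolding sum_2 by (intro mult_left_mono block) simp
    also have "\<dots> = ennreal (2 powr (r * real (d 1 + d 2)) * B d)" by (simp add: ennreal_mult' block)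
    also have "\<dots> \<le> ennreal (A * 1)"
      by (intro ennreal_leI order_trans[OF w] mult_left_mono w01 A)
    finally show ?thesis by simp
  qed
  then show ?thesis using True by (simp add: besov_norm_def SUP_le_iff)
next
  case False
  define Q where "Q = enn2real q"
  have Q: "Q \<ge> 1" unfolding Q_def using enn2real_mono[OF q] False by (simp add: less_top)
  have S0: "0 \<le> S" using S[of 0] by simp
  have term1: "ennreal (2 powr (r * real (\<Sum>i\<in>UNIV. d i) * Q)) * epowr (Lp_norm_distr p (frequency_block \<phi>\<^sub>0 d T)) Q
      \<le> ennreal (A powr Q * w (d 1) (d 2))" for d
  proof -
    have "ennreal (2 powr (r * real (\<Sum>i\<in>UNIV. d i) * Q)) * epowr (Lp_norm_distr p (frequency_block \<phi>\<^sub>0 d T)) Q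
        \<le> ennreal (2 powr (r * real (d 1 + d 2) * Q)) * ennreal (B d powr Q)"
      unfolding sum_2 using Q by (intro mult_left_mono epowr_mono block) auto
    also have "\<dots> = ennreal ((2 powr (r * real (d 1 + d 2)) * B d) powr Q)"
      using block(2)[of d] by (simp add: ennreal_mult' powr_mult powr_powr)
    also have "\<dots> \<le> ennreal ((A * w (d 1) (d 2)) powr Q)"
      using Q block(2)[of d] w[of d] by (intro ennreal_leI powr_mono2) auto
    also have "(A * w (d 1) (d 2)) powr Q = A powr Q * w (d 1) (d 2) powr Q"
      using A w01 by (simp add: powr_mult)
    also have "ennreal \<dots> \<le> ennreal (A powr Q * w (d 1) (d 2))"
    proof (intro ennreal_leI mult_left_mono)
      show "w (d 1) (d 2) powr Q \<le> w (d 1) (d 2)"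
      proof (cases "w (d 1) (d 2) = 0")
        case False
        then have "0 < w (d 1) (d 2)" using w01(1)[of "d 1" "d 2"] by simp
        then show ?thesis using powr_le_of_le_one[of "w (d 1) (d 2)" 1 Q] w01(2) Q by simp
      qed simp
    qed simp
    finally show ?thesis .
  qed
  have "(\<Sum>\<^sub>\<infinity>d. ennreal (2 powr (r * real (\<Sum>i\<in>UNIV. d i) * Q)) * epowr (Lp_norm_distr p (frequency_block \<phi>\<^sub>0 d T)) Q)
      \<le> ennreal (A powr Q * S)"
  proof (rule infsum_le_finite_sums)
    show "(\<lambda>d. ennreal (2 powr (r * real (\<Sum>i\<in>UNIV. d i) * Q)) * epowr (Lp_norm_distr p (frequency_block \<phi>\<^sub>0 d T)) Q) summable_on UNIV"
      by (rule nonneg_summable_on_complete) simp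
    fix F :: "(2 \<Rightarrow> nat) set" assume F: "finite F"
    have "(\<Sum>d\<in>F. ennreal (2 powr (r * real (\<Sum>i\<in>UNIV. d i) * Q)) * epowr (Lp_norm_distr p (frequency_block \<phi>\<^sub>0 d T)) Q)
       \<le> (\<Sum>d\<in>F. ennreal (A powr Q * w (d 1) (d 2)))" by (intro sum_mono term1)
    also have "\<dots> = ennreal (A powr Q * (\<Sum>d\<in>F. w (d 1) (d 2)))"
      using w01 by (subst sum_ennreal) (auto simp: sum_distrib_left)
    also have "\<dots> \<le> ennreal (A powr Q * S)"
      by (intro ennreal_leI mult_left_mono sum_fun2_le[OF F w01(1) S]) simp
    finally show "(\<Sum>d\<in>F. ennreal (2 powr (r * real (\<Sum>i\<in>UNIV. d i) * Q)) * epowr (Lp_norm_distr p (frequency_block \<phi>\<^sub>0 d T)) Q)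
       \<le> ennreal (A powr Q * S)" .
  qed
  then have "besov_norm \<phi>\<^sub>0 p q r T \<le> ennreal ((A powr Q * S) powr (1 / Q))"
    using False Q S0 unfolding besov_norm_def Q_def[symmetric] by (simp add: epowr_mono)
  also have "(A powr Q * S) powr (1 / Q) = A * S powr (1 / Q)"
    using A S0 Q by (simp add: powr_mult powr_powr)
  finally show ?thesis using False by (simp add: Q_def)
qed

theorem theorem3:
  fixes p q :: ennreal and r :: real and b :: nat and \<sigma> :: "nat \<Rightarrow> nat"
    and \<phi>\<^sub>0 :: "real \<Rightarrow> complex"
  assumes "\<phi>\<^sub>0 \<in> schwartz"
    and "\<And>t. \<bar>t\<bar> \<le> 1 \<Longrightarrow> \<phi>\<^sub>0 t = 1"
    and "\<And>t. \<bar>t\<bar> > 3 / 2 \<Longrightarrow> \<phi>\<^sub>0 t = 0"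
    and "1 \<le> p" and "1 \<le> q"
    and "0 \<le> r" and "ennreal r < 1 / p"
    and "2 \<le> b" and "\<sigma> permutes {0..b - 1}"
  shows "\<exists>C::real. C > 0 \<and>
    (\<forall>n\<ge>1. \<forall>\<Sigma> \<in> {1..n} \<rightarrow> {\<sigma>, flip b \<circ> \<sigma>}.
       besov_norm_on unit_cube \<phi>\<^sub>0 p q r
         (regular_distr unit_cube
            (\<lambda>t. complex_of_real (discrepancy (sym_hammersley b n \<Sigma>) t)))
       \<le> ennreal (C * (2 * real b ^ n) powr (r - 1) *
            (if q = \<infinity> then 1 else ln (2 * real b ^ n) powr (1 / enn2real q))))"
proof -
  obtain C H \<kappa>' where "C > 0"
    and "\<And>d x. C1_fun (H d x) (\<lambda>z. - kernel \<phi>\<^sub>0 d (x - z))"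
    and "\<And>d x. C1_fun (\<lambda>z. - kernel \<phi>\<^sub>0 d (x - z)) (\<lambda>z. \<kappa>' d (x - z))"
    and "\<And>d x z. z \<in> {0..1} \<Longrightarrow> norm (H d x z) \<le> C * peak (2 ^ d * (x - z))"
    and "\<And>d w. norm (kernel \<phi>\<^sub>0 d w) \<le> C * 2 ^ d * peak (2 ^ d * w)"
    and "\<And>d w. norm (\<kappa>' d w) \<le> C * 4 ^ d * peak (2 ^ d * w)"
    by (rule kernel_family[OF assms(1-3)]) auto
  then interpret kernel_bounds "kernel \<phi>\<^sub>0" H \<kappa>' C by unfold_locales
  have dI: "integrable lborel (dyadic_cutoff \<phi>\<^sub>0 j)" for j
    by (rule dyadic_cutoff_integrable[OF C2_funD[OF schwartz_C2_fun[OF assms(1)]] assms(3)])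
  \<comment> \<open>\<open>1 / \<infinity>\<close> is \<open>0\<close>, and no extended nonnegative
    real lies below it.\<close>
  have p: "p \<noteq> \<infinity>" using assms(7) by auto
  define P where "P = enn2real p"
  have pP: "p = ennreal P" unfolding P_def using p by (simp add: less_top)
  have P: "P \<ge> 1" unfolding P_def using enn2real_mono[OF assms(4)] p by (simp add: less_top)
  have r: "r < 1 / P"
  proof -
    have "1 / p = ennreal (1 / P)" unfolding pP using P by (simp add: divide_ennreal flip: ennreal_1)
    then show ?thesis using assms(6,7) P by (simp add: ennreal_less_iff)
  qed
  \<comment> \<open>\<open>1 / P - r\<close> is the gain left by the smoothness,
    \<open>1 / 2\<close> the one of the square root in \<open>main_rate\<close>.\<close>
  define \<epsilon> where "\<epsilon> = min (1 / P - r) (1 / 2)"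
  have \<epsilon>: "0 < \<epsilon>" "\<epsilon> \<le> 1 / P - r" "\<epsilon> \<le> 1 / 2" using r unfolding \<epsilon>_def by linarith+
  define c where "c = 2 powr \<epsilon> / (2 powr \<epsilon> - 1)"
  \<comment> \<open>At least 1, so that \<open>K powr (1 / enn2real q) \<le> K\<close>.\<close>
  define K where "K = max 1 (8 * c + 2 * c\<^sup>2)"
  let ?C = "36 * block_const b * K"
  note bc = block_const_pos[OF assms(8)]
  have K: "K \<ge> 1" by (simp add: K_def)
  have main: "besov_norm_on unit_cube \<phi>\<^sub>0 p q r (regular_distr unit_cube (\<lambda>t. complex_of_real (discrepancy (sym_hammersley b n \<Sigma>) t)))
       \<le> ennreal (?C * (2 * real b ^ n) powr (r - 1) * (if q = \<infinity> then 1 else ln (2 * real b ^ n) powr (1 / enn2real q)))"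
    if n: "n \<ge> 1" and \<Sigma>: "\<Sigma> \<in> {1..n} \<rightarrow> {\<sigma>, flip b \<circ> \<sigma>}" for n \<Sigma>
  proof -
    let ?T = "regular_distr unit_cube (\<lambda>t. complex_of_real (discrepancy (sym_hammersley b n \<Sigma>) t))"
    define N where "N = real b ^ n"
    have "real b ^ 1 \<le> N" unfolding N_def using n assms(8) by (intro power_increasing) auto
    then have N: "N \<ge> 2" using assms(8) by simp
    \<comment> \<open>\<open>besov_norm_le\<close> asks for weights of at most 1 and
      \<open>decay\<close> is bounded by \<open>3\<close>, so the weights are
      \<open>decay / 3\<close>; with the \<open>6\<close> of \<open>weighted_block_rate\<close> this
      gives \<open>18\<close>.\<close>
    define A where "A = 18 * block_const b * N powr (r - 1)"
    have A: "A \<ge> 0" using bc by (simp add: A_def)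
    define B where "B d = block_const b * block_rate P N (d 1) (d 2)" for d :: "2 \<Rightarrow> nat"
    have Lb: "Lp_norm_distr p (frequency_block \<phi>\<^sub>0 d ?T) \<le> ennreal (B d)" for d
      unfolding B_def N_def P_def
    proof (rule frequency_block_norm)
      show "bij_betw (\<Sigma> i) {..<b} {..<b}" if "i \<in> {1..n}" for i
        by (rule bij_betw_digits[OF assms(8,9) \<Sigma> that])
      show "1 \<le> enn2real p" using P by (simp add: P_def)
    qed (use assms(8) p dI in auto)
    have dec: "0 \<le> decay \<epsilon> N i j / 3" "decay \<epsilon> N i j / 3 \<le> 1" for i j
      using decay_bounds[of N \<epsilon> i j] N \<epsilon> by auto
    have "besov_norm \<phi>\<^sub>0 p q r ?T \<le> ennreal (A * (if q = \<infinity> then 1 else (K * ln (2 * N)) powr (1 / enn2real q)))"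
    proof (rule besov_norm_le[OF assms(5) A Lb, where w = "\<lambda>i j. decay \<epsilon> N i j / 3"])
      fix d :: "2 \<Rightarrow> nat"
      show "0 \<le> B d"
        using bc N unfolding B_def block_rate_def main_rate_def mean_rate_def by (auto intro!: mult_nonneg_nonneg add_nonneg_nonneg)
      have "2 powr (r * real (d 1 + d 2)) = (2 ^ d 1 * 2 ^ d 2) powr r"
        by (simp add: powr_powr powr_mult powr_add distrib_left mult.commute flip: powr_realpow)
      then have "2 powr (r * real (d 1 + d 2)) * B d = block_const b * ((2 ^ d 1 * 2 ^ d 2) powr r * block_rate P N (d 1) (d 2))"
        by (simp add: B_def)
      also have "\<dots> \<le> block_const b * (6 * N powr (r - 1) * decay \<epsilon> N (d 1) (d 2))"
        using bc N r P assms(6) \<epsilon> by (intro mult_left_mono weighted_block_rate) auto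
      finally show "2 powr (r * real (d 1 + d 2)) * B d \<le> A * (decay \<epsilon> N (d 1) (d 2) / 3)" by (simp add: A_def)
    next
      fix D
      have "(\<Sum>i<D. \<Sum>j<D. decay \<epsilon> N i j / 3) = (\<Sum>i<D. \<Sum>j<D. decay \<epsilon> N i j) / 3"
        by (simp add: sum_divide_distrib)
      also have "\<dots> \<le> (\<Sum>i<D. \<Sum>j<D. decay \<epsilon> N i j)"
        using decay_bounds(1)[of N \<epsilon>] N \<epsilon> by (intro divide_le_eq_numeral1(1)[THEN iffD2]) (auto intro!: sum_nonneg)
      also have "\<dots> \<le> (8 * c + 2 * c\<^sup>2) * ln (2 * N)" unfolding c_def by (rule sum_decay_le[OF N \<epsilon>(1)])
      also have "\<dots> \<le> K * ln (2 * N)" using N by (intro mult_right_mono) (auto simp: K_def)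
      finally show "(\<Sum>i<D. \<Sum>j<D. decay \<epsilon> N i j / 3) \<le> K * ln (2 * N)" .
    qed (rule dec)+
    also have "A * (if q = \<infinity> then 1 else (K * ln (2 * N)) powr (1 / enn2real q))
        \<le> ?C * (2 * N) powr (r - 1) * (if q = \<infinity> then 1 else ln (2 * N) powr (1 / enn2real q))"
    proof -
      have "A \<le> 36 * block_const b * (2 * N) powr (r - 1)"
      proof -
        \<comment> \<open>As \<open>r \<ge> 0\<close>, replacing \<open>N\<close> by
          \<open>2 * N\<close> in the power costs a factor of at most \<open>2\<close>, hence
          \<open>36\<close>.\<close>
        have "1 / 2 = 2 powr (-1 :: real)" by (simp add: powr_minus)
        also have "\<dots> \<le> 2 powr (r - 1)" using assms(6) by (intro powr_mono) auto
        finally have "1 * N powr (r - 1) \<le> (2 * 2 powr (r - 1)) * N powr (r - 1)" by (intro mult_right_mono) auto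
        then have "N powr (r - 1) \<le> 2 * (2 * N) powr (r - 1)" using N by (simp add: powr_mult)
        then have "18 * block_const b * N powr (r - 1) \<le> 18 * block_const b * (2 * (2 * N) powr (r - 1))"
          using bc by (intro mult_left_mono) auto
        then show ?thesis by (simp add: A_def)
      qed
      moreover have "(if q = \<infinity> then 1 else (K * ln (2 * N)) powr (1 / enn2real q))
          \<le> K * (if q = \<infinity> then 1 else ln (2 * N) powr (1 / enn2real q))"
      proof (cases "q = \<infinity>")
        case False
        have "enn2real q \<ge> 1" using enn2real_mono[OF assms(5)] False by (simp add: less_top)
        then have "K powr (1 / enn2real q) \<le> K powr 1" using K by (intro powr_mono) auto
        then have "K powr (1 / enn2real q) * ln (2 * N) powr (1 / enn2real q) \<le> K * ln (2 * N) powr (1 / enn2real q)"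
          using K by (intro mult_right_mono) auto
        then show ?thesis using False K N by (simp add: powr_mult)
      qed (use K in simp)
      ultimately have "A * (if q = \<infinity> then 1 else (K * ln (2 * N)) powr (1 / enn2real q))
         \<le> (36 * block_const b * (2 * N) powr (r - 1)) * (K * (if q = \<infinity> then 1 else ln (2 * N) powr (1 / enn2real q)))"
        using bc by (intro mult_mono) auto
      then show ?thesis by (simp add: mult_ac)
    qed
    finally have bn: "besov_norm \<phi>\<^sub>0 p q r ?T
       \<le> ennreal (?C * (2 * N) powr (r - 1) * (if q = \<infinity> then 1 else ln (2 * N) powr (1 / enn2real q)))"
      by (simp add: ennreal_leI)
    \<comment> \<open>The functional \<open>?T\<close> integrates over the unit cube only and is
      thus its own extension by zero.\<close>
    have "tempered_distribution ?T"
      by (rule regular_distr_tempered[where Bh = 2]) (auto intro: norm_discrepancy_le)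
    then have "?T \<in> besov_space \<phi>\<^sub>0 p q r"
      using le_less_trans[OF bn ennreal_less_top] by (simp add: besov_space_def)
    then have "besov_norm_on unit_cube \<phi>\<^sub>0 p q r ?T \<le> besov_norm \<phi>\<^sub>0 p q r ?T"
      unfolding besov_norm_on_def by (intro INF_lower) (auto simp: restricts_to_def)
    then show ?thesis using bn unfolding N_def by (rule order_trans)
  qed
  show ?thesis using main bc K by (intro exI[of _ ?C]) auto
qed

end
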